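(* Let $(E,\mathcal{B})$ be a Lusin measurable space and let $X=(\Omega,\mathcal{F},\mathcal{F}_t,X_t,\theta_t,\mathbb{P}^x)$ be a conservative right Markov process with state space $E$ and associated resolvent $\mathcal{U}=(U_q)_{q>0}$, i.e. $\mathcal{U}$ is a sub-Markovian resolvent of kernels on $(E,\mathcal{B})$ with $$U_qf(x)=\mathbb{E}^x\int_0^\infty e^{-qt}f(X_t)\,dt\qquad\text{for all bounded } \mathcal{B}\text{-measurable } f,\ x\in E,\ q>0.$$ Let $N\in\mathcal{B}$ be a $\mathcal{U}$-negligible set which is not polar, put $F:=E\setminus N$, and let $\mathcal{U}'=(U'_q)_{q>0}$ be the restriction of $\mathcal{U}$ from $E$ to $F$. Then there exists no right Markov process with state space $(F,\mathcal{B}|_F)$ having resolvent $\mathcal{U}'=(U'_q)_{q>0}$.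
   Context: A Lusin topological space is a topological space homeomorphic to a Borel subset of a compact metric space; a Lusin measurable space is a measurable space $(E,\mathcal{B})$ such that $\mathcal{B}$ is the Borel $\sigma$-algebra of some Lusin topology on $E$. A sub-Markovian resolvent of kernels is a family $(U_q)_{q>0}$ of kernels on $(E,\mathcal{B})$ with $U_p-U_q=(q-p)U_pU_q$ for $0<p<q$ and $qU_q1\le1$. Excessive functions: for $\beta>0$, a $\mathcal{B}$-measurable function $u:E\to[0,\infty]$ is $\mathcal{U}_\beta$-excessive if $qU_{\beta+q}u\le u$ for all $q>0$ and $\lim_{q\to\infty}qU_{\beta+q}u(x)=u(x)$ for all $x\in E$. Right Markov process: a right Markov process with state space $(E,\mathcal{B})$ and resolvent $\mathcal{U}$ is a normal ($\mathbb{P}^x(X_0=x)=1$), temporally homogeneous Markov process $X=(\Omega,\mathcal{F},\mathcal{F}_t,X_t,\theta_t,\mathbb{P}^x)$, $x\in E$, with shift operators $\theta_t$ (possibly with a lifetime $\zeta$ after which it stays at a cemetery point, functions being extended by $0$ there; conservative means $\zeta=\infty$ a.s.), satisfying $U_qf(x)=\mathbb{E}^x\int_0^\infty e^{-qt}f(X_t)\,dt$, and such that: (i) the filtration $(\mathcal{F}_t)$ is right-continuous and augmented, i.e. $\mathcal{F}_t=\bigcap_\mu\mathcal{F}_t^\mu$, where $\mu$ runs over all probability measures on $(E,\mathcal{B})$, $\mathbb{P}^\mu=\int\mathbb{P}^x\mu(dx)$, and $\mathcal{F}_t^\mu$ is the completion of $\mathcal{F}_t$ with respect to $\mathbb{P}^\mu$;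 (ii) for one (hence all) $\beta>0$ and every $\mathcal{U}_\beta$-excessive function $u$, the process $t\mapsto u(X_t)$ is right-continuous $\mathbb{P}^x$-a.s. for all $x\in E$; (iii) there exists a Lusin topology on $E$ with Borel $\sigma$-algebra exactly $\mathcal{B}$ with respect to which the paths of $X$ are right-continuous $\mathbb{P}^x$-a.s. for all $x\in E$. No specific topology on the state space is prescribed; the non-existence in the claim is with respect to any Lusin topology on $F$ whose Borel $\sigma$-algebra is $\mathcal{B}|_F$. Negligible: $N\in\mathcal{B}$ is $\mathcal{U}$-negligible if $U_q(1_N)\equiv0$ for one (equivalently all) $q>0$. Polar: $N\in\mathcal{B}$ is polar (for the right process $X$) if $\mathbb{P}^x(T_N<\infty)=0$ for all $x\in E$, where $T_N=\inf\{t>0:X_t\in N\}$. Restriction: for a $\mathcal{U}$-negligible $N$ and $F=E\setminus N$, $U'_qg:=(U_q\overline g)|_F$ for every nonnegative $\mathcal{B}|_F$-measurable $g$ on $F$, where $\overline g$ is any nonnegative $\mathcal{B}$-measurable extension of $g$ to $E$; $\mathcal{U}'=(U'_q)_{q>0}$ is a sub-Markovian resolvent of kernels on $(F,\mathcal{B}|_F)$. *)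

theory Defs
  imports "HOL-Probability.Probability"
begin

text \<open>A measurable space is a value of type \<open>'a measure\<close> of which only the carrier and the
  \<open>\<sigma>\<close>-algebra are used.\<close>

section \<open>Lusin spaces\<close>

definition borel_sets_of :: "'a topology \<Rightarrow> 'a set set" where
  "borel_sets_of T = sigma_sets (topspace T) {V. openin T V}"

text \<open>HOL cannot quantify existentially over the type carrying the compact metric space.  A compact
  metric space has at most the cardinality of the continuum, so up to isometry its points may be
  taken to be real numbers; the metric \<open>m\<close> below is an arbitrary abstract one, on an arbitrary set
  of reals, unrelated to the usual distance.\<close>

definition lusin_topology :: "'a topology \<Rightarrow> bool" where
  "lusin_topology T \<longleftrightarrow>
     (\<exists>(m :: real metric) B. compact_space (mtopology_of m) \<and>
        B \<in> borel_sets_of (mtopology_of m) \<and>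
        T homeomorphic_space subtopology (mtopology_of m) B)"

definition lusin_topology_on :: "'a measure \<Rightarrow> 'a topology \<Rightarrow> bool" where
  "lusin_topology_on M T \<longleftrightarrow>
     lusin_topology T \<and> topspace T = space M \<and> sets M = borel_sets_of T"

definition lusin_measurable_space :: "'a measure \<Rightarrow> bool" where
  "lusin_measurable_space M \<longleftrightarrow> (\<exists>T. lusin_topology_on M T)"


section \<open>Resolvents of kernels\<close>

text \<open>The library's kernels, valued in \<open>subprob_algebra\<close>, have total mass at most one,
  which is too restrictive for resolvents.\<close>

definition kernel_on :: "'a measure \<Rightarrow> ('a \<Rightarrow> 'a measure) \<Rightarrow> bool" where
  "kernel_on M K \<longleftrightarrow>
     (\<forall>x\<in>space M. sets (K x) = sets M) \<and>
     (\<forall>A\<in>sets M. (\<lambda>x. emeasure (K x) A) \<in> borel_measurable M)"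

definition kernel_apply :: "('a \<Rightarrow> 'a measure) \<Rightarrow> ('a \<Rightarrow> ennreal) \<Rightarrow> 'a \<Rightarrow> ennreal" where
  "kernel_apply K f x = (\<integral>\<^sup>+ y. f y \<partial>K x)"

text \<open>Subtraction on \<open>ennreal\<close> being truncated, \<open>U p - U q = (q - p) U p U q\<close> is written additively;
  the kernels are finite by the last condition.\<close>

definition sub_markov_resolvent :: "'a measure \<Rightarrow> (real \<Rightarrow> 'a \<Rightarrow> 'a measure) \<Rightarrow> bool" where
  "sub_markov_resolvent M U \<longleftrightarrow>
     (\<forall>q>0. kernel_on M (U q)) \<and>
     (\<forall>p q. 0 < p \<and> p < q \<longrightarrow>
        (\<forall>f\<in>borel_measurable M. \<forall>x\<in>space M.
           kernel_apply (U p) f x =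
             kernel_apply (U q) f x
             + ennreal (q - p) * kernel_apply (U p) (kernel_apply (U q) f) x)) \<and>
     (\<forall>q>0. \<forall>x\<in>space M. ennreal q * kernel_apply (U q) (\<lambda>_. 1) x \<le> 1)"

definition excessive ::
    "'a measure \<Rightarrow> (real \<Rightarrow> 'a \<Rightarrow> 'a measure) \<Rightarrow> real \<Rightarrow> ('a \<Rightarrow> ennreal) \<Rightarrow> bool" where
  "excessive M U \<beta> u \<longleftrightarrow>
     u \<in> borel_measurable M \<and>
     (\<forall>q>0. \<forall>x\<in>space M. ennreal q * kernel_apply (U (\<beta> + q)) u x \<le> u x) \<and>
     (\<forall>x\<in>space M. ((\<lambda>q. ennreal q * kernel_apply (U (\<beta> + q)) u x) \<longlongrightarrow> u x) at_top)"

definition negligible_set :: "'a measure \<Rightarrow> (real \<Rightarrow> 'a \<Rightarrow> 'a measure) \<Rightarrow> 'a set \<Rightarrow> bool" where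
  "negligible_set M U N \<longleftrightarrow>
     N \<in> sets M \<and> (\<exists>q>0. \<forall>x\<in>space M. kernel_apply (U q) (indicator N) x = 0)"

text \<open>Integrating \<open>g\<close> against \<open>restrict_space (U q x) F\<close> is integrating the extension of \<open>g\<close> by zero
  against \<open>U q x\<close>.  Lemma \<open>kernel_apply_restrict_resolvent\<close> shows that any other measurable
  extension gives the same value.\<close>

definition restrict_resolvent ::
    "'a set \<Rightarrow> (real \<Rightarrow> 'a \<Rightarrow> 'a measure) \<Rightarrow> real \<Rightarrow> 'a \<Rightarrow> 'a measure" where
  "restrict_resolvent F U = (\<lambda>q x. restrict_space (U q x) F)"


section \<open>Markov processes with a lifetime\<close>

text \<open>Paths take values in \<open>'a option\<close>; \<open>None\<close> is the cemetery point.  Only times \<open>t \<ge> 0\<close> matter.\<close>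

definition adjoin_cemetery :: "'a measure \<Rightarrow> 'a option measure" where
  "adjoin_cemetery M = sigma (insert None (Some ` space M)) {Some ` A | A. A \<in> sets M}"

definition extend0 :: "('a \<Rightarrow> ennreal) \<Rightarrow> 'a option \<Rightarrow> ennreal" where
  "extend0 f z = (case z of None \<Rightarrow> 0 | Some y \<Rightarrow> f y)"

definition lifetime :: "(real \<Rightarrow> 'w \<Rightarrow> 'a option) \<Rightarrow> 'w \<Rightarrow> ennreal" where
  "lifetime X w = Inf {ennreal t | t. 0 \<le> t \<and> X t w = None}"

definition hitting_time :: "(real \<Rightarrow> 'w \<Rightarrow> 'a option) \<Rightarrow> 'a set \<Rightarrow> 'w \<Rightarrow> ennreal" where
  "hitting_time X N w = Inf {ennreal t | t. 0 < t \<and> X t w \<in> Some ` N}"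

definition universally_measurable :: "'a measure \<Rightarrow> ('a \<Rightarrow> ennreal) \<Rightarrow> bool" where
  "universally_measurable M f \<longleftrightarrow>
     (\<forall>\<mu>. prob_space \<mu> \<and> sets \<mu> = sets M \<longrightarrow> f \<in> borel_measurable (completion \<mu>))"

text \<open>\<open>\<G>\<close> is the \<open>\<sigma>\<close>-algebra \<open>\<F>\<close> (and sample space) of the underlying
  \<open>(\<Omega>, \<F>)\<close>, and \<open>\<F> t\<close> is the filtration.  Universal measurability of \<open>x \<mapsto> P x A\<close> is
  what makes the mixtures of the laws \<open>P x\<close> well defined.\<close>

locale markov_process =
  fixes M :: "'a measure"
    and \<G> :: "'w measure"
    and \<F> :: "real \<Rightarrow> 'w measure"
    and X :: "real \<Rightarrow> 'w \<Rightarrow> 'a option"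
    and \<theta> :: "real \<Rightarrow> 'w \<Rightarrow> 'w"
    and P :: "'a \<Rightarrow> 'w measure"
  assumes prob_space_P: "\<And>x. x \<in> space M \<Longrightarrow> prob_space (P x)"
    and sets_P: "\<And>x. x \<in> space M \<Longrightarrow> sets (P x) = sets \<G>"
    and universally_measurable_P:
      "\<And>A. A \<in> sets \<G> \<Longrightarrow> universally_measurable M (\<lambda>x. emeasure (P x) A)"
    and subalgebra_filtration: "\<And>t. 0 \<le> t \<Longrightarrow> subalgebra \<G> (\<F> t)"
    and filtration_mono: "\<And>s t. 0 \<le> s \<Longrightarrow> s \<le> t \<Longrightarrow> sets (\<F> s) \<subseteq> sets (\<F> t)"
    and adapted: "\<And>t. 0 \<le> t \<Longrightarrow> X t \<in> \<F> t \<rightarrow>\<^sub>M adjoin_cemetery M"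
    and cemetery:
      "\<And>t w. 0 \<le> t \<Longrightarrow> w \<in> space \<G> \<Longrightarrow> X t w = None \<longleftrightarrow> lifetime X w \<le> ennreal t"
    and normal: "\<And>x. x \<in> space M \<Longrightarrow> AE w in P x. X 0 w = Some x"
    and shift_in_space: "\<And>t w. 0 \<le> t \<Longrightarrow> w \<in> space \<G> \<Longrightarrow> \<theta> t w \<in> space \<G>"
    and shift:
      "\<And>s t w. 0 \<le> s \<Longrightarrow> 0 \<le> t \<Longrightarrow> w \<in> space \<G> \<Longrightarrow> X s (\<theta> t w) = X (s + t) w"
    and markov:
      "\<And>s t f x. 0 \<le> s \<Longrightarrow> 0 \<le> t \<Longrightarrow> f \<in> borel_measurable M \<Longrightarrow> x \<in> space M \<Longrightarrow>
         AE w in P x.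
           nn_cond_exp (P x) (\<F> t) (\<lambda>v. extend0 f (X (t + s) v)) w =
           extend0 (\<lambda>y. \<integral>\<^sup>+ v. extend0 f (X s v) \<partial>P y) (X t w)"

definition mixture :: "'w measure \<Rightarrow> ('a \<Rightarrow> 'w measure) \<Rightarrow> 'a measure \<Rightarrow> 'w measure" where
  "mixture \<G> P \<mu> =
     measure_of (space \<G>) (sets \<G>) (\<lambda>A. \<integral>\<^sup>+ x. emeasure (P x) A \<partial>completion \<mu>)"

text \<open>The resolvent condition is stated for \<open>[0,\<infinity>]\<close>-valued \<open>f\<close>, which is equivalent to
  bounded \<open>f\<close> by linearity and monotone convergence.  In the last condition, beyond the lifetime
  the path is constant, so right-continuity is only required before it.\<close>

locale right_process = markov_process M \<G> \<F> X \<theta> P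
  for M :: "'a measure"
    and \<G> :: "'w measure"
    and \<F> :: "real \<Rightarrow> 'w measure"
    and X :: "real \<Rightarrow> 'w \<Rightarrow> 'a option"
    and \<theta> :: "real \<Rightarrow> 'w \<Rightarrow> 'w"
    and P :: "'a \<Rightarrow> 'w measure" +
  fixes U :: "real \<Rightarrow> 'a \<Rightarrow> 'a measure"
  assumes resolvent:
      "\<And>q f x. 0 < q \<Longrightarrow> f \<in> borel_measurable M \<Longrightarrow> x \<in> space M \<Longrightarrow>
         kernel_apply (U q) f x =
           (\<integral>\<^sup>+ w. (\<integral>\<^sup>+ t\<in>{0..}. ennreal (exp (- q * t)) * extend0 f (X t w) \<partial>lborel) \<partial>P x)"
    and filtration_right_continuous:
      "\<And>t. 0 \<le> t \<Longrightarrow> sets (\<F> t) = (\<Inter>s\<in>{t<..}. sets (\<F> s))"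
    and filtration_augmented:
      "\<And>t. 0 \<le> t \<Longrightarrow> sets (\<F> t) =
         {A. A \<subseteq> space \<G> \<and>
             (\<forall>\<mu>. prob_space \<mu> \<and> sets \<mu> = sets M \<longrightarrow>
                A \<in> sets (completion (restr_to_subalg (mixture \<G> P \<mu>) (\<F> t))))}"
    and excessive_right_continuous:
      "\<exists>\<beta>>0. \<forall>u. excessive M U \<beta> u \<longrightarrow>
         (\<forall>x\<in>space M. AE w in P x. \<forall>t\<ge>0. continuous (at_right t) (\<lambda>s. extend0 u (X s w)))"
    and paths_right_continuous:
      "\<exists>T. lusin_topology_on M T \<and>
         (\<forall>x\<in>space M. AE w in P x. \<forall>t\<ge>0. ennreal t < lifetime X w \<longrightarrow>
            limitin T (\<lambda>s. the (X s w)) (the (X t w)) (at_right t))"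

definition conservative ::
    "'a measure \<Rightarrow> (real \<Rightarrow> 'w \<Rightarrow> 'a option) \<Rightarrow> ('a \<Rightarrow> 'w measure) \<Rightarrow> bool" where
  "conservative M X P \<longleftrightarrow> (\<forall>x\<in>space M. AE w in P x. lifetime X w = \<infinity>)"

text \<open>\<open>AE\<close> refers to the completion of \<open>P x\<close>; \<open>emeasure\<close> would return the junk value 0 if the event
  were not in \<open>\<G>\<close>.\<close>

definition polar_set ::
    "'a measure \<Rightarrow> (real \<Rightarrow> 'w \<Rightarrow> 'a option) \<Rightarrow> ('a \<Rightarrow> 'w measure) \<Rightarrow> 'a set \<Rightarrow> bool" where
  "polar_set M X P N \<longleftrightarrow>
     N \<in> sets M \<and> (\<forall>x\<in>space M. AE w in P x. \<not> hitting_time X N w < \<infinity>)"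


section \<open>The restricted resolvent: independence of the extension, and resolvent property\<close>

lemma kernel_apply_measurable:
  assumes K: "kernel_on M K" and f: "f \<in> borel_measurable M"
  shows "kernel_apply K f \<in> borel_measurable M"
  using f
proof (induction rule: borel_measurable_induct)
  case (cong f g)
  have "kernel_apply K f x = kernel_apply K g x" if "x \<in> space M" for x
    unfolding kernel_apply_def
    using K that cong(3) sets_eq_imp_space_eq[of "K x" M]
    by (intro nn_integral_cong) (auto simp: kernel_on_def)
  with cong(4) show ?case by (simp cong: measurable_cong)
next
  case (set A)
  have "kernel_apply K (indicator A) x = emeasure (K x) A" if "x \<in> space M" for x
    using K that set by (simp add: kernel_apply_def kernel_on_def)
  with K set show ?case by (simp add: kernel_on_def cong: measurable_cong)
next
  case (mult u c)
  have "kernel_apply K (\<lambda>x. c * u x) x = c * kernel_apply K u x" if "x \<in> space M" for x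
  proof -
    have "u \<in> borel_measurable (K x)"
      using K that mult(2) by (simp add: kernel_on_def cong: measurable_cong_sets)
    then show ?thesis by (simp add: kernel_apply_def nn_integral_cmult)
  qed
  with mult show ?case by (simp cong: measurable_cong)
next
  case (add u v)
  have "kernel_apply K (\<lambda>x. v x + u x) x = kernel_apply K v x + kernel_apply K u x"
    if "x \<in> space M" for x
  proof -
    have "u \<in> borel_measurable (K x)" "v \<in> borel_measurable (K x)"
      using K that add by (simp_all add: kernel_on_def cong: measurable_cong_sets)
    then show ?thesis by (simp add: kernel_apply_def nn_integral_add)
  qed
  with add show ?case by (simp cong: measurable_cong)
next
  case (seq V)
  have "kernel_apply K (SUP i. V i) x = (SUP i. kernel_apply K (V i) x)" if "x \<in> space M" for x
  proof -
    have "V i \<in> borel_measurable (K x)" for i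
      using K that seq by (simp add: kernel_on_def cong: measurable_cong_sets)
    then show ?thesis
      using nn_integral_monotone_convergence_SUP[OF seq(3), of "K x"]
      by (simp add: kernel_apply_def image_comp)
  qed
  then have "kernel_apply K (SUP i. V i) \<in> borel_measurable M \<longleftrightarrow>
      (\<lambda>x. SUP i. kernel_apply K (V i) x) \<in> borel_measurable M"
    by (intro measurable_cong)
  moreover have "(\<lambda>x. SUP i. kernel_apply K (V i) x) \<in> borel_measurable M"
    using seq(5) by (intro borel_measurable_SUP) auto
  ultimately have "kernel_apply K (SUP i. V i) \<in> borel_measurable M" by blast
  then show ?case unfolding seq(4) .
qed

lemma negligible_set_all:
  assumes U: "sub_markov_resolvent M U" and N: "negligible_set M U N"
    and q: "0 < q" and x: "x \<in> space M"
  shows "emeasure (U q x) N = 0"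
proof -
  obtain p where p: "0 < p" and z: "\<And>y. y \<in> space M \<Longrightarrow> kernel_apply (U p) (indicator N) y = 0"
    using N by (auto simp: negligible_set_def)
  have Nm: "N \<in> sets M" using N by (simp add: negligible_set_def)
  then have i: "indicator N \<in> borel_measurable M" by simp
  have s: "sets (U r y) = sets M" if "0 < r" "y \<in> space M" for r y
    using U that by (simp add: sub_markov_resolvent_def kernel_on_def)
  have res: "kernel_apply (U a) (indicator N) x = kernel_apply (U b) (indicator N) x
      + ennreal (b - a) * kernel_apply (U a) (kernel_apply (U b) (indicator N)) x"
    if "0 < a" "a < b" for a b
    using U that i x unfolding sub_markov_resolvent_def by blast
  have "kernel_apply (U q) (indicator N) x = 0"
  proof (cases p q rule: linorder_cases)
    case less
    then show ?thesis using res[of p q] p z[OF x] by simp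
  next
    case equal
    then show ?thesis using z x by simp
  next
    case greater
    have "kernel_apply (U q) (kernel_apply (U p) (indicator N)) x = (\<integral>\<^sup>+ y. 0 \<partial>U q x)"
      unfolding kernel_apply_def[of "U q"]
      using z sets_eq_imp_space_eq[OF s[OF q x]] by (intro nn_integral_cong) auto
    then show ?thesis using res[of q p] greater q z[OF x] by simp
  qed
  then show ?thesis using Nm s[OF q x] by (simp add: kernel_apply_def)
qed

lemma kernel_apply_restrict_resolvent:
  assumes U: "sub_markov_resolvent M U" and N: "negligible_set M U N"
    and q: "0 < q" and x: "x \<in> space M - N"
    and h: "h \<in> borel_measurable M" and g: "\<And>y. y \<in> space M - N \<Longrightarrow> h y = g y"
  shows "kernel_apply (restrict_resolvent (space M - N) U q) g x = kernel_apply (U q) h x"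
proof -
  have s: "sets (U q x) = sets M"
    using U q x by (simp add: sub_markov_resolvent_def kernel_on_def)
  have Nm: "N \<in> sets (U q x)" using N s by (simp add: negligible_set_def)
  have sp: "space (U q x) = space M" using s by (rule sets_eq_imp_space_eq)
  have "AE y in U q x. y \<notin> N"
    using Nm negligible_set_all[OF U N q] x by (intro AE_not_in) (auto simp: null_sets_def)
  then have "AE y in U q x. g y * indicator (space M - N) y = h y"
    using AE_space by eventually_elim (auto simp: sp g)
  then have "(\<integral>\<^sup>+ y. g y * indicator (space M - N) y \<partial>U q x) = (\<integral>\<^sup>+ y. h y \<partial>U q x)"
    by (rule nn_integral_cong_AE)
  moreover have "(space M - N) \<inter> space (U q x) \<in> sets (U q x)"
    using Nm by (auto simp: sp[symmetric])
  ultimately show ?thesis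
    by (simp add: kernel_apply_def restrict_resolvent_def nn_integral_restrict_space)
qed

lemma sub_markov_resolvent_restrict:
  assumes U: "sub_markov_resolvent M U" and N: "negligible_set M U N"
  shows "sub_markov_resolvent (restrict_space M (space M - N)) (restrict_resolvent (space M - N) U)"
proof -
  let ?F = "space M - N"
  let ?M = "restrict_space M ?F" and ?U = "restrict_resolvent ?F U"
  have F: "?F \<in> sets M" using N by (auto simp: negligible_set_def)
  have sp: "space ?M = ?F" by (auto simp: space_restrict_space)
  have K: "kernel_on M (U q)" if "0 < q" for q
    using U that by (simp add: sub_markov_resolvent_def)
  have s: "sets (U q x) = sets M" if "0 < q" "x \<in> space M" for q x
    using K[OF that(1)] that(2) by (simp add: kernel_on_def)
  let ?e = "\<lambda>f y. f y * indicator ?F y :: ennreal"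
  have e: "?e f \<in> borel_measurable M" if "f \<in> borel_measurable ?M" for f
    using that F by (subst (asm) borel_measurable_restrict_space_iff_ennreal) auto
  have app: "kernel_apply (?U q) f x = kernel_apply (U q) (?e f) x"
    if "0 < q" "f \<in> borel_measurable ?M" "x \<in> ?F" for q f x
    using that e by (intro kernel_apply_restrict_resolvent[OF U N]) auto
  have kernel: "kernel_on ?M (?U q)" if q: "0 < q" for q
    unfolding kernel_on_def sp
  proof (intro conjI ballI)
    fix x assume "x \<in> ?F"
    then show "sets (?U q x) = sets ?M"
      using s[OF q] by (auto simp: restrict_resolvent_def sets_restrict_space)
  next
    fix A assume "A \<in> sets ?M"
    then have A: "A \<in> sets M" "A \<subseteq> ?F"
      using F by (auto simp: sets_restrict_space_iff)
    have "emeasure (?U q x) A = emeasure (U q x) A" if "x \<in> ?F" for x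
      unfolding restrict_resolvent_def
      using that A F s[OF q, of x] sets_eq_imp_space_eq[OF s[OF q, of x]]
      by (intro emeasure_restrict_space) auto
    moreover have "(\<lambda>x. emeasure (U q x) A) \<in> borel_measurable ?M"
      using K[OF q] A by (intro measurable_restrict_space1) (simp add: kernel_on_def)
    ultimately show "(\<lambda>x. emeasure (?U q x) A) \<in> borel_measurable ?M"
      by (subst measurable_cong[where g = "\<lambda>x. emeasure (U q x) A"]) (auto simp: sp)
  qed
  have res: "kernel_apply (?U p) f x = kernel_apply (?U q) f x
      + ennreal (q - p) * kernel_apply (?U p) (kernel_apply (?U q) f) x"
    if pq: "0 < p" "p < q" and f: "f \<in> borel_measurable ?M" and x: "x \<in> ?F" for p q f x
  proof -
    have q: "0 < q" using pq by simp
    have "kernel_apply (?U p) (kernel_apply (?U q) f) x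
        = kernel_apply (U p) (kernel_apply (U q) (?e f)) x"
      using app[OF q f] by (intro kernel_apply_restrict_resolvent[OF U N pq(1) x
          kernel_apply_measurable[OF K[OF q] e[OF f]]]) simp
    moreover have "kernel_apply (U p) (?e f) x = kernel_apply (U q) (?e f) x
        + ennreal (q - p) * kernel_apply (U p) (kernel_apply (U q) (?e f)) x"
      using U pq e[OF f] x unfolding sub_markov_resolvent_def by blast
    ultimately show ?thesis using app[OF _ f x] pq q by simp
  qed
  have bound: "ennreal q * kernel_apply (?U q) (\<lambda>_. 1) x \<le> 1" if "0 < q" "x \<in> ?F" for q x
  proof -
    have "kernel_apply (?U q) (\<lambda>_. 1) x = kernel_apply (U q) (\<lambda>_. 1) x"
      using that by (intro kernel_apply_restrict_resolvent[OF U N]) auto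
    then show ?thesis using U that by (simp add: sub_markov_resolvent_def)
  qed
  show ?thesis
    unfolding sub_markov_resolvent_def sp using kernel res bound by blast
qed

end

theory Submission
  imports Defs
begin

text \<open>
  Suppose that a right process \<open>X'\<close> on the complement \<open>F\<close> of \<open>N\<close> had the restricted resolvent. Started at the same
  point of \<open>F\<close>, the processes \<open>X\<close> and \<open>X'\<close> turn out to have the same law as random right-continuous paths. Since
  \<open>X'\<close> cannot enter \<open>N\<close>, neither can \<open>X\<close>, and \<open>N\<close> is polar. Each of the following points needs an idea.

  \<^item> \<^emph>\<open>A common topology.\<close> The Lusin topologies in which the paths of \<open>X\<close> and of \<open>X'\<close> are right-continuous
    are unrelated. But potentials of bounded functions are differences of excessive functions, and the potentials
    of \<open>X'\<close> are the restrictions of those of \<open>X\<close>; so for large \<open>q\<close> all functions \<open>U q f\<close> are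
    right-continuous along both processes. Countably many of them generate the Borel sets
    (\<open>coding_exists\<close>), because \<open>f\<close> is a limit of linear combinations of potentials \<open>U (q + j) f\<close> when it is continuous
    (\<open>laplace_inversion\<close>). Thus both processes become right-continuous paths in a sequence space, in which
    \<open>N\<close> is the inverse image of a Borel set.

  \<^item> \<^emph>\<open>Equality of laws.\<close> The mean at time \<open>t\<close> of a continuous function of finitely many potentials is
    right-continuous in \<open>t\<close>, hence determined by its Laplace transform, which is the resolvent
    (\<open>one_dimensional_laws_agree\<close>). The Markov property extends this to the paths at rational times
    (\<open>path_laws_agree\<close>), and these determine the codes at all times.

  \<^item> \<^emph>\<open>Hitting is an uncountable union over times.\<close> The set of paths that visit \<open>N\<close> is the projection of a
    measurable set of times and paths. By Choquet's capacitability argument (\<open>projection_null\<close>) it is negligible as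
    soon as its measurable subsets are, and null sets can be compared through the laws.

  \<^item> \<^emph>\<open>Starting points in \<open>N\<close>.\<close> As \<open>N\<close> has potential zero, there are arbitrarily small times \<open>a\<close> at which the process is
    almost surely outside \<open>N\<close> (\<open>good_times\<close>). After time \<open>a\<close> its path is a mixture of paths started
    outside \<open>N\<close>, and the above applies to the mixture (\<open>not_hit_after\<close>). Letting \<open>a\<close> tend to 0 gives all positive times.
\<close>

section \<open>Projections of measurable sets\<close>

text \<open>A Souslin scheme of rectangles, closed in time and measurable in the sample point. The rectangle
  \<open>F n s \<times> A n s\<close> sits at the node \<open>(s 0, \<dots>, s (n - 1))\<close> of the tree of finite sequences; the
  whole sequence is passed instead of a list, and the last clause says that only these entries are read.\<close>

definition souslin_scheme ::
    "'w measure \<Rightarrow> (nat \<Rightarrow> (nat \<Rightarrow> nat) \<Rightarrow> real set) \<Rightarrow> (nat \<Rightarrow> (nat \<Rightarrow> nat) \<Rightarrow> 'w set) \<Rightarrow> bool" where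
  "souslin_scheme L F A \<longleftrightarrow>
     (\<forall>n s. closed (F n s) \<and> A n s \<in> sets L) \<and>
     (\<forall>n s s'. (\<forall>i<n. s i = s' i) \<longrightarrow> F n s = F n s' \<and> A n s = A n s')"

definition souslin_kernel ::
    "(nat \<Rightarrow> (nat \<Rightarrow> nat) \<Rightarrow> real set) \<Rightarrow> (nat \<Rightarrow> (nat \<Rightarrow> nat) \<Rightarrow> 'w set) \<Rightarrow> (real \<times> 'w) set" where
  "souslin_kernel F A = {(t, w). \<exists>s. \<forall>n. t \<in> F n s \<and> w \<in> A n s}"

definition souslin :: "'w measure \<Rightarrow> (real \<times> 'w) set \<Rightarrow> bool" where
  "souslin L H \<longleftrightarrow> (\<exists>F A. souslin_scheme L F A \<and> H = souslin_kernel F A)"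

lemma souslin_schemeD:
  assumes "souslin_scheme L F A"
  shows "closed (F n s)" "A n s \<in> sets L"
    "(\<And>i. i < n \<Longrightarrow> s i = s' i) \<Longrightarrow> F n s = F n s' \<and> A n s = A n s'"
  using assms unfolding souslin_scheme_def by blast+

lemma souslin_rectangle: "closed F \<Longrightarrow> A \<in> sets L \<Longrightarrow> souslin L (F \<times> A)"
  unfolding souslin_def souslin_scheme_def souslin_kernel_def
  by (intro exI[of _ "\<lambda>_ _. F"] exI[of _ "\<lambda>_ _. A"]) auto

text \<open>The first entry of a branch selects the set, and the remaining entries run through the scheme
  of that set, one level later. At level 0 no entry has been read, so the whole space stands there.\<close>

lemma souslin_UN:
  fixes H :: "nat \<Rightarrow> (real \<times> 'w) set"
  assumes "\<And>j. souslin L (H j)" and sub: "\<And>j. H j \<subseteq> UNIV \<times> space L"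
  shows "souslin L (\<Union>j. H j)"
proof -
  obtain F A where sch: "\<And>j. souslin_scheme L (F j) (A j)" and Hk: "\<And>j. H j = souslin_kernel (F j) (A j)"
    using assms(1) unfolding souslin_def by metis
  note FA = souslin_schemeD(1,2)[OF sch] and loc = souslin_schemeD(3)[OF sch]
  have H: "x \<in> H j \<longleftrightarrow> (\<exists>s. \<forall>n. fst x \<in> F j n s \<and> snd x \<in> A j n s)" for x j
    by (auto simp: Hk souslin_kernel_def split_beta)
  define F' where "F' n s = (case n of 0 \<Rightarrow> UNIV | Suc m \<Rightarrow> F (s 0) m (\<lambda>i. s (Suc i)))" for n and s :: "nat \<Rightarrow> nat"
  define A' where "A' n s = (case n of 0 \<Rightarrow> space L | Suc m \<Rightarrow> A (s 0) m (\<lambda>i. s (Suc i)))" for n and s :: "nat \<Rightarrow> nat"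
  have "closed (F' n s) \<and> A' n s \<in> sets L" for n s
    using FA by (cases n) (auto simp: F'_def A'_def)
  moreover have "F' n s = F' n s' \<and> A' n s = A' n s'" if "\<forall>i<n. s i = s' i" for n s s'
  proof (cases n)
    case 0 then show ?thesis by (simp add: F'_def A'_def)
  next
    case (Suc m)
    with that have "s 0 = s' 0" "\<forall>i<m. s (Suc i) = s' (Suc i)" by auto
    then show ?thesis using loc[of m "\<lambda>i. s (Suc i)" "\<lambda>i. s' (Suc i)" "s' 0"] Suc
      by (simp add: F'_def A'_def)
  qed
  moreover have "(\<Union>j. H j) = {(t, w). \<exists>s. \<forall>n. t \<in> F' n s \<and> w \<in> A' n s}" (is "_ = ?R")
  proof (intro set_eqI iffI)
    fix x assume "x \<in> (\<Union>j. H j)"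
    then obtain j where x: "x \<in> H j" by blast
    then obtain s where s: "\<forall>n. fst x \<in> F j n s \<and> snd x \<in> A j n s"
      unfolding H by blast
    have "snd x \<in> space L" using sub x by fastforce
    then have "\<forall>n. fst x \<in> F' n (case_nat j s) \<and> snd x \<in> A' n (case_nat j s)"
      using s by (auto simp: F'_def A'_def split: nat.split)
    then show "x \<in> ?R" unfolding split_beta by blast
  next
    fix x assume "x \<in> ?R"
    then obtain s where s: "\<And>n. fst x \<in> F' n s \<and> snd x \<in> A' n s" by (auto simp: split_beta)
    have "\<forall>n. fst x \<in> F (s 0) n (\<lambda>i. s (Suc i)) \<and> snd x \<in> A (s 0) n (\<lambda>i. s (Suc i))"
      using s[of "Suc n" for n] by (auto simp: F'_def A'_def)
    then have "x \<in> H (s 0)" unfolding H by blast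
    then show "x \<in> (\<Union>j. H j)" by blast
  qed
  ultimately show ?thesis unfolding souslin_def souslin_scheme_def souslin_kernel_def by blast
qed

text \<open>One branch carries countably many: the branch belonging to the \<open>j\<close>-th set occupies the positions
  \<open>prod_encode (j, i)\<close>. As \<open>prod_encode (j, i)\<close> increases with \<open>i\<close>, the node at which the \<open>n\<close>-th
  rectangle of the \<open>j\<close>-th set is tested comes after the entries on which this rectangle depends.\<close>

lemma souslin_INT:
  fixes H :: "nat \<Rightarrow> (real \<times> 'w) set"
  assumes "\<And>j. souslin L (H j)"
  shows "souslin L (\<Inter>j. H j)"
proof -
  obtain F A where sch: "\<And>j. souslin_scheme L (F j) (A j)" and Hk: "\<And>j. H j = souslin_kernel (F j) (A j)"
    using assms(1) unfolding souslin_def by metis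
  note FA = souslin_schemeD(1,2)[OF sch] and loc = souslin_schemeD(3)[OF sch]
  have H: "x \<in> H j \<longleftrightarrow> (\<exists>s. \<forall>n. fst x \<in> F j n s \<and> snd x \<in> A j n s)" for x j
    by (auto simp: Hk souslin_kernel_def split_beta)
  define F' where "F' m s = (case prod_decode m of (j, n) \<Rightarrow> F j n (\<lambda>i. s (prod_encode (j, i))))"
    for m and s :: "nat \<Rightarrow> nat"
  define A' where "A' m s = (case prod_decode m of (j, n) \<Rightarrow> A j n (\<lambda>i. s (prod_encode (j, i))))"
    for m and s :: "nat \<Rightarrow> nat"
  have less: "prod_encode (j, i) < prod_encode (j, n)" if "i < n" for i j n
  proof -
    have "strict_mono (\<lambda>i. prod_encode (j, i))"
      by (rule strict_monoI_Suc) (simp add: prod_encode_def)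
    then show ?thesis using that by (rule strict_monoD)
  qed
  have "closed (F' n s) \<and> A' n s \<in> sets L" for n s
    using FA by (auto simp: F'_def A'_def split: prod.split)
  moreover have "F' m s = F' m s' \<and> A' m s = A' m s'" if eq: "\<forall>i<m. s i = s' i" for m s s'
  proof -
    obtain j n where jn: "prod_decode m = (j, n)" by fastforce
    then have m: "m = prod_encode (j, n)" by (metis prod_decode_inverse)
    have "F j n (\<lambda>i. s (prod_encode (j, i))) = F j n (\<lambda>i. s' (prod_encode (j, i))) \<and>
       A j n (\<lambda>i. s (prod_encode (j, i))) = A j n (\<lambda>i. s' (prod_encode (j, i)))"
      using eq less m by (intro loc) auto
    then show ?thesis by (simp add: F'_def A'_def jn)
  qed
  moreover have "(\<Inter>j. H j) = {(t, w). \<exists>s. \<forall>n. t \<in> F' n s \<and> w \<in> A' n s}" (is "_ = ?R")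
  proof (intro set_eqI iffI)
    fix x assume "x \<in> (\<Inter>j. H j)"
    then have "\<forall>j. \<exists>s. \<forall>n. fst x \<in> F j n s \<and> snd x \<in> A j n s"
      unfolding H[symmetric] by blast
    then obtain S where S: "\<And>j n. fst x \<in> F j n (S j) \<and> snd x \<in> A j n (S j)" by metis
    have "\<forall>n. fst x \<in> F' n (\<lambda>m. case prod_decode m of (j, i) \<Rightarrow> S j i)
        \<and> snd x \<in> A' n (\<lambda>m. case prod_decode m of (j, i) \<Rightarrow> S j i)"
      using S by (auto simp: F'_def A'_def split: prod.split)
    then show "x \<in> ?R" unfolding split_beta by blast
  next
    fix x assume "x \<in> ?R"
    then obtain s where s: "\<And>n. fst x \<in> F' n s \<and> snd x \<in> A' n s" by (auto simp: split_beta)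
    have "fst x \<in> F j n (\<lambda>i. s (prod_encode (j, i))) \<and> snd x \<in> A j n (\<lambda>i. s (prod_encode (j, i)))"
      for j n
      using s[of "prod_encode (j, n)"] by (auto simp: F'_def A'_def)
    then show "x \<in> (\<Inter>j. H j)" using H by blast
  qed
  ultimately show ?thesis unfolding souslin_def souslin_scheme_def souslin_kernel_def by blast
qed

lemma souslin_Un:
  assumes "souslin L H" "souslin L K" "H \<subseteq> UNIV \<times> space L" "K \<subseteq> UNIV \<times> space L"
  shows "souslin L (H \<union> K)"
proof -
  have "H \<union> K = (\<Union>j::nat. if j = 0 then H else K)" by (auto split: if_splits)
  moreover have "souslin L (\<Union>j::nat. if j = 0 then H else K)"
    using assms by (intro souslin_UN) auto
  ultimately show ?thesis by simp
qed

lemma souslin_Int: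
  assumes "souslin L H" "souslin L K"
  shows "souslin L (H \<inter> K)"
proof -
  have "H \<inter> K = (\<Inter>j::nat. if j = 0 then H else K)" by (auto split: if_splits)
  moreover have "souslin L (\<Inter>j::nat. if j = 0 then H else K)"
    using assms by (intro souslin_INT) auto
  ultimately show ?thesis by simp
qed

text \<open>Souslin sets need not be closed under complements, but the sets that are Souslin together with
  their complement form a \<open>\<sigma>\<close>-algebra, and rectangles are among them.\<close>

lemma souslin_pair_measure:
  assumes "H \<in> sets (borel \<Otimes>\<^sub>M L)"
  shows "souslin L H"
proof -
  let ?T = "UNIV \<times> space L :: (real \<times> 'a) set"
  define D where "D H \<longleftrightarrow> H \<subseteq> ?T \<and> souslin L H \<and> souslin L (?T - H)" for H
  have UN: "D (\<Union>j. H j)" if "\<And>j::nat. D (H j)" for H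
  proof -
    have "?T - (\<Union>j. H j) = (\<Inter>j. ?T - H j)" by auto
    then show ?thesis using that souslin_UN[of L H] souslin_INT[of L "\<lambda>j. ?T - H j"]
      unfolding D_def by auto
  qed
  have compl: "D (?T - H)" if "D H" for H
    using that by (auto simp: D_def double_diff)
  have empty: "D {}"
    using souslin_rectangle[of "{}" "{}" L] souslin_rectangle[of UNIV "space L" L]
    by (auto simp: D_def)
  have Int: "D (H \<inter> K)" if "D H" "D K" for H K
  proof -
    have "?T - (H \<inter> K) = (?T - H) \<union> (?T - K)" by auto
    then show ?thesis using that souslin_Int[of L H K] souslin_Un[of L "?T - H" "?T - K"]
      unfolding D_def by auto
  qed
  have first: "D (a \<times> space L)" if "a \<in> sets borel" for a
    using that unfolding borel_eq_atMost sets_measure_of[OF subset_UNIV[of "range atMost", folded Pow_UNIV]]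
  proof (induction rule: sigma_sets.induct)
    case (Basic a)
    then obtain b where a: "a = {..b}" by blast
    have "?T - a \<times> space L = (\<Union>j::nat. {b + 1 / real (Suc j)..} \<times> space L)"
    proof -
      have "\<exists>j::nat. b + 1 / real (Suc j) \<le> t" if "b < t" for t
      proof -
        obtain j where "inverse (real (Suc j)) < t - b" using reals_Archimedean[of "t - b"] \<open>b < t\<close> by (metis diff_gt_0_iff_gt)
        then show ?thesis by (intro exI[of _ j]) (simp add: inverse_eq_divide)
      qed
      moreover have "b < t" if "b + 1 / real (Suc j) \<le> t" for t j
      proof -
        have "0 < 1 / real (Suc j)" by simp
        then show ?thesis using that by linarith
      qed
      ultimately have "b < t \<longleftrightarrow> (\<exists>j. b + 1 / real (Suc j) \<le> t)" for t by blast
      then have "- a = (\<Union>j::nat. {b + 1 / real (Suc j)..})"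
        unfolding a by (intro set_eqI) (simp add: not_le del: of_nat_Suc)
      moreover have "?T - a \<times> space L = (- a) \<times> space L" by blast
      ultimately show ?thesis by blast
    qed
    moreover have "souslin L (\<Union>j::nat. {b + 1 / real (Suc j)..} \<times> space L)"
      by (intro souslin_UN souslin_rectangle) auto
    ultimately show ?case by (auto simp: D_def a intro!: souslin_rectangle)
  next
    case Empty then show ?case using empty by simp
  next
    case (Compl a)
    have "(UNIV - a) \<times> space L = ?T - a \<times> space L" by auto
    then show ?case using compl[OF Compl.IH] by simp
  next
    case (Union a)
    have "(\<Union>(range a)) \<times> space L = (\<Union>j. a j \<times> space L)" by auto
    then show ?case using UN[OF Union.IH] by simp
  qed
  have second: "D (UNIV \<times> b)" if "b \<in> sets L" for b
  proof -
    have "?T - UNIV \<times> b = UNIV \<times> (space L - b)" by auto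
    then show ?thesis using that sets.sets_into_space[OF that]
      by (auto simp: D_def intro!: souslin_rectangle)
  qed
  from assms have "D H" unfolding sets_pair_measure space_borel
  proof (induction rule: sigma_sets.induct)
    case (Basic X)
    then obtain a b where ab: "X = a \<times> b" "a \<in> sets borel" "b \<in> sets L" by blast
    have "X = a \<times> space L \<inter> UNIV \<times> b" using sets.sets_into_space[OF ab(3)] ab(1) by auto
    then show ?case using Int first second ab by metis
  next
    case Empty then show ?case by (rule empty)
  next
    case (Compl a) then show ?case by (intro compl)
  next
    case (Union a) then show ?case by (intro UN)
  qed
  then show ?thesis by (simp add: D_def)
qed

lemma compact_bounded_sequences: "compact {s :: nat \<Rightarrow> nat. \<forall>i. s i \<le> k i}"
proof -
  have "compactin (product_topology (\<lambda>i. euclidean) UNIV) (PiE UNIV (\<lambda>i. {..k i}))"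
    by (subst compactin_PiE) (auto intro!: finite_imp_compact)
  then show ?thesis
    by (simp add: euclidean_product_topology PiE_UNIV_domain Pi_def)
qed

lemma open_cylinder: "open {s' :: nat \<Rightarrow> nat. \<forall>i<n. s' i = s i}"
proof -
  have "open ((\<lambda>s' :: nat \<Rightarrow> nat. s' i) -` {s i})" for i
    by (intro open_vimage[OF _ continuous_on_product_coordinates] discrete_topology_class.open_discrete)
  then have "open (\<Inter>i\<in>{..<n}. (\<lambda>s' :: nat \<Rightarrow> nat. s' i) -` {s i})" by (intro open_INT) auto
  moreover have "(\<Inter>i\<in>{..<n}. (\<lambda>s' :: nat \<Rightarrow> nat. s' i) -` {s i}) = {s'. \<forall>i<n. s' i = s i}"
    by auto
  ultimately show ?thesis by simp
qed

text \<open>Choquet's capacitability argument. Outer measure is continuous along increasing sequences of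
  arbitrary sets, so bounds \<open>k 0, k 1, \<dots>\<close> for the entries of the branches can be chosen one after the
  other such that the outer measure of the projection never drops below some \<open>e > 0\<close>. Looking
  only at the first \<open>n\<close> levels gives a measurable set \<open>B n\<close>, still of measure at least \<open>e\<close>. The
  intersection of the \<open>B n\<close> lies in the projection, because the branches bounded by \<open>k\<close> and the times
  in a bounded closed interval form a compact set.\<close>

lemma souslin_projection_inner:
  fixes H :: "(real \<times> 'w) set"
  assumes L: "finite_measure L" and H: "souslin L H" and HT: "H \<subseteq> UNIV \<times> space L"
    and pos: "0 < outer_measure_of L (snd ` H)"
  shows "\<exists>A\<in>sets L. A \<subseteq> snd ` H \<and> 0 < emeasure L A"
proof -
  interpret finite_measure L by fact
  obtain F A where sch: "souslin_scheme L F A" and Heq: "H = souslin_kernel F A"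
    using H unfolding souslin_def by blast
  note FA = souslin_schemeD(1,2)[OF sch] and loc = souslin_schemeD(3)[OF sch]
  note Heq = Heq[unfolded souslin_kernel_def]
  \<comment> \<open>the projection of the part of \<open>H\<close> with times in \<open>[-c, c]\<close> and branches bounded by \<open>k\<close> up to level \<open>n\<close>\<close>
  define V where "V c n k = {w. \<exists>t s. \<bar>t\<bar> \<le> real c \<and> (\<forall>i<n. s i \<le> k i) \<and> (\<forall>m. t \<in> F m s \<and> w \<in> A m s)}"
    for c n :: nat and k :: "nat \<Rightarrow> nat"
  have Vsp: "V c n k \<subseteq> space L" for c n k
    using FA(2) sets.sets_into_space unfolding V_def by blast
  have V_Un: "snd ` H = (\<Union>c. V c 0 k)" for k
  proof (intro set_eqI iffI)
    fix w assume "w \<in> snd ` H"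
    then obtain t s where ts: "\<forall>m. t \<in> F m s \<and> w \<in> A m s" unfolding Heq by auto
    obtain c :: nat where "\<bar>t\<bar> \<le> real c" using real_arch_simple by blast
    with ts have "w \<in> V c 0 k" unfolding V_def by blast
    then show "w \<in> (\<Union>c. V c 0 k)" by blast
  next
    fix w assume "w \<in> (\<Union>c. V c 0 k)"
    then obtain t s where "\<forall>m. t \<in> F m s \<and> w \<in> A m s" unfolding V_def by blast
    then have "(t, w) \<in> H" unfolding Heq by blast
    then show "w \<in> snd ` H" by force
  qed
  have V_inc: "incseq (\<lambda>c. V c 0 k)" for k
  proof (intro monoI subsetI)
    fix c c' w assume "c \<le> (c' :: nat)" "w \<in> V c 0 k"
    then obtain t s where "\<bar>t\<bar> \<le> real c" "\<forall>m. t \<in> F m s \<and> w \<in> A m s" unfolding V_def by blast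
    moreover from this have "\<bar>t\<bar> \<le> real c'" using \<open>c \<le> c'\<close> by linarith
    ultimately show "w \<in> V c' 0 k" unfolding V_def by blast
  qed
  have "0 < (SUP c. outer_measure_of L (V c 0 (\<lambda>_. 0)))"
    using SUP_outer_measure_of_incseq[OF Vsp V_inc] V_Un pos by simp
  then obtain c where c: "0 < outer_measure_of L (V c 0 (\<lambda>_. 0))"
    unfolding less_SUP_iff by blast
  obtain e where e: "0 < e" "e < outer_measure_of L (V c 0 (\<lambda>_. 0))" using c dense by blast
  have ex: "\<exists>j. e < outer_measure_of L (V c (Suc n) (k(n := j)))"
    if "e < outer_measure_of L (V c n k)" for n k
  proof -
    have bd: "(\<forall>i<Suc n. s i \<le> (k(n := j)) i) \<longleftrightarrow> (\<forall>i<n. s i \<le> k i) \<and> s n \<le> j" for s j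
      by (auto simp: less_Suc_eq)
    have Un: "V c n k = (\<Union>j. V c (Suc n) (k(n := j)))"
      unfolding V_def bd by blast
    have inc: "incseq (\<lambda>j. V c (Suc n) (k(n := j)))"
      unfolding V_def bd by (intro monoI) (blast intro: order_trans)
    have "e < (SUP j. outer_measure_of L (V c (Suc n) (k(n := j))))"
      using that SUP_outer_measure_of_incseq[OF Vsp inc] Un by simp
    then show ?thesis unfolding less_SUP_iff by blast
  qed
  have "\<exists>f. \<forall>n. e < outer_measure_of L (V c n (f n)) \<and> (\<forall>i<n. f (Suc n) i = f n i)"
  proof (rule dependent_nat_choice)
    show "\<exists>k. e < outer_measure_of L (V c 0 k)" using e(2) by blast
    fix k n assume "e < outer_measure_of L (V c n k)"
    then obtain j where "e < outer_measure_of L (V c (Suc n) (k(n := j)))" using ex by blast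
    then show "\<exists>k'. e < outer_measure_of L (V c (Suc n) k') \<and> (\<forall>i<n. k' i = k i)"
      by (intro exI[of _ "k(n := j)"]) simp
  qed
  then obtain f where f: "\<And>n. e < outer_measure_of L (V c n (f n))"
    and f2: "\<And>n i. i < n \<Longrightarrow> f (Suc n) i = f n i" by blast
  define k where "k i = f (Suc i) i" for i
  have "f n i = k i" if "i < n" for n i
    using that
  proof (induction n)
    case (Suc n) then show ?case using f2[of i n] by (cases "i = n") (auto simp: k_def)
  qed simp
  then have "V c n (f n) = V c n k" for n unfolding V_def by auto
  with f have k: "e < outer_measure_of L (V c n k)" for n by simp
  define B where "B n = {w. \<exists>t s. \<bar>t\<bar> \<le> real c \<and> (\<forall>i. s i \<le> k i) \<and> (\<forall>m\<le>n. t \<in> F m s \<and> w \<in> A m s)}"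
    for n
  have Bsets: "B n \<in> sets L" for n
  proof -
    \<comment> \<open>finitely many prefixes of length \<open>n\<close>, continued by zeros, represent all the bounded branches\<close>
    define S where "S = (\<lambda>g i. if i < n then g i else 0) ` PiE {..<n} (\<lambda>i. {..k i})"
    have "finite S" unfolding S_def by (intro finite_imageI finite_PiE) auto
    let ?S = "{s \<in> S. (\<forall>i. s i \<le> k i) \<and> (\<exists>t. \<bar>t\<bar> \<le> real c \<and> (\<forall>m\<le>n. t \<in> F m s))}"
    have "B n = (\<Union>s\<in>?S. \<Inter>m\<in>{..n}. A m s)"
    proof (intro set_eqI iffI)
      fix w assume "w \<in> B n"
      then obtain t s where ts: "\<bar>t\<bar> \<le> real c" "\<forall>i. s i \<le> k i" "\<forall>m\<le>n. t \<in> F m s \<and> w \<in> A m s"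
        unfolding B_def by blast
      let ?s = "\<lambda>i. if i < n then s i else 0"
      have "?s \<in> S" unfolding S_def
        by (rule image_eqI[where x = "restrict s {..<n}"]) (use ts(2) in auto)
      moreover have "F m s = F m ?s \<and> A m s = A m ?s" if "m \<le> n" for m
        using that by (intro loc) auto
      ultimately show "w \<in> (\<Union>s\<in>?S. \<Inter>m\<in>{..n}. A m s)"
        using ts by (intro UN_I[of ?s]) (auto intro!: exI[of _ t])
    qed (unfold B_def, auto, blast)
    moreover have "(\<Union>s\<in>?S. \<Inter>m\<in>{..n}. A m s) \<in> sets L"
      using \<open>finite S\<close> FA(2) by (intro sets.finite_UN sets.finite_INT) auto
    ultimately show ?thesis by simp
  qed
  have VB: "V c n k \<subseteq> B n" for n
  proof
    fix w assume "w \<in> V c n k"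
    then obtain t s where ts: "\<bar>t\<bar> \<le> real c" "\<forall>i<n. s i \<le> k i" "\<forall>m. t \<in> F m s \<and> w \<in> A m s"
      unfolding V_def by blast
    define s' where "s' = (\<lambda>i. if i < n then s i else 0)"
    have "t \<in> F m s' \<and> w \<in> A m s'" if "m \<le> n" for m
    proof -
      have "F m s = F m s' \<and> A m s = A m s'" using that by (intro loc) (auto simp: s'_def)
      moreover have "t \<in> F m s \<and> w \<in> A m s" using ts(3) by blast
      ultimately show ?thesis by simp
    qed
    moreover have "\<forall>i. s' i \<le> k i" using ts(2) by (simp add: s'_def)
    ultimately show "w \<in> B n" unfolding B_def using ts(1) by blast
  qed
  have Be: "e \<le> emeasure L (B n)" for n
  proof -
    have "e \<le> outer_measure_of L (V c n k)" using k by (rule less_imp_le)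
    also have "\<dots> \<le> outer_measure_of L (B n)" by (rule outer_measure_of_mono[OF VB])
    also have "\<dots> = emeasure L (B n)" using Bsets by simp
    finally show ?thesis .
  qed
  have dec: "decseq B" unfolding B_def by (intro antimonoI) (blast intro: order_trans)
  have "(INF n. emeasure L (B n)) = emeasure L (\<Inter>n. B n)"
    using Bsets by (intro INF_emeasure_decseq dec) auto
  then have "e \<le> emeasure L (\<Inter>n. B n)"
    using Be by (metis INF_greatest)
  moreover have "(\<Inter>n. B n) \<subseteq> snd ` H"
  proof
    fix w assume w: "w \<in> (\<Inter>n. B n)"
    define K where "K = {- real c..real c} \<times> {s :: nat \<Rightarrow> nat. \<forall>i. s i \<le> k i}"
    define C where "C m = {(t, s). t \<in> F m s \<and> w \<in> A m s}" for m
    have "compact K" unfolding K_def by (intro compact_Times compact_bounded_sequences) simp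
    have "closed (C m)" for m
      unfolding closed_def
    proof (subst open_subopen, intro ballI)
      fix x assume "x \<in> - C m"
      obtain t s where x: "x = (t, s)" by fastforce
      let ?Z = "{s'. \<forall>i<m. s' i = s i}"
      have eq: "F m s' = F m s \<and> A m s' = A m s" if "s' \<in> ?Z" for s' using that by (intro loc) auto
      show "\<exists>T. open T \<and> x \<in> T \<and> T \<subseteq> - C m"
      proof (cases "w \<in> A m s")
        case True
        have "t \<notin> F m s" using True \<open>x \<in> - C m\<close> by (auto simp: C_def x)
        have "(- F m s) \<times> ?Z \<subseteq> - C m" using eq unfolding C_def by blast
        moreover have "x \<in> (- F m s) \<times> ?Z" using \<open>t \<notin> F m s\<close> by (simp add: x)
        moreover have "open ((- F m s) \<times> ?Z)"
          using FA(1) by (intro open_Times open_cylinder open_Compl)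
        ultimately show ?thesis by blast
      next
        case False
        have "UNIV \<times> ?Z \<subseteq> - C m" using eq False unfolding C_def by blast
        moreover have "x \<in> UNIV \<times> ?Z" by (simp add: x)
        moreover have "open (UNIV \<times> ?Z :: (real \<times> (nat \<Rightarrow> nat)) set)"
          by (intro open_Times open_cylinder open_UNIV)
        ultimately show ?thesis by blast
      qed
    qed
    then have "K \<inter> (\<Inter>m\<in>UNIV. C m) \<noteq> {}"
    proof (rule compact_imp_fip_image[OF \<open>compact K\<close>])
      fix I :: "nat set" assume "finite I"
      obtain n where n: "\<forall>m\<in>I. m \<le> n" using \<open>finite I\<close> unfolding finite_nat_set_iff_bounded_le by blast
      from w have "w \<in> B n" by blast
      then obtain t s where "\<bar>t\<bar> \<le> real c" "\<forall>i. s i \<le> k i" "\<forall>m\<le>n. t \<in> F m s \<and> w \<in> A m s"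
        unfolding B_def by blast
      then have "(t, s) \<in> K \<inter> (\<Inter>m\<in>I. C m)" using n by (auto simp: K_def C_def)
      then show "K \<inter> (\<Inter>m\<in>I. C m) \<noteq> {}" by blast
    qed
    then obtain x where "\<And>m. x \<in> C m" by blast
    then have "\<And>m. fst x \<in> F m (snd x) \<and> w \<in> A m (snd x)" by (simp add: C_def split_beta)
    then obtain t s where "\<forall>m. t \<in> F m s \<and> w \<in> A m s" by blast
    then have "(t, w) \<in> H" unfolding Heq by blast
    then show "w \<in> snd ` H" by force
  qed
  moreover have "(\<Inter>n. B n) \<in> sets L" using Bsets by (intro sets.countable_INT) auto
  ultimately show ?thesis using e(1) by (metis less_le_trans)
qed

text \<open>The projection of \<open>H\<close> is an uncountable union over times. Testing it by the measurable sets inside it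
  is what can be carried over between two processes with the same law.\<close>

theorem projection_null:
  fixes H :: "(real \<times> 'w) set"
  assumes "finite_measure L" and H: "H \<in> sets (borel \<Otimes>\<^sub>M L)"
    and null: "\<And>A. A \<in> sets L \<Longrightarrow> A \<subseteq> snd ` H \<Longrightarrow> emeasure L A = 0"
  shows "AE w in L. w \<notin> snd ` H"
proof -
  have HT: "H \<subseteq> UNIV \<times> space L"
    using sets.sets_into_space[OF H] by (auto simp: space_pair_measure)
  have "\<not> 0 < outer_measure_of L (snd ` H)"
    using souslin_projection_inner[OF assms(1) souslin_pair_measure[OF H] HT] null by fastforce
  moreover have sp: "snd ` H \<subseteq> space L" using HT by auto
  moreover obtain E where "E \<in> sets L" "snd ` H \<subseteq> E" "outer_measure_of L (snd ` H) = emeasure L E"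
    using outer_measure_of_attain[OF sp] by blast
  ultimately show ?thesis by (intro AE_I'[of E]) (auto simp: null_sets_def)
qed

section \<open>Inversion of the Laplace transform\<close>

text \<open>The bump lies strictly to the right of \<open>s\<close>, since the functions to be recovered are only
  right-continuous there. It is a function of \<open>exp (- t)\<close> so that polynomials in \<open>exp (- t)\<close> can approximate
  it. Writing \<open>\<bar>t\<bar>\<close> keeps the argument in \<open>(0, 1]\<close> for all \<open>t\<close>, while the exponential law does not
  charge negative times.\<close>

lemma bump_kernel_exists:
  fixes q s d :: real
  assumes q: "0 < q" and s: "0 \<le> s" and d: "0 < d"
  defines "\<mu> \<equiv> density lborel (exponential_density q)"
  shows "\<exists>h. continuous_on UNIV h \<and> (\<forall>x. 0 \<le> h x) \<and> (\<forall>t\<ge>0. h (exp (- t)) \<noteq> 0 \<longrightarrow> s < t \<and> t < s + d) \<and>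
     integrable \<mu> (\<lambda>t. h (exp (- \<bar>t\<bar>))) \<and> (\<integral>t. h (exp (- \<bar>t\<bar>)) \<partial>\<mu>) = (1 :: real)"
proof -
  interpret prob_space \<mu> unfolding \<mu>_def by (rule prob_space_exponential_density[OF q])
  have sets_mu[measurable_cong]: "sets \<mu> = sets borel" by (simp add: \<mu>_def)
  define b where "b x = max 0 ((exp (- s) - x) * (x - exp (- (s + d))))" for x :: real
  have b0: "0 \<le> b x" for x by (simp add: b_def)
  have bc: "continuous_on UNIV b" unfolding b_def by (intro continuous_intros)
  have [measurable]: "b \<in> borel_measurable borel"
    using bc by (rule borel_measurable_continuous_onI)
  have b1: "b x \<le> 1" if "0 \<le> x" for x
  proof (cases "exp (- s) - x \<ge> 0 \<and> x - exp (- (s + d)) \<ge> 0")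
    case True
    moreover have "exp (- s) \<le> 1" "0 < exp (- (s + d))" using s by auto
    ultimately have "exp (- s) - x \<le> 1" "x - exp (- (s + d)) \<le> 1" using that by linarith+
    then have "(exp (- s) - x) * (x - exp (- (s + d))) \<le> 1" using True mult_le_one by blast
    then show ?thesis by (simp add: b_def)
  next
    case False
    moreover have "exp (- (s + d)) < exp (- s)" using d by simp
    ultimately have "(exp (- s) - x) * (x - exp (- (s + d))) \<le> 0"
      unfolding mult_le_0_iff by linarith
    then show ?thesis by (simp add: b_def)
  qed
  have bsupp: "b (exp (- t)) \<noteq> 0 \<longleftrightarrow> s < t \<and> t < s + d" for t
  proof -
    have "b (exp (- t)) \<noteq> 0 \<longleftrightarrow> 0 < (exp (- s) - exp (- t)) * (exp (- t) - exp (- (s + d)))"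
    proof -
      have "max 0 z \<noteq> 0 \<longleftrightarrow> 0 < z" for z :: real by auto
      then show ?thesis unfolding b_def .
    qed
    also have "\<dots> \<longleftrightarrow> s < t \<and> t < s + d" using d by (auto simp: zero_less_mult_iff)
    finally show ?thesis .
  qed
  let ?b = "\<lambda>t. b (exp (- \<bar>t\<bar>))"
  have bi: "integrable \<mu> ?b"
    by (rule integrable_const_bound[where B = 1]) (use b0 b1 in auto)
  define c where "c = (\<integral>t. ?b t \<partial>\<mu>)"
  have "0 \<le> c" unfolding c_def using b0 by (intro Bochner_Integration.integral_nonneg) auto
  moreover have "c \<noteq> 0"
  proof
    assume "c = 0"
    then have "AE t in \<mu>. ?b t = 0"
      unfolding c_def using integral_nonneg_eq_0_iff_AE[OF bi] b0 by auto
    then have "AE t in lborel. 0 < ennreal (exponential_density q t) \<longrightarrow> ?b t = 0"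
      unfolding \<mu>_def by (subst (asm) AE_density) auto
    then have "AE t in lborel. t \<notin> {s<..<s + d}"
    proof eventually_elim
      case (elim t)
      show ?case
      proof
        assume t: "t \<in> {s<..<s + d}"
        then have "0 \<le> t" using s by simp
        then have "0 < ennreal (exponential_density q t)" using q
          by (simp add: exponential_density_def)
        with elim \<open>0 \<le> t\<close> have "b (exp (- t)) = 0" by simp
        with bsupp[of t] t show False by simp
      qed
    qed
    then have "emeasure lborel {s<..<s + d} = 0"
      by (subst (asm) AE_iff_measurable[OF _ refl]) (auto simp: greaterThanLessThan_def greaterThan_def lessThan_def Int_def)
    then show False using d by simp
  qed
  ultimately have c: "0 < c" by simp
  show ?thesis
  proof (intro exI[of _ "\<lambda>x. b x / c"] conjI allI impI)
    show "continuous_on UNIV (\<lambda>x. b x / c)" using c bc by (intro continuous_intros) auto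
    show "(\<integral>t. b (exp (- \<bar>t\<bar>)) / c \<partial>\<mu>) = 1" using c by (simp add: c_def)
    show "integrable \<mu> (\<lambda>t. b (exp (- \<bar>t\<bar>)) / c)" using bi by simp
  qed (use bsupp b0 c in auto)
qed

lemma exponential_integral_eq_laplace:
  fixes \<phi> :: "real \<Rightarrow> real"
  assumes q: "0 < q" and [measurable]: "\<phi> \<in> borel_measurable borel" and \<phi>: "\<And>t. 0 \<le> \<phi> t"
  shows "(\<integral>t. exp (- \<bar>t\<bar>) ^ j * \<phi> t \<partial>density lborel (exponential_density q)) =
    q * enn2real (\<integral>\<^sup>+ t\<in>{0..}. ennreal (exp (- (q + real j) * t)) * ennreal (\<phi> t) \<partial>lborel)"
proof -
  have "(\<integral>t. exp (- \<bar>t\<bar>) ^ j * \<phi> t \<partial>density lborel (exponential_density q)) =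
      (\<integral>t. exponential_density q t * (exp (- \<bar>t\<bar>) ^ j * \<phi> t) \<partial>lborel)"
    using q by (subst integral_density) (auto simp: exponential_density_nonneg)
  also have "\<dots> = (\<integral>t. q * (indicator {0..} t * (exp (- (q + real j) * t) * \<phi> t)) \<partial>lborel)"
    by (intro Bochner_Integration.integral_cong refl)
       (auto simp: exponential_density_def indicator_def exp_of_nat_mult[symmetric] exp_add[symmetric] algebra_simps)
  also have "\<dots> = q * (\<integral>t. indicator {0..} t * (exp (- (q + real j) * t) * \<phi> t) \<partial>lborel)"
    by simp
  also have "(\<integral>t. indicator {0..} t * (exp (- (q + real j) * t) * \<phi> t) \<partial>lborel) =
      enn2real (\<integral>\<^sup>+ t. ennreal (indicator {0..} t * (exp (- (q + real j) * t) * \<phi> t)) \<partial>lborel)"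
    using \<phi> by (intro integral_eq_nn_integral) auto
  also have "(\<integral>\<^sup>+ t. ennreal (indicator {0..} t * (exp (- (q + real j) * t) * \<phi> t)) \<partial>lborel) =
      (\<integral>\<^sup>+ t\<in>{0..}. ennreal (exp (- (q + real j) * t)) * ennreal (\<phi> t) \<partial>lborel)"
    by (intro nn_integral_cong) (use \<phi> in \<open>auto simp: indicator_def ennreal_mult'\<close>)
  finally show ?thesis .
qed

text \<open>The coefficients do not depend on the function. Therefore the Laplace transform determines the value
  at \<open>s\<close>, and this value is a measurable function of any parameter in which the transform is measurable.\<close>

definition inverts_laplace :: "real \<Rightarrow> real \<Rightarrow> (nat \<Rightarrow> nat \<Rightarrow> real) \<Rightarrow> (nat \<Rightarrow> nat) \<Rightarrow> bool" where
  "inverts_laplace q s c d \<longleftrightarrow> (\<forall>\<phi>. \<phi> \<in> borel_measurable borel \<longrightarrow> (\<forall>t. 0 \<le> \<phi> t \<and> \<phi> t \<le> 1) \<longrightarrow>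
     (\<phi> \<longlongrightarrow> \<phi> s) (at_right s) \<longrightarrow>
     (\<lambda>n. \<Sum>j\<le>d n. c n j * enn2real
       (\<integral>\<^sup>+ t\<in>{0..}. ennreal (exp (- (q + real j) * t)) * ennreal (\<phi> t) \<partial>lborel)) \<longlonglongrightarrow> (\<phi> s :: real))"

text \<open>Averaging against a bump of width \<open>1 / (n + 1)\<close> to the right of \<open>s\<close> nearly evaluates a right-continuous
  function at \<open>s\<close>. By Weierstrass' theorem the bump is a polynomial in \<open>exp (- t)\<close> up to \<open>1 / (n + 1)\<close>, and
  against the density \<open>q exp (- q t)\<close> the monomials give the transform at \<open>q, q + 1, \<dots>\<close>.\<close>

lemma laplace_inversion:
  fixes q s :: real
  assumes q: "0 < q" and s: "0 \<le> s"
  shows "\<exists>c d. inverts_laplace q s c d"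
proof -
  define \<mu> where "\<mu> = density lborel (exponential_density q)"
  interpret prob_space \<mu> unfolding \<mu>_def by (rule prob_space_exponential_density[OF q])
  have sets_mu[measurable_cong]: "sets \<mu> = sets borel" by (simp add: \<mu>_def)
  have "\<forall>n. \<exists>h. continuous_on UNIV h \<and> (\<forall>x. 0 \<le> h x) \<and>
      (\<forall>t\<ge>0. h (exp (- t)) \<noteq> 0 \<longrightarrow> s < t \<and> t < s + 1 / real (Suc n)) \<and>
      integrable \<mu> (\<lambda>t. h (exp (- \<bar>t\<bar>))) \<and> (\<integral>t. h (exp (- \<bar>t\<bar>)) \<partial>\<mu>) = (1 :: real)"
    unfolding \<mu>_def using bump_kernel_exists[OF q s] by simp
  then obtain h where hc: "\<And>n. continuous_on UNIV (h n)" and h0: "\<And>n x. 0 \<le> h n x"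
    and hs: "\<And>n t. 0 \<le> t \<Longrightarrow> h n (exp (- t)) \<noteq> 0 \<Longrightarrow> s < t \<and> t < s + 1 / real (Suc n)"
    and hi: "\<And>n. integrable \<mu> (\<lambda>t. h n (exp (- \<bar>t\<bar>)))"
    and h1: "\<And>n. (\<integral>t. h n (exp (- \<bar>t\<bar>)) \<partial>\<mu>) = (1 :: real)"
    unfolding choice_iff by blast
  have [measurable]: "h n \<in> borel_measurable borel" for n
    using hc by (rule borel_measurable_continuous_onI)
  have "\<forall>n. \<exists>p. (\<exists>a d. p = (\<lambda>x. \<Sum>j\<le>d. a j * x ^ j)) \<and> (\<forall>x\<in>{0..1}. \<bar>h n x - p x\<bar> < 1 / real (Suc n))"
  proof
    fix n
    obtain p where "real_polynomial_function p" "\<And>x. x \<in> {0..1} \<Longrightarrow> \<bar>h n x - p x\<bar> < 1 / real (Suc n)"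
      using Stone_Weierstrass_real_polynomial_function[of "{0..1}" "h n" "1 / real (Suc n)"]
        continuous_on_subset[OF hc] by auto
    then show "\<exists>p. (\<exists>a d. p = (\<lambda>x. \<Sum>j\<le>d. a j * x ^ j)) \<and> (\<forall>x\<in>{0..1}. \<bar>h n x - p x\<bar> < 1 / real (Suc n))"
      unfolding real_polynomial_function_iff_sum by blast
  qed
  then obtain p where p: "\<And>n. \<exists>a d. p n = (\<lambda>x. \<Sum>j\<le>d. a j * x ^ j)"
    and hp: "\<And>n x. x \<in> {0..1} \<Longrightarrow> \<bar>h n x - p n x\<bar> < 1 / real (Suc n)"
    unfolding choice_iff by blast
  from p have "\<exists>a d. \<forall>n. p n = (\<lambda>x. \<Sum>j\<le>d n. a n j * x ^ j)" by metis
  then obtain a d where pn: "\<And>n. p n = (\<lambda>x. \<Sum>j\<le>d n. a n j * x ^ j)" by blast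
  have "(\<lambda>n. \<Sum>j\<le>d n. (q * a n j) * enn2real
       (\<integral>\<^sup>+ t\<in>{0..}. ennreal (exp (- (q + real j) * t)) * ennreal (\<phi> t) \<partial>lborel)) \<longlonglongrightarrow> \<phi> s"
    if [measurable]: "\<phi> \<in> borel_measurable borel" and \<phi>: "\<forall>t. 0 \<le> \<phi> t \<and> \<phi> t \<le> 1"
      and lim: "(\<phi> \<longlongrightarrow> \<phi> s) (at_right s)" for \<phi> :: "real \<Rightarrow> real"
  proof -
    have int: "integrable \<mu> (\<lambda>t. exp (- \<bar>t\<bar>) ^ j * \<phi> t)" for j
      by (rule integrable_const_bound[where B = 1])
        (use \<phi> in \<open>auto simp: abs_mult intro!: mult_le_one power_le_one\<close>)
    have eq: "(\<Sum>j\<le>d n. (q * a n j) * enn2real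
       (\<integral>\<^sup>+ t\<in>{0..}. ennreal (exp (- (q + real j) * t)) * ennreal (\<phi> t) \<partial>lborel))
       = (\<integral>t. p n (exp (- \<bar>t\<bar>)) * \<phi> t \<partial>\<mu>)" (is "?S n = _") for n
    proof -
      have "?S n = (\<Sum>j\<le>d n. a n j * (\<integral>t. exp (- \<bar>t\<bar>) ^ j * \<phi> t \<partial>\<mu>))"
        unfolding \<mu>_def using \<phi> by (subst exponential_integral_eq_laplace[OF q]) (auto simp: ac_simps)
      also have "\<dots> = (\<integral>t. (\<Sum>j\<le>d n. a n j * (exp (- \<bar>t\<bar>) ^ j * \<phi> t)) \<partial>\<mu>)"
        using int by (subst Bochner_Integration.integral_sum) auto
      also have "\<dots> = (\<integral>t. p n (exp (- \<bar>t\<bar>)) * \<phi> t \<partial>\<mu>)"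
        by (simp add: pn sum_distrib_right mult.assoc)
      finally show ?thesis .
    qed
    have pint: "integrable \<mu> (\<lambda>t. p n (exp (- \<bar>t\<bar>)) * \<phi> t)" for n
      unfolding pn sum_distrib_right mult.assoc using int by (intro Bochner_Integration.integrable_sum integrable_mult_right) auto
    have hint: "integrable \<mu> (\<lambda>t. h n (exp (- \<bar>t\<bar>)) * (\<phi> t - c))" if "0 \<le> c" "c \<le> 1" for n c
    proof (rule Bochner_Integration.integrable_bound[OF hi[of n]])
      have "\<bar>\<phi> t - c\<bar> \<le> 1" for t using \<phi> that by (smt (verit))
      then show "AE t in \<mu>. norm (h n (exp (- \<bar>t\<bar>)) * (\<phi> t - c)) \<le> norm (h n (exp (- \<bar>t\<bar>)))"
        by (intro AE_I2) (simp add: abs_mult mult_left_le)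
    qed simp
    have AE0: "AE t in \<mu>. 0 \<le> t"
      unfolding \<mu>_def by (subst AE_density) (auto simp: exponential_density_def)
    show ?thesis unfolding eq
    proof (rule LIMSEQ_I)
      fix r :: real assume r: "0 < r"
      from lim have "\<forall>\<^sub>F t in at_right s. dist (\<phi> t) (\<phi> s) < r / 4" using r by (intro tendstoD) auto
      then obtain \<delta> where \<delta>: "s < \<delta>" "\<And>t. s < t \<Longrightarrow> t < \<delta> \<Longrightarrow> dist (\<phi> t) (\<phi> s) < r / 4"
        unfolding eventually_at_right_field by blast
      obtain N where N: "1 / real (Suc N) < min (\<delta> - s) (r / 4)"
        using reals_Archimedean[of "min (\<delta> - s) (r / 4)"] \<delta>(1) r by (auto simp: inverse_eq_divide)
      have "norm ((\<integral>t. p n (exp (- \<bar>t\<bar>)) * \<phi> t \<partial>\<mu>) - \<phi> s) < r" if "N \<le> n" for n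
      proof -
        have nN: "1 / real (Suc n) \<le> 1 / real (Suc N)" using that by (intro divide_left_mono) auto
        let ?P = "\<lambda>t. p n (exp (- \<bar>t\<bar>)) * \<phi> t" and ?H = "\<lambda>t. h n (exp (- \<bar>t\<bar>)) * \<phi> t"
        have Hint: "integrable \<mu> ?H" using hint[of 0 n] by simp
        have "\<bar>(\<integral>t. ?P t \<partial>\<mu>) - (\<integral>t. ?H t \<partial>\<mu>)\<bar> = \<bar>\<integral>t. ?P t - ?H t \<partial>\<mu>\<bar>"
          using pint Hint by simp
        also have "\<dots> \<le> (\<integral>t. \<bar>?P t - ?H t\<bar> \<partial>\<mu>)" by (rule integral_abs_bound)
        also have "\<dots> \<le> (\<integral>t. r / 4 \<partial>\<mu>)"
        proof (rule integral_mono)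
          fix t
          have "\<bar>p n (exp (- \<bar>t\<bar>)) - h n (exp (- \<bar>t\<bar>))\<bar> \<le> r / 4"
            using hp[of "exp (- \<bar>t\<bar>)" n] N nN by (simp add: abs_minus_commute)
          moreover have "\<bar>?P t - ?H t\<bar> = \<bar>p n (exp (- \<bar>t\<bar>)) - h n (exp (- \<bar>t\<bar>))\<bar> * \<phi> t"
            using \<phi> by (simp add: left_diff_distrib[symmetric] abs_mult)
          ultimately show "\<bar>?P t - ?H t\<bar> \<le> r / 4"
            using \<phi> mult_mono[of "\<bar>p n (exp (- \<bar>t\<bar>)) - h n (exp (- \<bar>t\<bar>))\<bar>" "r / 4" "\<phi> t" 1] r by simp
        qed (use pint Hint in auto)
        finally have A: "\<bar>(\<integral>t. ?P t \<partial>\<mu>) - (\<integral>t. ?H t \<partial>\<mu>)\<bar> \<le> r / 4" by (simp add: prob_space)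
        let ?D = "\<lambda>t. h n (exp (- \<bar>t\<bar>)) * (\<phi> t - \<phi> s)"
        have Dint: "integrable \<mu> ?D" using hint[of "\<phi> s" n] \<phi> by blast
        have "(\<integral>t. ?H t \<partial>\<mu>) - \<phi> s = (\<integral>t. ?H t \<partial>\<mu>) - (\<integral>t. h n (exp (- \<bar>t\<bar>)) * \<phi> s \<partial>\<mu>)"
          using h1[of n] by simp
        also have "\<dots> = (\<integral>t. ?D t \<partial>\<mu>)"
          unfolding right_diff_distrib using Hint hi[of n]
          by (intro Bochner_Integration.integral_diff[symmetric]) auto
        finally have "\<bar>(\<integral>t. ?H t \<partial>\<mu>) - \<phi> s\<bar> \<le> (\<integral>t. \<bar>?D t\<bar> \<partial>\<mu>)"
          using integral_abs_bound by metis
        also have "\<dots> \<le> (\<integral>t. h n (exp (- \<bar>t\<bar>)) * (r / 4) \<partial>\<mu>)"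
        proof (rule integral_mono_AE)
          show "AE t in \<mu>. \<bar>?D t\<bar> \<le> h n (exp (- \<bar>t\<bar>)) * (r / 4)"
            using AE0
          proof eventually_elim
            case (elim t)
            show ?case
            proof (cases "h n (exp (- t)) = 0")
              case False
              from hs[OF elim False] N nN have "s < t" "t < \<delta>" by auto
              then have "\<bar>\<phi> t - \<phi> s\<bar> \<le> r / 4" using \<delta>(2)[of t] by (simp add: dist_real_def)
              then show ?thesis using h0 elim mult_left_mono[OF _ h0] by (simp only: abs_mult abs_of_nonneg)
            qed (use elim in simp)
          qed
        qed (use Dint hi[of n] in auto)
        also have "\<dots> = r / 4" using h1[of n] by simp
        finally show ?thesis using A r unfolding real_norm_def by linarith
      qed
      then show "\<exists>N. \<forall>n\<ge>N. norm ((\<integral>t. p n (exp (- \<bar>t\<bar>)) * \<phi> t \<partial>\<mu>) - \<phi> s) < r" by blast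
    qed
  qed
  then show ?thesis unfolding inverts_laplace_def
    by (intro exI[of _ "\<lambda>n j. q * a n j"] exI[of _ d]) blast
qed

section \<open>Potentials of a resolvent\<close>

lemma resolvent_sets:
  assumes "sub_markov_resolvent M U" "0 < q" "x \<in> space M"
  shows "sets (U q x) = sets M" "space (U q x) = space M"
  using assms sets_eq_imp_space_eq[of "U q x" M] by (auto simp: sub_markov_resolvent_def kernel_on_def)

lemma resolvent_kernel_on: "sub_markov_resolvent M U \<Longrightarrow> 0 < q \<Longrightarrow> kernel_on M (U q)"
  by (simp add: sub_markov_resolvent_def)

lemma resolvent_equation:
  assumes "sub_markov_resolvent M U" "0 < p" "p < q" "f \<in> borel_measurable M" "x \<in> space M"
  shows "kernel_apply (U p) f x = kernel_apply (U q) f x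
      + ennreal (q - p) * kernel_apply (U p) (kernel_apply (U q) f) x"
  using assms unfolding sub_markov_resolvent_def by blast

lemma resolvent_cong:
  assumes "sub_markov_resolvent M U" "0 < q" "x \<in> space M" "\<And>y. y \<in> space M \<Longrightarrow> f y = g y"
  shows "kernel_apply (U q) f x = kernel_apply (U q) g x"
  using assms resolvent_sets(2)[OF assms(1-3)] unfolding kernel_apply_def
  by (intro nn_integral_cong) auto

lemma resolvent_cmult:
  assumes "sub_markov_resolvent M U" "0 < q" "x \<in> space M" "f \<in> borel_measurable M"
  shows "kernel_apply (U q) (\<lambda>y. c * f y) x = c * kernel_apply (U q) f x"
proof -
  have "f \<in> borel_measurable (U q x)"
    using assms resolvent_sets(1)[OF assms(1-3)] by (simp cong: measurable_cong_sets)
  then show ?thesis unfolding kernel_apply_def by (rule nn_integral_cmult)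
qed

lemma resolvent_le:
  assumes U: "sub_markov_resolvent M U" and q: "0 < q" and x: "x \<in> space M"
    and f: "\<And>y. y \<in> space M \<Longrightarrow> f y \<le> ennreal B" and B: "0 \<le> B"
  shows "kernel_apply (U q) f x \<le> ennreal (B / q)"
proof -
  have one: "ennreal q * kernel_apply (U q) (\<lambda>_. 1) x \<le> 1"
    using U q x by (simp add: sub_markov_resolvent_def)
  have "kernel_apply (U q) f x \<le> kernel_apply (U q) (\<lambda>_. ennreal B * 1) x"
    using f resolvent_sets(2)[OF U q x] unfolding kernel_apply_def by (intro nn_integral_mono) auto
  also have "\<dots> = ennreal B * kernel_apply (U q) (\<lambda>_. 1) x"
    by (rule resolvent_cmult[OF U q x]) simp
  also have "\<dots> = ennreal (B / q) * (ennreal q * kernel_apply (U q) (\<lambda>_. 1) x)"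
    using q B by (simp add: mult.assoc[symmetric] ennreal_mult[symmetric])
  also have "\<dots> \<le> ennreal (B / q) * 1" using one by (rule mult_left_mono) simp
  finally show ?thesis by simp
qed

text \<open>The resolvent equation, iterated, is a geometric series with ratio \<open>(q - p) / q < 1\<close>. It
  expresses \<open>U p\<close> through powers of \<open>U q\<close>, so that the two commute.\<close>

lemma resolvent_neumann_series:
  assumes U: "sub_markov_resolvent M U" and pq: "0 < p" "p < q" and x: "x \<in> space M"
    and f: "f \<in> borel_measurable M" and fB: "\<And>y. y \<in> space M \<Longrightarrow> f y \<le> ennreal B" and B: "0 \<le> B"
  shows "kernel_apply (U p) f x = (\<Sum>n. ennreal (q - p) ^ n * (kernel_apply (U q) ^^ Suc n) f x)"
proof -
  let ?c = "ennreal (q - p)" and ?K = "kernel_apply (U q)"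
  have q: "0 < q" using pq by simp
  have meas: "(?K ^^ n) f \<in> borel_measurable M" for n
    using f by (induction n) (auto intro!: kernel_apply_measurable resolvent_kernel_on[OF U q])
  have bd: "(?K ^^ n) f y \<le> ennreal (B / q ^ n)" if "y \<in> space M" for n y
    using that
  proof (induction n arbitrary: y)
    case 0 then show ?case using fB by simp
  next
    case (Suc n)
    have "?K ((?K ^^ n) f) y \<le> ennreal (B / q ^ n / q)"
      using Suc q B by (intro resolvent_le[OF U q]) auto
    then show ?case by (simp add: mult.commute)
  qed
  let ?S = "\<lambda>N. \<Sum>n<N. ?c ^ n * (?K ^^ Suc n) f x"
  let ?R = "\<lambda>N. ?c ^ N * kernel_apply (U p) ((?K ^^ N) f) x"
  have expand: "kernel_apply (U p) f x = ?S N + ?R N" for N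
  proof (induction N)
    case (Suc N)
    have "kernel_apply (U p) ((?K ^^ N) f) x = ?K ((?K ^^ N) f) x + ?c * kernel_apply (U p) (?K ((?K ^^ N) f)) x"
      by (rule resolvent_equation[OF U pq meas x])
    then show ?case unfolding Suc by (simp add: distrib_left mult.assoc add.assoc mult.left_commute)
  qed simp
  have R: "?R N \<le> ennreal (((q - p) / q) ^ N * (B / p))" for N
  proof -
    have "kernel_apply (U p) ((?K ^^ N) f) x \<le> ennreal (B / q ^ N / p)"
      using bd B q by (intro resolvent_le[OF U pq(1) x]) auto
    then have "?R N \<le> ?c ^ N * ennreal (B / q ^ N / p)" by (rule mult_left_mono) simp
    also have "\<dots> = ennreal (((q - p) / q) ^ N * (B / p))"
      using pq B q by (simp add: ennreal_power ennreal_mult[symmetric] power_divide)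
    finally show ?thesis .
  qed
  have "(\<lambda>N. ((q - p) / q) ^ N * (B / p)) \<longlonglongrightarrow> 0 * (B / p)"
    using pq by (intro tendsto_mult LIMSEQ_realpow_zero tendsto_const) auto
  then have "(\<lambda>N. ennreal (((q - p) / q) ^ N * (B / p))) \<longlonglongrightarrow> 0"
    using tendsto_ennrealI by fastforce
  then have R0: "?R \<longlonglongrightarrow> 0"
    by (rule tendsto_sandwich[OF _ _ tendsto_const, rotated 2]) (use R in auto)
  have "?S \<longlonglongrightarrow> (\<Sum>n. ?c ^ n * (?K ^^ Suc n) f x)" by (rule summable_LIMSEQ) simp
  from tendsto_add[OF this R0] show ?thesis unfolding expand[symmetric]
    by (simp add: LIMSEQ_const_iff)
qed

lemma resolvent_commute:
  assumes U: "sub_markov_resolvent M U" and pq: "0 < p" "p < q" and x: "x \<in> space M"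
    and f: "f \<in> borel_measurable M" and fB: "\<And>y. y \<in> space M \<Longrightarrow> f y \<le> ennreal B" and B: "0 \<le> B"
  shows "kernel_apply (U q) (kernel_apply (U p) f) x = kernel_apply (U p) (kernel_apply (U q) f) x"
proof -
  let ?c = "ennreal (q - p)" and ?K = "kernel_apply (U q)"
  have q: "0 < q" using pq by simp
  have meas: "(?K ^^ n) f \<in> borel_measurable M" for n
    using f by (induction n) (auto intro!: kernel_apply_measurable resolvent_kernel_on[OF U q])
  have "?K (kernel_apply (U p) f) x = ?K (\<lambda>y. \<Sum>n. ?c ^ n * (?K ^^ Suc n) f y) x"
    by (rule resolvent_cong[OF U q x]) (rule resolvent_neumann_series[OF U pq _ f fB B])
  also have "\<dots> = (\<Sum>n. ?K (\<lambda>y. ?c ^ n * (?K ^^ Suc n) f y) x)"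
    unfolding kernel_apply_def[of "U q" "\<lambda>y. \<Sum>n. _ n y"] kernel_apply_def[of "U q" "\<lambda>y. _ * _ y"]
    using meas[of "Suc n" for n] resolvent_sets(1)[OF U q x]
    by (intro nn_integral_suminf borel_measurable_times_ennreal) (simp_all cong: measurable_cong_sets)
  also have "\<dots> = (\<Sum>n. ?c ^ n * (?K ^^ Suc n) (?K f) x)"
  proof (intro suminf_cong)
    fix n
    have "?K (\<lambda>y. ?c ^ n * (?K ^^ Suc n) f y) x = ?c ^ n * ?K ((?K ^^ Suc n) f) x"
      by (rule resolvent_cmult[OF U q x meas])
    also have "?K ((?K ^^ Suc n) f) = (?K ^^ Suc n) (?K f)" by (rule funpow_swap1)
    finally show "?K (\<lambda>y. ?c ^ n * (?K ^^ Suc n) f y) x = ?c ^ n * (?K ^^ Suc n) (?K f) x" .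
  qed
  also have "\<dots> = kernel_apply (U p) (?K f) x"
    using resolvent_le[OF U q _ fB B] q B
    by (intro resolvent_neumann_series[OF U pq x _ , of _ "B / q", symmetric] kernel_apply_measurable resolvent_kernel_on[OF U q] f) auto
  finally show ?thesis .
qed

text \<open>The resolvent equation and commutation give
  \<open>u = U (\<beta> + r) f + r U (\<beta> + r) u\<close> for \<open>u = U \<beta> f\<close>, where the first summand is at most \<open>B / (\<beta> + r)\<close>.\<close>

lemma excessive_potential:
  assumes U: "sub_markov_resolvent M U" and \<beta>: "0 < \<beta>"
    and f: "f \<in> borel_measurable M" and fB: "\<And>y. y \<in> space M \<Longrightarrow> f y \<le> ennreal B" and B: "0 \<le> B"
  shows "excessive M U \<beta> (kernel_apply (U \<beta>) f)"
proof -
  let ?u = "kernel_apply (U \<beta>) f"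
  have eq: "?u x = kernel_apply (U (\<beta> + r)) f x + ennreal r * kernel_apply (U (\<beta> + r)) ?u x"
    if "0 < r" "x \<in> space M" for r x
  proof -
    have "kernel_apply (U (\<beta> + r)) ?u x = kernel_apply (U \<beta>) (kernel_apply (U (\<beta> + r)) f) x"
      using that \<beta> by (intro resolvent_commute[OF U \<beta> _ _ f fB B]) auto
    then show ?thesis using resolvent_equation[OF U \<beta> _ f, of "\<beta> + r" x] that by simp
  qed
  have "((\<lambda>r. ennreal r * kernel_apply (U (\<beta> + r)) ?u x) \<longlongrightarrow> ?u x) at_top" if x: "x \<in> space M" for x
  proof -
    have fin: "?u x < \<infinity>"
      using le_less_trans[OF resolvent_le[OF U \<beta> x fB B] ennreal_less_top] by simp
    have "((\<lambda>r. B / (\<beta> + r)) \<longlongrightarrow> 0) at_top"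
      by (intro tendsto_divide_0[OF tendsto_const] filterlim_at_top_imp_at_infinity
          filterlim_tendsto_add_at_top[OF tendsto_const filterlim_ident])
    then have "((\<lambda>r. ennreal (B / (\<beta> + r))) \<longlongrightarrow> 0) at_top"
      using tendsto_ennrealI by fastforce
    then have "((\<lambda>r. ?u x - ennreal (B / (\<beta> + r))) \<longlongrightarrow> ?u x - 0) at_top"
      using fin by (intro tendsto_diff_ennreal tendsto_const) auto
    moreover have lower: "?u x - ennreal (B / (\<beta> + r)) \<le> ennreal r * kernel_apply (U (\<beta> + r)) ?u x"
      and upper: "ennreal r * kernel_apply (U (\<beta> + r)) ?u x \<le> ?u x" if r: "0 < r" for r
    proof -
      have "kernel_apply (U (\<beta> + r)) f x \<le> ennreal (B / (\<beta> + r))"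
        using \<beta> r by (intro resolvent_le[OF U _ x fB B]) auto
      then have "?u x \<le> ennreal (B / (\<beta> + r)) + ennreal r * kernel_apply (U (\<beta> + r)) ?u x"
        using eq[OF r x] add_right_mono by metis
      then show "?u x - ennreal (B / (\<beta> + r)) \<le> ennreal r * kernel_apply (U (\<beta> + r)) ?u x"
        by (simp add: ennreal_minus_le_iff)
      show "ennreal r * kernel_apply (U (\<beta> + r)) ?u x \<le> ?u x"
        by (subst eq[OF r x]) (rule add_increasing; simp)
    qed
    ultimately have lim: "((\<lambda>r. ?u x - ennreal (B / (\<beta> + r))) \<longlongrightarrow> ?u x) at_top" by simp
    have "\<forall>\<^sub>F r in at_top. ?u x - ennreal (B / (\<beta> + r)) \<le> ennreal r * kernel_apply (U (\<beta> + r)) ?u x"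
      using eventually_gt_at_top[of "0::real"] by eventually_elim (rule lower)
    moreover have "\<forall>\<^sub>F r in at_top. ennreal r * kernel_apply (U (\<beta> + r)) ?u x \<le> ?u x"
      using eventually_gt_at_top[of "0::real"] by eventually_elim (rule upper)
    ultimately show ?thesis by (rule tendsto_sandwich[OF _ _ lim tendsto_const])
  qed
  moreover have "ennreal r * kernel_apply (U (\<beta> + r)) ?u x \<le> ?u x" if "0 < r" "x \<in> space M" for r x
    by (subst eq[OF that]) (rule add_increasing; simp)
  ultimately show ?thesis
    unfolding excessive_def using kernel_apply_measurable[OF resolvent_kernel_on[OF U \<beta>] f] by blast
qed

section \<open>Continuous functions generating the Borel sets\<close>

lemma compact_metric_countable_dense:
  assumes "compact_space (mtopology_of (m :: 'b metric))"
  shows "\<exists>D. countable D \<and> D \<subseteq> mspace m \<and> (\<forall>x\<in>mspace m. \<forall>e>0. \<exists>d\<in>D. mdist m x d < e)"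
proof -
  interpret Metric_space "mspace m" "mdist m" by (rule Metric_space_mspace_mdist)
  have "mtotally_bounded (mspace m)"
    using assms by (simp add: mtopology_of_def compact_space_eq_mcomplete_mtotally_bounded)
  then have "\<forall>n::nat. \<exists>K. finite K \<and> K \<subseteq> mspace m \<and> mspace m \<subseteq> (\<Union>x\<in>K. mball x (1 / real (Suc n)))"
    unfolding mtotally_bounded_def by simp
  then obtain K where fin: "\<And>n. finite (K n)" and sub: "\<And>n. K n \<subseteq> mspace m"
    and cov: "\<And>n. mspace m \<subseteq> (\<Union>x\<in>K n. mball x (1 / real (Suc n)))"
    unfolding choice_iff by blast
  have "\<exists>d\<in>(\<Union>n. K n). mdist m x d < e" if "x \<in> mspace m" and e: "0 < e" for x e
  proof -
    obtain n where n: "inverse (real (Suc n)) < e" using reals_Archimedean[OF e] by blast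
    from cov[of n] \<open>x \<in> mspace m\<close> obtain d where "d \<in> K n" "x \<in> mball d (1 / real (Suc n))" by blast
    then show ?thesis using n commute[of x d] by (intro bexI[of _ d]) (auto simp: inverse_eq_divide in_mball)
  qed
  moreover have "countable (\<Union>n. K n)" using fin by (intro countable_UN) (auto intro: countable_finite)
  ultimately show ?thesis using sub by blast
qed

text \<open>Truncated distances to the points of a countable dense subset of the compact metric space into which
  the state space embeds. Every open set is the union of those of the countably many balls described by them
  that it contains.\<close>

lemma lusin_generating_functions:
  assumes T: "lusin_topology_on M T" and ne: "space M \<noteq> {}"
  shows "\<exists>f :: nat \<Rightarrow> 'a \<Rightarrow> real. (\<forall>n. continuous_map T euclideanreal (f n)) \<and>
     (\<forall>n x. 0 \<le> f n x \<and> f n x \<le> 1) \<and>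
     sets M \<subseteq> sigma_sets (space M) {{x \<in> space M. f n x < r} | n r. True}"
proof -
  obtain m :: "real metric" and B where cpt: "compact_space (mtopology_of m)"
    and hom: "T homeomorphic_space subtopology (mtopology_of m) B"
    using T unfolding lusin_topology_on_def lusin_topology_def by blast
  interpret Metric_space "mspace m" "mdist m" by (rule Metric_space_mspace_mdist)
  have tsp: "topspace T = space M" and sets_M: "sets M = sigma_sets (space M) {V. openin T V}"
    using T by (auto simp: lusin_topology_on_def borel_sets_of_def)
  obtain h g where hg: "homeomorphic_maps T (subtopology (mtopology_of m) B) h g"
    using hom unfolding homeomorphic_space_def by blast
  then have hcont: "continuous_map T (mtopology_of m) h"
    by (auto simp: homeomorphic_maps_def continuous_map_in_subtopology)
  have gcont: "continuous_map (subtopology (mtopology_of m) B) T g"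
    and gh: "\<And>x. x \<in> space M \<Longrightarrow> g (h x) = x"
    using hg tsp by (auto simp: homeomorphic_maps_def)
  have hsp: "h x \<in> mspace m \<inter> B" if "x \<in> space M" for x
  proof -
    have "continuous_map T (subtopology (mtopology_of m) B) h" using hg by (simp add: homeomorphic_maps_def)
    then have "h x \<in> topspace (subtopology (mtopology_of m) B)"
      using that tsp by (metis continuous_map_image_subset_topspace image_subset_iff)
    then show ?thesis by simp
  qed
  obtain D where D: "countable D" "D \<subseteq> mspace m" "\<And>x e. x \<in> mspace m \<Longrightarrow> 0 < e \<Longrightarrow> \<exists>d\<in>D. mdist m x d < e"
    using compact_metric_countable_dense[OF cpt] by blast
  have "D \<noteq> {}" using D(3)[of _ 1] hsp ne by fastforce
  define d where "d = from_nat_into D"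
  have dD: "d n \<in> D" for n using \<open>D \<noteq> {}\<close> by (simp add: d_def from_nat_into)
  have dm: "d n \<in> mspace m" for n using dD D(2) by blast
  have dsurj: "\<exists>n. e = d n" if "e \<in> D" for e
    using that D(1) unfolding d_def by (metis from_nat_into_surj)
  define f where "f n x = min 1 (mdist m (h x) (d n))" for n x
  have cont: "continuous_map T euclideanreal (f n)" for n
  proof -
    have "continuous_map T euclideanreal (\<lambda>x. mdist m (h x) (d n))"
      using continuous_map_mdist[OF hcont, of "\<lambda>_. d n"] dm by (simp add: mtopology_of_def topspace_mtopology)
    then show ?thesis unfolding f_def
      by (intro continuous_map_real_min continuous_map_const[THEN iffD2]) auto
  qed
  let ?G = "{{x \<in> space M. f n x < r} | n r. True}"
  have "V \<in> sigma_sets (space M) ?G" if V: "openin T V" for V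
  proof -
    \<comment> \<open>the balls of radius \<open>1 / (j + 1)\<close> around \<open>d n\<close> that are contained in \<open>V\<close>\<close>
    let ?I = "{(n, j). \<forall>x\<in>space M. f n x < 1 / real (Suc j) \<longrightarrow> x \<in> V}"
    have "V = (\<Union>(n, j)\<in>?I. {x \<in> space M. f n x < 1 / real (Suc j)})" (is "_ = ?R")
    proof (intro equalityI subsetI)
      fix x assume xV: "x \<in> V"
      have VM: "V \<subseteq> space M" using openin_subset[OF V] tsp by simp
      then have x: "x \<in> space M" using xV by blast
      have "openin (subtopology (mtopology_of m) B) {y \<in> topspace (subtopology (mtopology_of m) B). g y \<in> V}"
        using gcont V by (rule openin_continuous_map_preimage)
      then obtain W where W: "openin mtopology W"
        "{y \<in> mspace m \<inter> B. g y \<in> V} = W \<inter> B"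
        unfolding openin_subtopology by (auto simp: mtopology_of_def topspace_mtopology)
      have "h x \<in> {y \<in> mspace m \<inter> B. g y \<in> V}" using hsp[OF x] gh[OF x] xV by simp
      then have "h x \<in> W" unfolding W(2) by blast
      then obtain e where e: "0 < e" "mball (h x) e \<subseteq> W"
        using W(1) unfolding openin_mtopology by blast
      obtain j where j: "inverse (real (Suc j)) < e / 2" using reals_Archimedean[of "e / 2"] e(1) by auto
      have j1: "1 / real (Suc j) < e / 2" using j by (simp add: inverse_eq_divide)
      obtain n where n: "mdist m (h x) (d n) < 1 / real (Suc j)"
        using D(3)[of "h x" "1 / real (Suc j)"] hsp[OF x] dsurj by fastforce
      have le1: "1 / real (Suc j) \<le> 1" by simp
      have "y \<in> V" if y: "y \<in> space M" "f n y < 1 / real (Suc j)" for y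
      proof -
        have "mdist m (h y) (d n) < 1 / real (Suc j)" using y(2) le1 by (auto simp: f_def min_def split: if_splits)
        then have "mdist m (h x) (h y) < e"
          using triangle[of "h x" "d n" "h y"] hsp[OF x] hsp[OF y(1)] dm[of n] n j1 commute[of "h y" "d n"]
          by auto
        then have "h y \<in> mball (h x) e" using hsp[OF x] hsp[OF y(1)] by simp
        then have "h y \<in> W \<inter> B" using e(2) hsp[OF y(1)] by blast
        then have "g (h y) \<in> V" using W(2) by blast
        then show ?thesis using gh[OF y(1)] by simp
      qed
      moreover have "f n x < 1 / real (Suc j)" using n by (simp add: f_def min_less_iff_disj)
      ultimately show "x \<in> ?R" using x by (intro UN_I[of "(n, j)"]) auto
    qed auto
    moreover have "?R \<in> sigma_sets (space M) ?G"
      by (intro sigma_sets_UNION) (auto intro!: sigma_sets.Basic)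
    ultimately show ?thesis by simp
  qed
  then have "sets M \<subseteq> sigma_sets (space M) ?G"
    unfolding sets_M by (intro sigma_sets_mono) auto
  moreover have "0 \<le> f n x \<and> f n x \<le> 1" for n x by (simp add: f_def)
  ultimately show ?thesis using cont by blast
qed

section \<open>Means along right-continuous paths\<close>

lemma space_adjoin_cemetery: "space (adjoin_cemetery M) = insert None (Some ` space M)"
  and sets_adjoin_cemetery:
    "sets (adjoin_cemetery M) = sigma_sets (insert None (Some ` space M)) {Some ` A | A. A \<in> sets M}"
proof -
  have "{Some ` A | A. A \<in> sets M} \<subseteq> Pow (insert None (Some ` space M))"
    using sets.sets_into_space by auto
  then show "space (adjoin_cemetery M) = insert None (Some ` space M)"
    "sets (adjoin_cemetery M) = sigma_sets (insert None (Some ` space M)) {Some ` A | A. A \<in> sets M}"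
    unfolding adjoin_cemetery_def by (auto simp: space_measure_of_conv sets_measure_of_conv)
qed

lemma Some_image_in_adjoin_cemetery: "A \<in> sets M \<Longrightarrow> Some ` A \<in> sets (adjoin_cemetery M)"
  unfolding sets_adjoin_cemetery by (intro sigma_sets.Basic) auto

lemma measurable_Some_adjoin_cemetery: "Some \<in> M \<rightarrow>\<^sub>M adjoin_cemetery M"
  unfolding adjoin_cemetery_def
proof (rule measurable_measure_of)
  show "{Some ` A | A. A \<in> sets M} \<subseteq> Pow (insert None (Some ` space M))"
    using sets.sets_into_space by auto
  fix y assume "y \<in> {Some ` A | A. A \<in> sets M}"
  then obtain A where A: "y = Some ` A" "A \<in> sets M" by blast
  then have "Some -` y \<inter> space M = A" using sets.sets_into_space by auto
  then show "Some -` y \<inter> space M \<in> sets M" using A by simp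
qed auto

lemma measurable_adjoin_cemetery:
  assumes g: "(\<lambda>x. g (Some x)) \<in> M \<rightarrow>\<^sub>M L" and None: "g None \<in> space L"
  shows "g \<in> adjoin_cemetery M \<rightarrow>\<^sub>M L"
proof (rule measurableI)
  fix z assume "z \<in> space (adjoin_cemetery M)"
  then show "g z \<in> space L" using None measurable_space[OF g] by (auto simp: space_adjoin_cemetery)
next
  fix S assume S: "S \<in> sets L"
  let ?A = "(\<lambda>x. g (Some x)) -` S \<inter> space M"
  have A: "?A \<in> sets M" using g S by (rule measurable_sets)
  have "{None} = space (adjoin_cemetery M) - Some ` space M" by (auto simp: space_adjoin_cemetery)
  then have N: "{None} \<in> sets (adjoin_cemetery M)"
    using Some_image_in_adjoin_cemetery[of "space M" M] by auto
  have eq: "g -` S \<inter> space (adjoin_cemetery M) = Some ` ?A \<union> (if g None \<in> S then {None} else {})"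
    by (auto simp: space_adjoin_cemetery)
  show "g -` S \<inter> space (adjoin_cemetery M) \<in> sets (adjoin_cemetery M)"
    unfolding eq by (intro sets.Un Some_image_in_adjoin_cemetery A) (simp add: N)
qed

lemma measurable_extend0 [measurable]:
  "f \<in> borel_measurable M \<Longrightarrow> extend0 f \<in> borel_measurable (adjoin_cemetery M)"
  by (rule measurable_adjoin_cemetery) (simp_all add: extend0_def)

lemma adjoin_cemetery_mono:
  assumes "(\<lambda>x. x) \<in> M0 \<rightarrow>\<^sub>M M"
  shows "(\<lambda>z. z) \<in> adjoin_cemetery M0 \<rightarrow>\<^sub>M adjoin_cemetery M"
  using measurable_compose[OF assms measurable_Some_adjoin_cemetery]
  by (intro measurable_adjoin_cemetery) (auto simp: space_adjoin_cemetery)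

lemma extend0_le_1:
  assumes "\<And>y. y \<in> space M \<Longrightarrow> h y \<le> 1" "z \<in> space (adjoin_cemetery M)"
  shows "extend0 h z \<le> 1"
  using assms by (auto simp: extend0_def space_adjoin_cemetery)

text \<open>An approximation of \<open>t\<close> by grid points. It takes countably many values, all rational,
  and the added 1 keeps it strictly above \<open>t\<close>, so that limits from the right may be taken along it.\<close>

definition right_grid :: "nat \<Rightarrow> real \<Rightarrow> real" where
  "right_grid n t = real (nat \<lfloor>t * real (Suc n)\<rfloor> + 1) / real (Suc n)"

lemma right_grid_nonneg: "0 \<le> right_grid n t" and right_grid_rat: "right_grid n t \<in> \<rat>"
  by (simp_all add: right_grid_def)

lemma right_grid_bounds:
  assumes "0 \<le> t"
  shows "t < right_grid n t" "right_grid n t \<le> t + 1 / real (Suc n)"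
proof -
  have "0 \<le> t * real (Suc n)" using assms by simp
  then have "real (nat \<lfloor>t * real (Suc n)\<rfloor>) = real_of_int \<lfloor>t * real (Suc n)\<rfloor>" by simp
  then have "t * real (Suc n) < real (nat \<lfloor>t * real (Suc n)\<rfloor> + 1)"
    "real (nat \<lfloor>t * real (Suc n)\<rfloor> + 1) \<le> t * real (Suc n) + 1" by linarith+
  note k = this
  show "t < right_grid n t"
    using k(1) unfolding right_grid_def by (subst pos_less_divide_eq) auto
  have "right_grid n t \<le> (t * real (Suc n) + 1) / real (Suc n)"
    using k(2) unfolding right_grid_def by (rule divide_right_mono) simp
  then show "right_grid n t \<le> t + 1 / real (Suc n)" by (simp add: add_divide_distrib del: of_nat_Suc)
qed

lemma right_grid_tendsto:
  assumes "0 \<le> t"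
  shows "filterlim (\<lambda>n. right_grid n t) (at_right t) sequentially"
proof -
  have "(\<lambda>n. t + 1 / real (Suc n)) \<longlonglongrightarrow> t + 0"
    by (intro tendsto_intros LIMSEQ_Suc[OF lim_1_over_n])
  then have lim: "(\<lambda>n. t + 1 / real (Suc n)) \<longlonglongrightarrow> t" by simp
  have "(\<lambda>n. right_grid n t) \<longlonglongrightarrow> t"
  proof (rule tendsto_sandwich[OF _ _ tendsto_const lim])
    show "\<forall>\<^sub>F n in sequentially. t \<le> right_grid n t"
      using right_grid_bounds(1)[OF assms] by (intro always_eventually allI less_imp_le)
    show "\<forall>\<^sub>F n in sequentially. right_grid n t \<le> t + 1 / real (Suc n)"
      using right_grid_bounds(2)[OF assms] by (intro always_eventually allI)
  qed
  then show ?thesis using right_grid_bounds(1)[OF assms]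
    unfolding filterlim_at by (intro conjI always_eventually allI) (auto simp: less_imp_neq[symmetric])
qed

text \<open>The grid takes countably many values, so that measurability at each of them gives joint measurability.\<close>

lemma measurable_right_grid:
  assumes "\<And>r. 0 \<le> r \<Longrightarrow> r \<in> \<rat> \<Longrightarrow> Z r \<in> L \<rightarrow>\<^sub>M K"
  shows "(\<lambda>(t, w). Z (right_grid n t) w) \<in> borel \<Otimes>\<^sub>M L \<rightarrow>\<^sub>M K"
proof -
  have 1: "(\<lambda>x. Z (real (i + 1) / real (Suc n)) (snd x)) \<in> borel \<Otimes>\<^sub>M L \<rightarrow>\<^sub>M K" for i :: nat
    by (intro measurable_compose[OF measurable_snd assms]) auto
  have 2: "(\<lambda>x. nat \<lfloor>fst x * real (Suc n)\<rfloor>) \<in> (borel :: real measure) \<Otimes>\<^sub>M L \<rightarrow>\<^sub>M count_space UNIV"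
    by measurable
  show ?thesis unfolding split_beta right_grid_def
    by (rule measurable_compose_countable[OF 1 2])
qed

definition right_continuous_along ::
    "(real \<Rightarrow> 'w \<Rightarrow> 'a option) \<Rightarrow> ('a \<Rightarrow> ennreal) \<Rightarrow> 'w \<Rightarrow> bool" where
  "right_continuous_along X h w \<longleftrightarrow>
     (\<forall>t\<ge>0. ((\<lambda>s. extend0 h (X s w)) \<longlongrightarrow> extend0 h (X t w)) (at_right t))"

lemma right_continuous_along_grid:
  assumes "right_continuous_along X h w" "0 \<le> a" "0 \<le> t"
  shows "(\<lambda>n. extend0 h (X (a + right_grid n t) w)) \<longlonglongrightarrow> extend0 h (X (a + t) w)"
proof -
  have "filterlim (\<lambda>n. a + right_grid n t) (at_right (a + t)) sequentially"
    using right_grid_tendsto[OF assms(3)] unfolding filterlim_at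
    by (auto intro!: tendsto_intros)
  moreover have "((\<lambda>s. extend0 h (X s w)) \<longlongrightarrow> extend0 h (X (a + t) w)) (at_right (a + t))"
    using assms unfolding right_continuous_along_def by simp
  ultimately show ?thesis by (rule filterlim_compose[rotated])
qed

context markov_process
begin

lemma space_P: "x \<in> space M \<Longrightarrow> space (P x) = space \<G>"
  using sets_P by (rule sets_eq_imp_space_eq)

lemma X_measurable_G: "0 \<le> t \<Longrightarrow> X t \<in> \<G> \<rightarrow>\<^sub>M adjoin_cemetery M"
  using measurable_from_subalg[OF subalgebra_filtration adapted] .

lemma X_measurable_P: "0 \<le> t \<Longrightarrow> x \<in> space M \<Longrightarrow> X t \<in> P x \<rightarrow>\<^sub>M adjoin_cemetery M"
  using X_measurable_G sets_P by (simp cong: measurable_cong_sets)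

lemma X_in_space: "0 \<le> t \<Longrightarrow> w \<in> space \<G> \<Longrightarrow> X t w \<in> space (adjoin_cemetery M)"
  using measurable_space[OF X_measurable_G] .

text \<open>The Markov property in the form that can be iterated: the past enters as a weight.\<close>

lemma markov_integral:
  assumes s: "0 \<le> s" and t: "0 \<le> t" and Y: "Y \<in> borel_measurable (\<F> t)"
    and f: "f \<in> borel_measurable M" and x: "x \<in> space M"
  shows "(\<integral>\<^sup>+ w. Y w * extend0 f (X (t + s) w) \<partial>P x) =
    (\<integral>\<^sup>+ w. Y w * extend0 (\<lambda>y. \<integral>\<^sup>+ v. extend0 f (X s v) \<partial>P y) (X t w) \<partial>P x)"
proof -
  interpret prob_space "P x" using x by (rule prob_space_P)
  have "subalgebra (P x) (\<F> t)"
    using subalgebra_filtration[OF t] sets_P[OF x] space_P[OF x] by (simp add: subalgebra_def)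
  then interpret finite_measure_subalgebra "P x" "\<F> t" by unfold_locales
  have g: "(\<lambda>w. extend0 f (X (t + s) w)) \<in> borel_measurable (P x)"
    using s t by (intro measurable_compose[OF X_measurable_P[OF _ x] measurable_extend0[OF f]]) simp
  have "(\<integral>\<^sup>+ w. Y w * extend0 f (X (t + s) w) \<partial>P x) =
      (\<integral>\<^sup>+ w. Y w * nn_cond_exp (P x) (\<F> t) (\<lambda>v. extend0 f (X (t + s) v)) w \<partial>P x)"
    by (rule nn_cond_exp_intg[OF Y g, symmetric])
  also have "\<dots> = (\<integral>\<^sup>+ w. Y w * extend0 (\<lambda>y. \<integral>\<^sup>+ v. extend0 f (X s v) \<partial>P y) (X t w) \<partial>P x)"
    using markov[OF s t f x] by (intro nn_integral_cong_AE) auto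
  finally show ?thesis .
qed

text \<open>The map \<open>(t, w) \<mapsto> X t w\<close> itself need not be jointly measurable. The lower
  limit \<open>Z\<close> of its values along the grid is, and almost surely it agrees with \<open>extend0 h (X t w)\<close> for all
  times at once, so that Fubini's theorem applies to it.\<close>

lemma mean_of_right_continuous:
  assumes x: "x \<in> space M" and h: "h \<in> borel_measurable M" and h1: "\<And>y. y \<in> space M \<Longrightarrow> h y \<le> 1"
    and rc: "AE w in P x. right_continuous_along X h w"
  defines "\<phi> \<equiv> \<lambda>t. if t < 0 then 0 else enn2real (\<integral>\<^sup>+ w. extend0 h (X t w) \<partial>P x)"
  shows "\<phi> \<in> borel_measurable borel"
    and "\<And>t. 0 \<le> \<phi> t \<and> \<phi> t \<le> 1"
    and "\<And>t. 0 \<le> t \<Longrightarrow> ennreal (\<phi> t) = (\<integral>\<^sup>+ w. extend0 h (X t w) \<partial>P x)"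
    and "\<And>s. 0 \<le> s \<Longrightarrow> (\<phi> \<longlongrightarrow> \<phi> s) (at_right s)"
    and "\<And>q. (\<integral>\<^sup>+ w. (\<integral>\<^sup>+ t\<in>{0..}. ennreal (exp (- q * t)) * extend0 h (X t w) \<partial>lborel) \<partial>P x) =
      (\<integral>\<^sup>+ t\<in>{0..}. ennreal (exp (- q * t)) * ennreal (\<phi> t) \<partial>lborel)"
proof -
  interpret prob_space "P x" using x by (rule prob_space_P)
  have eh: "extend0 h \<in> borel_measurable (adjoin_cemetery M)" using h by measurable
  have hX: "(\<lambda>w. extend0 h (X t w)) \<in> borel_measurable (P x)" if "0 \<le> t" for t
    by (rule measurable_compose[OF X_measurable_P[OF that x] eh])
  have le1: "extend0 h (X t w) \<le> 1" if "0 \<le> t" "w \<in> space (P x)" for t w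
    using h1 X_in_space[of t w] that space_P[OF x] by (intro extend0_le_1) auto
  have mean1: "(\<integral>\<^sup>+ w. extend0 h (X t w) \<partial>P x) \<le> 1" if "0 \<le> t" for t
  proof -
    have "(\<integral>\<^sup>+ w. extend0 h (X t w) \<partial>P x) \<le> (\<integral>\<^sup>+ w. 1 \<partial>P x)"
      using le1 that by (intro nn_integral_mono) auto
    then show ?thesis by (simp add: emeasure_space_1)
  qed
  show phi: "ennreal (\<phi> t) = (\<integral>\<^sup>+ w. extend0 h (X t w) \<partial>P x)" if "0 \<le> t" for t
    using mean1[OF that] that unfolding \<phi>_def
    by (simp add: ennreal_enn2real_if top.extremum_unique) (metis ennreal_one_neq_top top.extremum_unique)
  show bd: "0 \<le> \<phi> t \<and> \<phi> t \<le> 1" for t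
    using mean1[of t] unfolding \<phi>_def by (auto simp: not_less intro!: enn2real_leI)
  define Z where "Z = (\<lambda>(t, w). liminf (\<lambda>n. extend0 h (X (right_grid n t) w)))"
  have Zm [measurable]: "Z \<in> borel_measurable (borel \<Otimes>\<^sub>M P x)"
  proof -
    have "(\<lambda>(t, w). extend0 h (X (right_grid n t) w)) \<in> borel_measurable (borel \<Otimes>\<^sub>M P x)" for n
      by (rule measurable_right_grid[where Z = "\<lambda>r w. extend0 h (X r w)"]) (rule hX)
    then show ?thesis unfolding Z_def split_beta by (rule borel_measurable_liminf)
  qed
  have ZX: "AE w in P x. \<forall>t\<ge>0. Z (t, w) = extend0 h (X t w)"
    using rc
  proof eventually_elim
    case (elim w)
    show ?case
    proof (intro allI impI)
      fix t :: real assume "0 \<le> t"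
      from right_continuous_along_grid[OF elim order_refl this]
      show "Z (t, w) = extend0 h (X t w)"
        unfolding Z_def by (simp add: lim_imp_Liminf)
    qed
  qed
  have phiZ: "ennreal (\<phi> t) = (\<integral>\<^sup>+ w. Z (t, w) \<partial>P x)" if "0 \<le> t" for t
    unfolding phi[OF that] using ZX that by (intro nn_integral_cong_AE) auto
  have "(\<lambda>t. if t < 0 then 0 else enn2real (\<integral>\<^sup>+ w. Z (t, w) \<partial>P x)) \<in> borel_measurable borel"
    by measurable
  also have "(\<lambda>t. if t < 0 then 0 else enn2real (\<integral>\<^sup>+ w. Z (t, w) \<partial>P x)) = \<phi>"
  proof
    fix t show "(if t < 0 then 0 else enn2real (\<integral>\<^sup>+ w. Z (t, w) \<partial>P x)) = \<phi> t"
      using phiZ[of t] phi[of t] bd[of t] by (cases "t < 0") (auto simp: \<phi>_def)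
  qed
  finally show "\<phi> \<in> borel_measurable borel" .
  show "(\<phi> \<longlongrightarrow> \<phi> s) (at_right s)" if s: "0 \<le> s" for s
  proof (rule tendsto_at_right_sequentially[of s "s + 1"])
    fix S :: "nat \<Rightarrow> real" assume S: "\<And>n. s < S n" "S \<longlonglongrightarrow> s"
    then have "filterlim S (at_right s) sequentially"
      unfolding filterlim_at by (intro conjI always_eventually allI) (use S less_imp_neq[OF S(1)] in auto)
    then have lim: "AE w in P x. (\<lambda>n. extend0 h (X (S n) w)) \<longlonglongrightarrow> extend0 h (X s w)"
      using rc s unfolding right_continuous_along_def by (auto elim!: eventually_mono intro: filterlim_compose)
    have S0: "0 \<le> S n" for n using S(1)[of n] s by simp
    have "(\<lambda>n. \<integral>\<^sup>+ w. extend0 h (X (S n) w) \<partial>P x) \<longlonglongrightarrow> (\<integral>\<^sup>+ w. extend0 h (X s w) \<partial>P x)"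
    proof (rule nn_integral_dominated_convergence[where w = "\<lambda>_. 1"])
      show "AE w in P x. extend0 h (X (S n) w) \<le> 1" for n using le1 S0 by (intro AE_I2) auto
    qed (use hX S0 s lim in \<open>auto simp: emeasure_space_1\<close>)
    then have "(\<lambda>n. ennreal (\<phi> (S n))) \<longlonglongrightarrow> ennreal (\<phi> s)"
      using phi S0 s by simp
    then show "(\<lambda>n. \<phi> (S n)) \<longlonglongrightarrow> \<phi> s" using bd by (simp add: tendsto_ennreal_iff)
  qed simp
  fix q :: real
  have "(\<integral>\<^sup>+ w. (\<integral>\<^sup>+ t\<in>{0..}. ennreal (exp (- q * t)) * extend0 h (X t w) \<partial>lborel) \<partial>P x) =
     (\<integral>\<^sup>+ w. (\<integral>\<^sup>+ t\<in>{0..}. ennreal (exp (- q * t)) * Z (t, w) \<partial>lborel) \<partial>P x)"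
    using ZX by (intro nn_integral_cong_AE) (auto elim!: eventually_mono intro!: nn_integral_cong simp: indicator_def)
  also have "\<dots> = (\<integral>\<^sup>+ t. (\<integral>\<^sup>+ w. ennreal (exp (- q * t)) * Z (t, w) * indicator {0..} t \<partial>P x) \<partial>lborel)"
  proof -
    interpret pair_sigma_finite lborel "P x" by unfold_locales
    show ?thesis by (rule Fubini') measurable
  qed
  also have "\<dots> = (\<integral>\<^sup>+ t\<in>{0..}. ennreal (exp (- q * t)) * ennreal (\<phi> t) \<partial>lborel)"
  proof (rule nn_integral_cong)
    fix t :: real
    have "(\<integral>\<^sup>+ w. ennreal (exp (- q * t)) * Z (t, w) * indicator {0..} t \<partial>P x) =
        ennreal (exp (- q * t)) * (\<integral>\<^sup>+ w. Z (t, w) \<partial>P x) * indicator {0..} t"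
      by (subst nn_integral_multc, measurable, subst nn_integral_cmult, measurable)
    then show "(\<integral>\<^sup>+ w. ennreal (exp (- q * t)) * Z (t, w) * indicator {0..} t \<partial>P x) =
        ennreal (exp (- q * t)) * ennreal (\<phi> t) * indicator {0..} t"
      using phiZ[of t] by (auto simp: indicator_def)
  qed
  finally show "(\<integral>\<^sup>+ w. (\<integral>\<^sup>+ t\<in>{0..}. ennreal (exp (- q * t)) * extend0 h (X t w) \<partial>lborel) \<partial>P x) =
      (\<integral>\<^sup>+ t\<in>{0..}. ennreal (exp (- q * t)) * ennreal (\<phi> t) \<partial>lborel)" .
qed

end

text \<open>The resolvent is the Laplace transform of the mean, which is right-continuous by
  dominated convergence.\<close>

lemma (in right_process) mean_inversion:
  assumes inv: "inverts_laplace q s c d" and q: "0 < q" and s: "0 \<le> s"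
    and x: "x \<in> space M" and h: "h \<in> borel_measurable M" and h1: "\<And>y. y \<in> space M \<Longrightarrow> h y \<le> 1"
    and rc: "AE w in P x. right_continuous_along X h w"
  shows "(\<lambda>n. \<Sum>j\<le>d n. c n j * enn2real (kernel_apply (U (q + real j)) h x))
     \<longlonglongrightarrow> enn2real (\<integral>\<^sup>+ w. extend0 h (X s w) \<partial>P x)"
proof -
  let ?\<phi> = "\<lambda>t. if t < 0 then 0 else enn2real (\<integral>\<^sup>+ w. extend0 h (X t w) \<partial>P x)"
  note mean = mean_of_right_continuous[OF x h h1 rc]
  have "kernel_apply (U (q + real j)) h x =
     (\<integral>\<^sup>+ t\<in>{0..}. ennreal (exp (- (q + real j) * t)) * ennreal (?\<phi> t) \<partial>lborel)" for j
  proof -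
    have "0 < q + real j" using q by simp
    from trans[OF resolvent[OF this h x] mean(5)] show ?thesis .
  qed
  moreover have "(\<lambda>n. \<Sum>j\<le>d n. c n j * enn2real
     (\<integral>\<^sup>+ t\<in>{0..}. ennreal (exp (- (q + real j) * t)) * ennreal (?\<phi> t) \<partial>lborel)) \<longlonglongrightarrow> ?\<phi> s"
    using inv mean(1,2,4) s unfolding inverts_laplace_def by blast
  ultimately show ?thesis using s by simp
qed

section \<open>Functions that are right-continuous along the paths\<close>

lemma right_continuous_along_cong:
  assumes "\<And>t. 0 \<le> t \<Longrightarrow> X t w \<in> space (adjoin_cemetery M)" "\<And>y. y \<in> space M \<Longrightarrow> f y = g y"
    and rc: "right_continuous_along X f w"
  shows "right_continuous_along X g w"
proof -
  have eq: "extend0 f (X t w) = extend0 g (X t w)" if "0 \<le> t" for t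
    using assms(1)[OF that] assms(2) by (auto simp: extend0_def space_adjoin_cemetery)
  show ?thesis unfolding right_continuous_along_def
  proof (intro allI impI)
    fix t :: real assume t: "0 \<le> t"
    have "((\<lambda>s. extend0 f (X s w)) \<longlongrightarrow> extend0 g (X t w)) (at_right t)"
      using rc t unfolding right_continuous_along_def eq[OF t, symmetric] by blast
    moreover have "\<forall>\<^sub>F s in at_right t. extend0 f (X s w) = extend0 g (X s w)"
      using eventually_at_right_less[of t] by eventually_elim (use eq t in auto)
    ultimately show "((\<lambda>s. extend0 g (X s w)) \<longlongrightarrow> extend0 g (X t w)) (at_right t)"
      by (rule Lim_transform_eventually)
  qed
qed

context markov_process
begin

lemma dead_stays:
  assumes w: "w \<in> space \<G>" and "0 \<le> t" "t \<le> s" "X t w = None"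
  shows "X s w = None"
proof -
  have "lifetime X w \<le> ennreal t" using cemetery[OF assms(2) w] assms(4) by simp
  also have "\<dots> \<le> ennreal s" using assms(3) by (rule ennreal_leI)
  finally show ?thesis using cemetery[of s w] w assms(2,3) by simp
qed

lemma alive_eventually:
  assumes w: "w \<in> space \<G>" and t: "0 \<le> t" and alive: "X t w \<noteq> None"
  shows "\<forall>\<^sub>F s in at_right t. X s w \<noteq> None"
proof -
  have less: "ennreal t < lifetime X w" using cemetery[OF t w] alive by simp
  have lim: "((\<lambda>s. ennreal s) \<longlongrightarrow> ennreal t) (at_right t)"
    by (intro tendsto_ennrealI tendsto_ident_at)
  from order_tendstoD(2)[OF lim less] show ?thesis
    using eventually_at_right_less[of t]
  proof eventually_elim
    case (elim s)
    then show ?case using cemetery[of s w] w t by simp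
  qed
qed

text \<open>From the lifetime on the path is constant, and just after a time before the lifetime the path is still alive.
  So right-continuity is only an issue while the path lives.\<close>

lemma right_continuous_along_iff:
  assumes w: "w \<in> space \<G>"
  shows "right_continuous_along X h w \<longleftrightarrow>
    (\<forall>t\<ge>0. X t w \<noteq> None \<longrightarrow> ((\<lambda>s. h (the (X s w))) \<longlongrightarrow> h (the (X t w))) (at_right t))"
proof -
  have "((\<lambda>s. extend0 h (X s w)) \<longlongrightarrow> extend0 h (X t w)) (at_right t) \<longleftrightarrow>
      (X t w \<noteq> None \<longrightarrow> ((\<lambda>s. h (the (X s w))) \<longlongrightarrow> h (the (X t w))) (at_right t))"
    if t: "0 \<le> t" for t
  proof (cases "X t w = None")
    case True
    have "\<forall>\<^sub>F s in at_right t. extend0 h (X s w) = 0"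
      using eventually_at_right_less[of t]
      by eventually_elim (use dead_stays[OF w t _ True] in \<open>auto simp: extend0_def\<close>)
    then have "((\<lambda>s. extend0 h (X s w)) \<longlongrightarrow> 0) (at_right t)" by (rule tendsto_eventually)
    then show ?thesis using True by (simp add: extend0_def)
  next
    case False
    have "\<forall>\<^sub>F s in at_right t. extend0 h (X s w) = h (the (X s w))"
      using alive_eventually[OF w t False] by eventually_elim (auto simp: extend0_def)
    moreover have "extend0 h (X t w) = h (the (X t w))" using False by (auto simp: extend0_def)
    ultimately have "((\<lambda>s. extend0 h (X s w)) \<longlongrightarrow> extend0 h (X t w)) (at_right t) \<longleftrightarrow>
        ((\<lambda>s. h (the (X s w))) \<longlongrightarrow> h (the (X t w))) (at_right t)"
      by (simp only: tendsto_cong)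
    then show ?thesis using False by (simp only: simp_thms)
  qed
  then show ?thesis unfolding right_continuous_along_def by blast
qed

lemma the_X_in_space:
  assumes "w \<in> space \<G>" "0 \<le> t" "X t w \<noteq> None"
  shows "the (X t w) \<in> space M"
  using X_in_space[OF assms(2,1)] assms(3) by (auto simp: space_adjoin_cemetery)

end

context right_process
begin

lemma continuous_right_continuous_along:
  "\<exists>T. lusin_topology_on M T \<and> (\<forall>f. continuous_map T euclideanreal f \<longrightarrow>
     (\<forall>x\<in>space M. AE w in P x. right_continuous_along X (\<lambda>y. ennreal (f y)) w))"
proof -
  obtain T where T: "lusin_topology_on M T"
    and paths: "\<And>x. x \<in> space M \<Longrightarrow> AE w in P x. \<forall>t\<ge>0. ennreal t < lifetime X w \<longrightarrow>
            limitin T (\<lambda>s. the (X s w)) (the (X t w)) (at_right t)"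
    using paths_right_continuous by blast
  have "AE w in P x. right_continuous_along X (\<lambda>y. ennreal (f y)) w"
    if f: "continuous_map T euclideanreal f" and x: "x \<in> space M" for f x
    using paths[OF x] AE_space
  proof eventually_elim
    case (elim w)
    then have w: "w \<in> space \<G>" using space_P[OF x] by simp
    show ?case unfolding right_continuous_along_iff[OF w]
    proof (intro allI impI)
      fix t :: real assume t: "0 \<le> t" and "X t w \<noteq> None"
      then have "ennreal t < lifetime X w" using cemetery[OF t w] by simp
      then have "limitin T (\<lambda>s. the (X s w)) (the (X t w)) (at_right t)" using elim t by blast
      then have "limitin euclideanreal (f \<circ> (\<lambda>s. the (X s w))) (f (the (X t w))) (at_right t)"
        by (rule continuous_map_limit[OF f])
      then show "((\<lambda>s. ennreal (f (the (X s w)))) \<longlongrightarrow> ennreal (f (the (X t w)))) (at_right t)"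
        by (intro tendsto_ennrealI) (simp add: o_def)
    qed
  qed
  then show ?thesis using T by blast
qed

text \<open>The excessive functions of one particular order \<open>\<beta>\<close> are right-continuous along the paths, among them
  the potentials \<open>U \<beta> f\<close> of bounded functions. For \<open>q > \<beta>\<close> the resolvent equation makes \<open>U q f\<close> a difference of two of them. This works for all large \<open>q\<close>, hence
  simultaneously for two processes whose constants \<open>\<beta>\<close> differ.\<close>

lemma potential_right_continuous_along:
  assumes U: "sub_markov_resolvent M U"
  shows "\<exists>\<beta>>0. \<forall>q>\<beta>. \<forall>f\<in>borel_measurable M. (\<forall>y\<in>space M. f y \<le> 1) \<longrightarrow>
     (\<forall>x\<in>space M. AE w in P x. right_continuous_along X (kernel_apply (U q) f) w)"
proof -
  obtain \<beta> where \<beta>: "0 < \<beta>" and exc: "\<And>u x. excessive M U \<beta> u \<Longrightarrow> x \<in> space M \<Longrightarrow>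
      AE w in P x. \<forall>t\<ge>0. continuous (at_right t) (\<lambda>s. extend0 u (X s w))"
    using excessive_right_continuous by blast
  have rc: "AE w in P x. right_continuous_along X (kernel_apply (U \<beta>) f) w"
    if "f \<in> borel_measurable M" "\<And>y. y \<in> space M \<Longrightarrow> f y \<le> ennreal B" "0 \<le> B" "x \<in> space M" for f B x
    using exc[OF excessive_potential[OF U \<beta> that(1-3)] that(4)]
    unfolding right_continuous_along_def continuous_within .
  have "AE w in P x. right_continuous_along X (kernel_apply (U q) f) w"
    if q: "\<beta> < q" and f: "f \<in> borel_measurable M" and f1: "\<And>y. y \<in> space M \<Longrightarrow> f y \<le> 1"
      and x: "x \<in> space M" for q f x
  proof -
    have q0: "0 < q" using q \<beta> by simp
    have f1': "f y \<le> ennreal 1" if "y \<in> space M" for y using f1[OF that] by simp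
    let ?g = "\<lambda>y. ennreal (q - \<beta>) * kernel_apply (U q) f y"
    have Uf: "kernel_apply (U q) f \<in> borel_measurable M"
      by (rule kernel_apply_measurable[OF resolvent_kernel_on[OF U q0] f])
    then have g: "?g \<in> borel_measurable M" by measurable
    have gB: "?g y \<le> ennreal ((q - \<beta>) * (1 / q))" if "y \<in> space M" for y
      using resolvent_le[OF U q0 that f1'] q q0
      by (subst ennreal_mult) (auto intro!: mult_left_mono)
    have B: "0 \<le> (q - \<beta>) * (1 / q)" using q q0 by simp
    have eq: "kernel_apply (U \<beta>) f y = kernel_apply (U q) f y + kernel_apply (U \<beta>) ?g y"
      and fin: "kernel_apply (U \<beta>) f y < top" "kernel_apply (U \<beta>) ?g y < top" if y: "y \<in> space M" for y
    proof -
      show "kernel_apply (U \<beta>) f y = kernel_apply (U q) f y + kernel_apply (U \<beta>) ?g y"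
        unfolding resolvent_cmult[OF U \<beta> y Uf] by (rule resolvent_equation[OF U \<beta> q f y])
      show "kernel_apply (U \<beta>) f y < top" "kernel_apply (U \<beta>) ?g y < top"
        using le_less_trans[OF resolvent_le[OF U \<beta> y f1'] ennreal_less_top]
          le_less_trans[OF resolvent_le[OF U \<beta> y gB B] ennreal_less_top] by simp_all
    qed
    have diff: "kernel_apply (U \<beta>) f y - kernel_apply (U \<beta>) ?g y = kernel_apply (U q) f y"
      if y: "y \<in> space M" for y
      using fin[OF y] unfolding eq[OF y] by simp
    have "AE w in P x. right_continuous_along X (kernel_apply (U \<beta>) f) w"
      by (rule rc[OF f _ zero_le_one x]) (rule f1')
    moreover have "AE w in P x. right_continuous_along X (kernel_apply (U \<beta>) ?g) w"
      by (rule rc[OF g _ B x]) (rule gB)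
    ultimately show ?thesis
      using AE_space
    proof eventually_elim
      case (elim w)
      then have w: "w \<in> space \<G>" using space_P[OF x] by simp
      have rcd: "right_continuous_along X (\<lambda>y. kernel_apply (U \<beta>) f y - kernel_apply (U \<beta>) ?g y) w"
        unfolding right_continuous_along_iff[OF w]
      proof (intro allI impI)
        fix t :: real assume t: "0 \<le> t" "X t w \<noteq> None"
        then have "the (X t w) \<in> space M" using the_X_in_space[OF w] by blast
        from fin[OF this] show "((\<lambda>s. kernel_apply (U \<beta>) f (the (X s w)) - kernel_apply (U \<beta>) ?g (the (X s w)))
            \<longlongrightarrow> kernel_apply (U \<beta>) f (the (X t w)) - kernel_apply (U \<beta>) ?g (the (X t w))) (at_right t)"
          using elim(1,2) t unfolding right_continuous_along_iff[OF w]
          by (intro tendsto_diff_ennreal) auto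
      qed
      show ?case
      proof (rule right_continuous_along_cong[OF _ _ rcd])
        show "X t w \<in> space (adjoin_cemetery M)" if "0 \<le> t" for t using that w by (rule X_in_space)
      qed (rule diff)
    qed
  qed
  then show ?thesis using \<beta> by blast
qed

end

text \<open>Continuous functions of \<open>v\<close> that increase to the indicator of \<open>a < v\<close> as \<open>m\<close> grows.\<close>

definition cutoff :: "nat \<Rightarrow> real \<Rightarrow> real \<Rightarrow> real" where
  "cutoff m a v = min 1 (max 0 (real m * (v - a)))"

lemma cutoff_bounds: "0 \<le> cutoff m a v" "cutoff m a v \<le> 1"
  by (simp_all add: cutoff_def)

lemma cutoff_tendsto: "(\<lambda>m. cutoff m a v) \<longlonglongrightarrow> (if a < v then 1 else 0)"
proof (cases "a < v")
  case True
  obtain m0 where m0: "1 / (v - a) \<le> real m0" using real_arch_simple by blast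
  have "\<forall>\<^sub>F m in sequentially. cutoff m a v = 1"
    using eventually_ge_at_top[of m0]
  proof eventually_elim
    case (elim m)
    then have "1 / (v - a) \<le> real m" using m0 by simp
    then have "1 \<le> real m * (v - a)" using True by (simp add: pos_divide_le_eq)
    then show ?case by (simp add: cutoff_def)
  qed
  then show ?thesis using True by (simp add: tendsto_eventually)
next
  case False
  then have "real m * (v - a) \<le> 0" for m by (intro mult_nonneg_nonpos) auto
  then have "cutoff m a v = 0" for m by (simp add: cutoff_def max_absorb1)
  then show ?thesis using False by simp
qed

definition box_approx :: "(nat \<Rightarrow> 'a \<Rightarrow> ennreal) \<Rightarrow> nat set \<Rightarrow> (nat \<Rightarrow> real) \<Rightarrow> nat \<Rightarrow> 'a \<Rightarrow> ennreal" where
  "box_approx u J a m y = ennreal (\<Prod>k\<in>J. cutoff m (a k) (enn2real (u k y)))"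

definition code_box :: "'a measure \<Rightarrow> (nat \<Rightarrow> 'a \<Rightarrow> ennreal) \<Rightarrow> nat set \<Rightarrow> (nat \<Rightarrow> real) \<Rightarrow> 'a set" where
  "code_box M u J a = {y \<in> space M. \<forall>k\<in>J. a k < enn2real (u k y)}"

lemma box_approx_measurable:
  assumes [measurable]: "\<And>k. u k \<in> borel_measurable M"
  shows "box_approx u J a m \<in> borel_measurable M"
  unfolding box_approx_def cutoff_def by measurable

lemma box_approx_le_1: "box_approx u J a m y \<le> 1"
  unfolding box_approx_def using cutoff_bounds by (auto intro!: prod_le_1)

lemma box_approx_tendsto:
  assumes "finite J"
  shows "(\<lambda>m. box_approx u J a m y) \<longlonglongrightarrow> (if \<forall>k\<in>J. a k < enn2real (u k y) then 1 else 0)"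
proof -
  have "(\<lambda>m. \<Prod>k\<in>J. cutoff m (a k) (enn2real (u k y))) \<longlonglongrightarrow>
      (\<Prod>k\<in>J. if a k < enn2real (u k y) then 1 else 0)"
    by (intro tendsto_prod cutoff_tendsto)
  also have "(\<Prod>k\<in>J. if a k < enn2real (u k y) then 1 else 0) =
      (if \<forall>k\<in>J. a k < enn2real (u k y) then 1 else (0 :: real))"
    using assms by (auto simp: prod_zero_iff)
  finally show ?thesis unfolding box_approx_def by (auto dest!: tendsto_ennrealI split: if_splits)
qed

lemma (in markov_process) box_approx_right_continuous:
  assumes w: "w \<in> space \<G>" and rc: "\<And>k. right_continuous_along X (u k) w"
    and fin: "\<And>k y. y \<in> space M \<Longrightarrow> u k y < top"
  shows "right_continuous_along X (box_approx u J a m) w"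
  unfolding right_continuous_along_iff[OF w]
proof (intro allI impI)
  fix t :: real assume t: "0 \<le> t" "X t w \<noteq> None"
  have lim: "((\<lambda>s. enn2real (u k (the (X s w)))) \<longlongrightarrow> enn2real (u k (the (X t w)))) (at_right t)" for k
  proof (rule tendsto_enn2real)
    have "ennreal (enn2real (u k (the (X t w)))) = u k (the (X t w))"
      using fin[OF the_X_in_space[OF w t]] by simp
    then show "((\<lambda>s. u k (the (X s w))) \<longlongrightarrow> ennreal (enn2real (u k (the (X t w))))) (at_right t)"
      using rc[of k] t unfolding right_continuous_along_iff[OF w] by simp
  qed simp
  show "((\<lambda>s. box_approx u J a m (the (X s w))) \<longlongrightarrow> box_approx u J a m (the (X t w))) (at_right t)"
    unfolding box_approx_def cutoff_def
    by (intro tendsto_ennrealI tendsto_prod tendsto_min tendsto_max tendsto_mult tendsto_diff tendsto_const lim)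
qed

text \<open>The indicator of a box is a limit of continuous functions of the \<open>u k\<close>, whose means are recovered
  from the resolvent. The resulting expression involves the process through its resolvent only: it is
  the same for all processes with this resolvent, and measurable in the starting point.\<close>

lemma (in right_process) box_probability:
  assumes inv: "inverts_laplace q s c d" and q: "0 < q" and s: "0 \<le> s" and x: "x \<in> space M"
    and u: "\<And>k. u k \<in> borel_measurable M" and fin: "\<And>k y. y \<in> space M \<Longrightarrow> u k y < top"
    and rc: "AE w in P x. \<forall>k. right_continuous_along X (u k) w" and J: "finite J"
  shows "(\<lambda>m. ennreal (lim (\<lambda>n. \<Sum>j\<le>d n. c n j * enn2real (kernel_apply (U (q + real j)) (box_approx u J a m) x))))
     \<longlonglongrightarrow> emeasure (distr (P x) (adjoin_cemetery M) (X s)) (Some ` code_box M u J a)"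
proof -
  interpret prob_space "P x" using x by (rule prob_space_P)
  let ?h = "box_approx u J a"
  have hm: "?h m \<in> borel_measurable M" for m by (rule box_approx_measurable[OF u])
  have h1: "?h m y \<le> 1" for m y by (rule box_approx_le_1)
  have rch: "AE w in P x. right_continuous_along X (?h m) w" for m
    using rc AE_space by eventually_elim (use box_approx_right_continuous fin space_P[OF x] in auto)
  have Xm: "X s \<in> P x \<rightarrow>\<^sub>M adjoin_cemetery M" by (rule X_measurable_P[OF s x])
  have hX: "(\<lambda>w. extend0 (?h m) (X s w)) \<in> borel_measurable (P x)" for m
    by (rule measurable_compose[OF Xm measurable_extend0[OF hm]])
  have le1: "(\<integral>\<^sup>+ w. extend0 (?h m) (X s w) \<partial>P x) \<le> 1" for m
  proof -
    have "(\<integral>\<^sup>+ w. extend0 (?h m) (X s w) \<partial>P x) \<le> (\<integral>\<^sup>+ w. 1 \<partial>P x)"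
      using h1 by (intro nn_integral_mono) (auto simp: extend0_def split: option.split)
    then show ?thesis by (simp add: emeasure_space_1)
  qed
  have lim: "ennreal (lim (\<lambda>n. \<Sum>j\<le>d n. c n j * enn2real (kernel_apply (U (q + real j)) (?h m) x))) =
      (\<integral>\<^sup>+ w. extend0 (?h m) (X s w) \<partial>P x)" for m
  proof -
    have "lim (\<lambda>n. \<Sum>j\<le>d n. c n j * enn2real (kernel_apply (U (q + real j)) (?h m) x)) =
      enn2real (\<integral>\<^sup>+ w. extend0 (?h m) (X s w) \<partial>P x)"
      by (rule limI[OF mean_inversion[OF inv q s x hm h1 rch]])
    moreover have "(\<integral>\<^sup>+ w. extend0 (?h m) (X s w) \<partial>P x) < top"
      using le1[of m] by (simp add: le_less_trans)
    ultimately show ?thesis by simp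
  qed
  have boxS: "code_box M u J a \<in> sets M"
  proof -
    have [measurable]: "\<And>k. u k \<in> borel_measurable M" by (rule u)
    show ?thesis unfolding code_box_def using J by measurable
  qed
  have ind: "(\<lambda>m. ?h m y) \<longlonglongrightarrow> indicator (code_box M u J a) y" if "y \<in> space M" for y
    using box_approx_tendsto[OF J, of u a y] that by (simp only: code_box_def indicator_def mem_Collect_eq simp_thms of_bool_def)
  have "(\<lambda>m. \<integral>\<^sup>+ w. extend0 (?h m) (X s w) \<partial>P x) \<longlonglongrightarrow>
      (\<integral>\<^sup>+ w. extend0 (indicator (code_box M u J a)) (X s w) \<partial>P x)"
  proof (rule nn_integral_dominated_convergence[where w = "\<lambda>_. 1"])
    show "(\<lambda>w. extend0 (indicator (code_box M u J a)) (X s w)) \<in> borel_measurable (P x)"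
      using boxS by (intro measurable_compose[OF Xm measurable_extend0]) auto
    show "AE w in P x. extend0 (?h m) (X s w) \<le> 1" for m
      using h1 by (intro AE_I2) (auto simp: extend0_def split: option.split)
    show "AE w in P x. (\<lambda>m. extend0 (?h m) (X s w)) \<longlonglongrightarrow> extend0 (indicator (code_box M u J a)) (X s w)"
    proof (rule AE_I2)
      fix w assume "w \<in> space (P x)"
      then have "X s w \<in> space (adjoin_cemetery M)" by (rule measurable_space[OF Xm])
      then show "(\<lambda>m. extend0 (?h m) (X s w)) \<longlonglongrightarrow> extend0 (indicator (code_box M u J a)) (X s w)"
        using ind by (auto simp: extend0_def space_adjoin_cemetery)
    qed
  qed (use hX in \<open>auto simp: emeasure_space_1\<close>)
  also have "(\<integral>\<^sup>+ w. extend0 (indicator (code_box M u J a)) (X s w) \<partial>P x) =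
      (\<integral>\<^sup>+ z. indicator (Some ` code_box M u J a) z \<partial>distr (P x) (adjoin_cemetery M) (X s))"
    using Some_image_in_adjoin_cemetery[OF boxS]
    by (subst nn_integral_distr[OF Xm]) (auto intro!: nn_integral_cong simp: extend0_def indicator_def split: option.split)
  also have "\<dots> = emeasure (distr (P x) (adjoin_cemetery M) (X s)) (Some ` code_box M u J a)"
    using Some_image_in_adjoin_cemetery[OF boxS] by simp
  finally show ?thesis unfolding lim .
qed

section \<open>Two processes with the same resolvent\<close>

text \<open>\<open>M'\<close> plays the role of the smaller state space with its trace \<open>\<sigma>\<close>-algebra, on which \<open>X'\<close> lives. The resolvents
  are compared on functions defined on the larger space.\<close>

locale subspace_process =
  E: right_process M \<G> \<F> X \<theta> P U + F: right_process M' \<G>' \<F>' X' \<theta>' P' U'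
  for M :: "'a measure" and \<G> :: "'w measure" and \<F> X \<theta> P U
    and M' :: "'a measure" and \<G>' :: "'v measure" and \<F>' X' \<theta>' P' U' +
  assumes sub_markov: "sub_markov_resolvent M U"
    and sub_markov': "sub_markov_resolvent M' U'"
    and inclusion: "(\<lambda>x. x) \<in> M' \<rightarrow>\<^sub>M M"
    and resolvents_agree: "\<And>q f y. 0 < q \<Longrightarrow> f \<in> borel_measurable M \<Longrightarrow> y \<in> space M' \<Longrightarrow>
      kernel_apply (U' q) f y = kernel_apply (U q) f y"
    and lusin_ex: "\<exists>T. lusin_topology_on M T"
begin

lemma space_M': "y \<in> space M' \<Longrightarrow> y \<in> space M"
  using measurable_space[OF inclusion] by simp

lemma measurable_M': "f \<in> borel_measurable M \<Longrightarrow> f \<in> borel_measurable M'"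
  using measurable_compose[OF inclusion] by blast

text \<open>The two processes are right-continuous in topologies that have nothing to do with each other. A coding
  family replaces them: its functions are right-continuous along the paths of both processes, and they
  generate the \<open>\<sigma>\<close>-algebra. The constant 1 tells living points from the cemetery, where all extended functions
  vanish.\<close>

definition coding :: "(nat \<Rightarrow> 'a \<Rightarrow> ennreal) \<Rightarrow> bool" where
  "coding u \<longleftrightarrow> (\<forall>k. u k \<in> borel_measurable M) \<and> (\<forall>k. \<forall>y\<in>space M. u k y < top) \<and> u 0 = (\<lambda>_. 1) \<and>
     (\<forall>x\<in>space M. AE w in P x. \<forall>k. right_continuous_along X (u k) w) \<and>
     (\<forall>x\<in>space M'. AE w in P' x. \<forall>k. right_continuous_along X' (u k) w) \<and>
     sets M = sigma_sets (space M) {code_box M u J a | J a. finite J}"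

text \<open>Take the potentials at \<open>q, q + 1, \<dots>\<close> of countably many continuous functions \<open>f i\<close> that generate the Borel
  sets of the larger space, with \<open>q\<close> beyond the constants of both processes. Laplace inversion at time 0 recovers
  the \<open>f i\<close> from these potentials, so the potentials generate as well.\<close>

lemma coding_exists:
  assumes ne: "space M \<noteq> {}"
  shows "\<exists>u. coding u"
proof -
  obtain \<beta> where \<beta>: "0 < \<beta>" and rcE: "\<And>q f x. \<beta> < q \<Longrightarrow> f \<in> borel_measurable M \<Longrightarrow> \<forall>y\<in>space M. f y \<le> 1 \<Longrightarrow>
      x \<in> space M \<Longrightarrow> AE w in P x. right_continuous_along X (kernel_apply (U q) f) w"
    using E.potential_right_continuous_along[OF sub_markov] by blast
  obtain \<beta>' where \<beta>': "0 < \<beta>'" and rcF: "\<And>q f x. \<beta>' < q \<Longrightarrow> f \<in> borel_measurable M' \<Longrightarrow> \<forall>y\<in>space M'. f y \<le> 1 \<Longrightarrow>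
      x \<in> space M' \<Longrightarrow> AE w in P' x. right_continuous_along X' (kernel_apply (U' q) f) w"
    using F.potential_right_continuous_along[OF sub_markov'] by blast
  obtain T where T: "lusin_topology_on M T" and rcT: "\<And>f x. continuous_map T euclideanreal f \<Longrightarrow> x \<in> space M \<Longrightarrow>
      AE w in P x. right_continuous_along X (\<lambda>y. ennreal (f y)) w"
    using E.continuous_right_continuous_along by blast
  obtain f :: "nat \<Rightarrow> 'a \<Rightarrow> real" where fc: "\<And>i. continuous_map T euclideanreal (f i)"
    and f01: "\<And>i y. 0 \<le> f i y \<and> f i y \<le> 1"
    and gen: "sets M \<subseteq> sigma_sets (space M) {{y \<in> space M. f i y < r} | i r. True}"
    using lusin_generating_functions[OF T ne] by blast
  have fm: "f i \<in> borel_measurable M" for i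
  proof (rule borel_measurableI)
    fix S :: "real set" assume "open S"
    then have "openin T {y \<in> topspace T. f i y \<in> S}"
      by (intro openin_continuous_map_preimage[OF fc]) simp
    then have "{y \<in> space M. f i y \<in> S} \<in> sets M"
      using T by (auto simp: lusin_topology_on_def borel_sets_of_def intro: sigma_sets.Basic)
    moreover have "f i -` S \<inter> space M = {y \<in> space M. f i y \<in> S}" by auto
    ultimately show "f i -` S \<inter> space M \<in> sets M" by simp
  qed
  then have em: "(\<lambda>y. ennreal (f i y)) \<in> borel_measurable M" for i by measurable
  define q where "q = max \<beta> \<beta>' + 1"
  have q: "0 < q" "\<beta> < q + real j" "\<beta>' < q + real j" for j using \<beta> by (auto simp: q_def)
  obtain c d where inv: "inverts_laplace q 0 c d" using laplace_inversion[OF q(1) order_refl] by blast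
  define v where "v i j = kernel_apply (U (q + real j)) (\<lambda>y. ennreal (f i y))" for i j
  define u where "u k = (case k of 0 \<Rightarrow> (\<lambda>_. 1) | Suc l \<Rightarrow> v (fst (prod_decode l)) (snd (prod_decode l)))" for k
  have qj: "0 < q + real j" for j using q(1) by simp
  have vm: "v i j \<in> borel_measurable M" for i j
    unfolding v_def by (rule kernel_apply_measurable[OF resolvent_kernel_on[OF sub_markov qj] em])
  have vfin: "v i j y < top" if "y \<in> space M" for i j y
  proof -
    have "v i j y \<le> ennreal (1 / (q + real j))"
      unfolding v_def using f01 by (intro resolvent_le[OF sub_markov qj that]) auto
    then show ?thesis using ennreal_less_top le_less_trans by blast
  qed
  have uv: "u (Suc (prod_encode (i, j))) = v i j" for i j by (simp add: u_def)
  have um: "u k \<in> borel_measurable M" for k unfolding u_def using vm by (cases k) auto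
  have ufin: "u k y < top" if "y \<in> space M" for k y
    unfolding u_def using vfin[OF that] by (cases k) auto
  have "AE w in P x. right_continuous_along X (u k) w" if x: "x \<in> space M" for x k
  proof (cases k)
    case 0
    show ?thesis using AE_space
      by eventually_elim (use E.space_P[OF x] in \<open>auto simp: E.right_continuous_along_iff 0 u_def\<close>)
  next
    case (Suc l)
    show ?thesis unfolding Suc u_def nat.case v_def
      using f01 q by (intro rcE em x) auto
  qed
  then have uE: "\<forall>x\<in>space M. AE w in P x. \<forall>k. right_continuous_along X (u k) w"
    by (simp add: AE_all_countable)
  have "AE w in P' x. right_continuous_along X' (u k) w" if x: "x \<in> space M'" for x k
  proof (cases k)
    case 0
    show ?thesis using AE_space
      by eventually_elim (use F.space_P[OF x] in \<open>auto simp: F.right_continuous_along_iff 0 u_def\<close>)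
  next
    case (Suc l)
    let ?i = "fst (prod_decode l)" and ?j = "snd (prod_decode l)"
    have "AE w in P' x. right_continuous_along X' (kernel_apply (U' (q + real ?j)) (\<lambda>y. ennreal (f ?i y))) w"
      using f01 q by (intro rcF measurable_M' em x) auto
    then show ?thesis using AE_space
    proof eventually_elim
      case (elim w)
      then have w: "w \<in> space \<G>'" using F.space_P[OF x] by simp
      show ?case
      proof (rule right_continuous_along_cong[OF _ _ elim(1)])
        show "X' t w \<in> space (adjoin_cemetery M')" if "0 \<le> t" for t using that w by (rule F.X_in_space)
        show "kernel_apply (U' (q + real ?j)) (\<lambda>y. ennreal (f ?i y)) y = u k y" if "y \<in> space M'" for y
          unfolding Suc u_def nat.case v_def by (rule resolvents_agree[OF qj em that])
      qed
    qed
  qed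
  then have uF: "\<forall>x\<in>space M'. AE w in P' x. \<forall>k. right_continuous_along X' (u k) w"
    by (simp add: AE_all_countable)
  let ?B = "{code_box M u J a | J a. finite J}"
  define S where "S = sigma (space M) ?B"
  have Bsub: "?B \<subseteq> Pow (space M)" by (auto simp: code_box_def)
  have spS: "space S = space M" and setsS: "sets S = sigma_sets (space M) ?B"
    using Bsub by (simp_all add: S_def space_measure_of_conv sets_measure_of)
  have uS: "(\<lambda>y. enn2real (u k y)) \<in> borel_measurable S" for k
    unfolding borel_measurable_iff_greater
  proof
    fix a
    have "{w \<in> space S. a < enn2real (u k w)} = code_box M u {k} (\<lambda>_. a)" by (auto simp: spS code_box_def)
    then show "{w \<in> space S. a < enn2real (u k w)} \<in> sets S" unfolding setsS by (auto intro!: sigma_sets.Basic)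
  qed
  have fS: "f i \<in> borel_measurable S" for i
  proof (rule borel_measurable_LIMSEQ_real)
    show "(\<lambda>y. \<Sum>j\<le>d n. c n j * enn2real (u (Suc (prod_encode (i, j))) y)) \<in> borel_measurable S" for n
      using uS by (intro borel_measurable_sum borel_measurable_times borel_measurable_const)
    fix y assume "y \<in> space S"
    then have y: "y \<in> space M" by (simp add: spS)
    interpret py: prob_space "P y" using y by (rule E.prob_space_P)
    have "(\<integral>\<^sup>+ w. extend0 (\<lambda>y. ennreal (f i y)) (X 0 w) \<partial>P y) = (\<integral>\<^sup>+ w. ennreal (f i y) \<partial>P y)"
      using E.normal[OF y] by (intro nn_integral_cong_AE) (auto elim!: eventually_mono simp: extend0_def)
    then have "enn2real (\<integral>\<^sup>+ w. extend0 (\<lambda>y. ennreal (f i y)) (X 0 w) \<partial>P y) = f i y"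
      using f01 by (simp add: py.emeasure_space_1)
    moreover have "(\<lambda>n. \<Sum>j\<le>d n. c n j * enn2real (kernel_apply (U (q + real j)) (\<lambda>y. ennreal (f i y)) y))
        \<longlonglongrightarrow> enn2real (\<integral>\<^sup>+ w. extend0 (\<lambda>y. ennreal (f i y)) (X 0 w) \<partial>P y)"
      using f01 by (intro E.mean_inversion[OF inv q(1) order_refl y em] rcT fc y) auto
    ultimately show "(\<lambda>n. \<Sum>j\<le>d n. c n j * enn2real (u (Suc (prod_encode (i, j))) y)) \<longlonglongrightarrow> f i y"
      unfolding uv v_def by simp
  qed
  have "sets M \<subseteq> sets S"
  proof -
    have "{{y \<in> space M. f i y < r} | i r. True} \<subseteq> sets S"
    proof safe
      fix i r
      have "{y \<in> space S. f i y < r} \<in> sets S" using fS by measurable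
      then show "{y \<in> space M. f i y < r} \<in> sets S" by (simp add: spS)
    qed
    then have "sigma_sets (space S) {{y \<in> space M. f i y < r} | i r. True} \<subseteq> sets S"
      by (rule sets.sigma_sets_subset)
    then show ?thesis using gen by (simp add: spS)
  qed
  moreover have "sets S \<subseteq> sets M"
  proof -
    have "?B \<subseteq> sets M"
    proof safe
      fix J :: "nat set" and a :: "nat \<Rightarrow> real" assume J: "finite J"
      have [measurable]: "\<And>k. u k \<in> borel_measurable M" by (rule um)
      show "code_box M u J a \<in> sets M" unfolding code_box_def using J by measurable
    qed
    then show ?thesis unfolding setsS by (rule sets.sigma_sets_subset)
  qed
  ultimately have "sets M = sigma_sets (space M) ?B" using setsS by simp
  then have "coding u" unfolding coding_def using um ufin uE uF by (simp add: u_def)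
  then show ?thesis by blast
qed

text \<open>The boxes consist of living points only; the whole space is added so that the total mass can be
  compared.\<close>

definition code_gen :: "(nat \<Rightarrow> 'a \<Rightarrow> ennreal) \<Rightarrow> 'a option set set" where
  "code_gen u = insert (space (adjoin_cemetery M)) {Some ` code_box M u J a | J a. finite J}"

lemma Some_image_box_in_sets:
  assumes u: "coding u" and J: "finite J"
  shows "Some ` code_box M u J a \<in> sets (adjoin_cemetery M)"
proof -
  have "sets M = sigma_sets (space M) {code_box M u J a | J a. finite J}" using u by (simp add: coding_def)
  then have "code_box M u J a \<in> sets M" using J by (auto intro: sigma_sets.Basic)
  then show ?thesis by (rule Some_image_in_adjoin_cemetery)
qed

lemma code_gen_props:
  assumes u: "coding u"
  shows "Int_stable (code_gen u)" "code_gen u \<subseteq> Pow (space (adjoin_cemetery M))"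
    "sets (adjoin_cemetery M) = sigma_sets (space (adjoin_cemetery M)) (code_gen u)"
proof -
  let ?\<Omega> = "space (adjoin_cemetery M)"
  have setsM: "sets M = sigma_sets (space M) {code_box M u J a | J a. finite J}" using u by (simp add: coding_def)
  have sub: "code_gen u \<subseteq> sets (adjoin_cemetery M)"
    using Some_image_box_in_sets[OF u] by (auto simp: code_gen_def)
  show pow: "code_gen u \<subseteq> Pow ?\<Omega>" using sub sets.sets_into_space by blast
  interpret sa: sigma_algebra ?\<Omega> "sigma_sets ?\<Omega> (code_gen u)"
    by (rule sigma_algebra_sigma_sets[OF pow])
  have int: "\<exists>K b. Some ` code_box M u J a \<inter> Some ` code_box M u J' a' = Some ` code_box M u K b \<and> finite K"
    if "finite J" "finite J'" for J J' a a'
  proof (intro exI conjI)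
    let ?b = "\<lambda>k. if k \<in> J then if k \<in> J' then max (a k) (a' k) else a k else a' k"
    show "Some ` code_box M u J a \<inter> Some ` code_box M u J' a' = Some ` code_box M u (J \<union> J') ?b"
      by (auto simp: code_box_def)
  qed (use that in simp)
  show "Int_stable (code_gen u)"
  proof (rule Int_stableI)
    fix A B assume AB: "A \<in> code_gen u" "B \<in> code_gen u"
    consider "A = ?\<Omega>" | "B = ?\<Omega>" | J a J' a' where "finite J" "finite J'" "A = Some ` code_box M u J a" "B = Some ` code_box M u J' a'"
      using AB by (auto simp: code_gen_def)
    then show "A \<inter> B \<in> code_gen u"
    proof cases
      case 1 then have "A \<inter> B = B" using AB pow by blast then show ?thesis using AB by simp
    next
      case 2 then have "A \<inter> B = A" using AB pow by blast then show ?thesis using AB by simp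
    next
      case 3
      then show ?thesis using int[of J J' a a'] by (auto simp: code_gen_def)
    qed
  qed
  have "Some ` A \<in> sigma_sets ?\<Omega> (code_gen u)" if "A \<in> sets M" for A
    using that unfolding setsM
  proof (induction rule: sigma_sets.induct)
    case (Basic A)
    then show ?case by (auto simp: code_gen_def intro!: sigma_sets.Basic)
  next
    case Empty then show ?case by (simp add: sigma_sets.Empty)
  next
    case (Compl A)
    have "space M = code_box M u {} (\<lambda>_. 0)" by (simp add: code_box_def)
    then have "Some ` space M \<in> sigma_sets ?\<Omega> (code_gen u)"
      by (auto simp: code_gen_def intro!: sigma_sets.Basic)
    moreover have "Some ` (space M - A) = Some ` space M - Some ` A" by auto
    ultimately show ?case using sa.Diff[OF _ Compl.IH] by simp
  next
    case (Union A)
    have "Some ` (\<Union>(range A)) = (\<Union>i. Some ` A i)" by auto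
    then show ?case using sigma_sets.Union[OF Union.IH] by simp
  qed
  then have "sets (adjoin_cemetery M) \<subseteq> sigma_sets ?\<Omega> (code_gen u)"
    unfolding sets_adjoin_cemetery space_adjoin_cemetery
    by (intro sigma_sets_mono) (auto simp: space_adjoin_cemetery)
  then show "sets (adjoin_cemetery M) = sigma_sets ?\<Omega> (code_gen u)"
    using sets.sigma_sets_subset[OF sub] by blast
qed

lemma X'_measurable:
  assumes "y \<in> space M'" "0 \<le> s"
  shows "X' s \<in> P' y \<rightarrow>\<^sub>M adjoin_cemetery M"
  using measurable_compose[OF F.X_measurable_P[OF assms(2,1)] adjoin_cemetery_mono[OF inclusion]] .

lemma one_dimensional_laws_agree:
  assumes u: "coding u" and y: "y \<in> space M'" and s: "0 \<le> s"
  shows "distr (P y) (adjoin_cemetery M) (X s) = distr (P' y) (adjoin_cemetery M) (X' s)"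
proof (rule measure_eqI_generator_eq[OF code_gen_props(1,2)[OF u]])
  have yM: "y \<in> space M" by (rule space_M'[OF y])
  interpret p: prob_space "P y" using yM by (rule E.prob_space_P)
  interpret p': prob_space "P' y" using y by (rule F.prob_space_P)
  note Xm = E.X_measurable_P[OF s yM] and Xm' = X'_measurable[OF y s]
  note cod = u[unfolded coding_def]
  fix A assume "A \<in> code_gen u"
  then consider "A = space (adjoin_cemetery M)" | J a where "finite J" "A = Some ` code_box M u J a"
    by (auto simp: code_gen_def)
  then show "emeasure (distr (P y) (adjoin_cemetery M) (X s)) A = emeasure (distr (P' y) (adjoin_cemetery M) (X' s)) A"
  proof cases
    case 1
    have "emeasure (distr (P y) (adjoin_cemetery M) (X s)) A = 1"
      using prob_space.emeasure_space_1[OF p.prob_space_distr[OF Xm]] 1 by simp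
    moreover have "emeasure (distr (P' y) (adjoin_cemetery M) (X' s)) A = 1"
      using prob_space.emeasure_space_1[OF p'.prob_space_distr[OF Xm']] 1 by simp
    ultimately show ?thesis by simp
  next
    case 2
    obtain c d where inv: "inverts_laplace 1 s c d" using laplace_inversion[OF zero_less_one s] by blast
    have um: "\<And>k. u k \<in> borel_measurable M" using cod by blast
    have L: "(\<lambda>m. ennreal (lim (\<lambda>n. \<Sum>j\<le>d n. c n j * enn2real (kernel_apply (U (1 + real j)) (box_approx u J a m) y))))
     \<longlonglongrightarrow> emeasure (distr (P y) (adjoin_cemetery M) (X s)) (Some ` code_box M u J a)"
      using cod yM by (intro E.box_probability[OF inv zero_less_one s yM um _ _ 2(1)]) auto
    have L': "(\<lambda>m. ennreal (lim (\<lambda>n. \<Sum>j\<le>d n. c n j * enn2real (kernel_apply (U' (1 + real j)) (box_approx u J a m) y))))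
     \<longlonglongrightarrow> emeasure (distr (P' y) (adjoin_cemetery M') (X' s)) (Some ` code_box M' u J a)"
      using cod y space_M' by (intro F.box_probability[OF inv zero_less_one s y measurable_M'[OF um] _ _ 2(1)]) auto
    have "kernel_apply (U' (1 + real j)) (box_approx u J a m) y = kernel_apply (U (1 + real j)) (box_approx u J a m) y" for j m
      by (rule resolvents_agree[OF _ box_approx_measurable[OF um] y]) simp
    from L'[unfolded this] L have eq: "emeasure (distr (P y) (adjoin_cemetery M) (X s)) (Some ` code_box M u J a) =
        emeasure (distr (P' y) (adjoin_cemetery M') (X' s)) (Some ` code_box M' u J a)"
      by (rule LIMSEQ_unique[symmetric])
    have code_box': "code_box M' u J a \<in> sets M'"
    proof -
      have [measurable]: "\<And>k. u k \<in> borel_measurable M'" by (rule measurable_M'[OF um])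
      show ?thesis unfolding code_box_def using 2(1) by measurable
    qed
    have "X' s -` (Some ` code_box M' u J a) \<inter> space (P' y) = X' s -` (Some ` code_box M u J a) \<inter> space (P' y)"
      using measurable_space[OF F.X_measurable_P[OF s y]] space_M'
      by (fastforce simp: code_box_def space_adjoin_cemetery)
    then have "emeasure (distr (P' y) (adjoin_cemetery M') (X' s)) (Some ` code_box M' u J a) =
        emeasure (distr (P' y) (adjoin_cemetery M) (X' s)) (Some ` code_box M u J a)"
      using Some_image_in_adjoin_cemetery[OF code_box'] Some_image_box_in_sets[OF u 2(1)]
      by (simp add: emeasure_distr[OF F.X_measurable_P[OF s y]] emeasure_distr[OF Xm'])
    then show ?thesis using eq 2(2) by simp
  qed
next
  interpret p: prob_space "P y" using space_M'[OF y] by (rule E.prob_space_P)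
  show "range (\<lambda>_::nat. space (adjoin_cemetery M)) \<subseteq> code_gen u" by (auto simp: code_gen_def)
  show "emeasure (distr (P y) (adjoin_cemetery M) (X s)) (space (adjoin_cemetery M)) \<noteq> \<infinity>" for i :: nat
    using prob_space.emeasure_space_1[OF p.prob_space_distr[OF E.X_measurable_P[OF s space_M'[OF y]]]] by simp
qed (simp_all add: code_gen_props(3)[OF u])

text \<open>A process comes with universal measurability in the starting point only. The resolvent is
  Borel measurable, and Laplace inversion passes this on to the transition probabilities.\<close>

lemma law_measurable:
  assumes u: "coding u" and s: "0 \<le> s"
  shows "(\<lambda>y. distr (P y) (adjoin_cemetery M) (X s)) \<in> M \<rightarrow>\<^sub>M prob_algebra (adjoin_cemetery M)"
proof (rule measurable_prob_algebra_generated[OF code_gen_props(3,1,2)[OF u]])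
  show ps: "prob_space (distr (P y) (adjoin_cemetery M) (X s))" if "y \<in> space M" for y
    using prob_space.prob_space_distr[OF E.prob_space_P[OF that] E.X_measurable_P[OF s that]] .
  note cod = u[unfolded coding_def]
  fix A assume "A \<in> code_gen u"
  then consider "A = space (adjoin_cemetery M)" | J a where "finite J" "A = Some ` code_box M u J a"
    by (auto simp: code_gen_def)
  then show "(\<lambda>y. emeasure (distr (P y) (adjoin_cemetery M) (X s)) A) \<in> borel_measurable M"
  proof cases
    case 1
    have "emeasure (distr (P y) (adjoin_cemetery M) (X s)) A = 1" if "y \<in> space M" for y
      using prob_space.emeasure_space_1[OF ps[OF that]] 1 by simp
    then show ?thesis by (simp cong: measurable_cong)
  next
    case 2
    obtain c d where inv: "inverts_laplace 1 s c d" using laplace_inversion[OF zero_less_one s] by blast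
    have um: "\<And>k. u k \<in> borel_measurable M" using cod by blast
    let ?L = "\<lambda>m y. ennreal (lim (\<lambda>n. \<Sum>j\<le>d n. c n j * enn2real (kernel_apply (U (1 + real j)) (box_approx u J a m) y)))"
    have "(\<lambda>m. ?L m y) \<longlonglongrightarrow> emeasure (distr (P y) (adjoin_cemetery M) (X s)) (Some ` code_box M u J a)"
      if yM: "y \<in> space M" for y
      using cod yM by (intro E.box_probability[OF inv zero_less_one s yM um _ _ 2(1)]) auto
    note L = this
    have "emeasure (distr (P y) (adjoin_cemetery M) (X s)) A = liminf (\<lambda>m. ?L m y)" if "y \<in> space M" for y
      using lim_imp_Liminf[OF sequentially_bot L[OF that]] 2(2) by simp
    moreover have km [measurable]: "kernel_apply (U (1 + real j)) (box_approx u J a m) \<in> borel_measurable M" for j m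
      by (rule kernel_apply_measurable[OF resolvent_kernel_on[OF sub_markov] box_approx_measurable[OF um]]) simp
    have "(\<lambda>y. liminf (\<lambda>m. ?L m y)) \<in> borel_measurable M"
      by (intro borel_measurable_liminf measurable_compose[OF _ measurable_ennreal] borel_measurable_lim_metric) measurable
    ultimately show ?thesis by (simp cong: measurable_cong)
  qed
qed simp_all

end

section \<open>Laws of paths at rational times\<close>

definition path_times :: "real set" where
  "path_times = {r \<in> \<rat>. 0 \<le> r}"

definition path_space :: "'a measure \<Rightarrow> (real \<Rightarrow> 'a option) measure" where
  "path_space M = PiM path_times (\<lambda>_. adjoin_cemetery M)"

definition path_of :: "(real \<Rightarrow> 'w \<Rightarrow> 'a option) \<Rightarrow> real \<Rightarrow> 'w \<Rightarrow> real \<Rightarrow> 'a option" where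
  "path_of X a w = (\<lambda>r\<in>path_times. X (a + r) w)"

definition cylinder :: "'a measure \<Rightarrow> real set \<Rightarrow> (real \<Rightarrow> 'a set) \<Rightarrow> (real \<Rightarrow> 'a option) set" where
  "cylinder M J A = {\<omega> \<in> space (path_space M). \<forall>r\<in>J. \<omega> r \<in> Some ` A r}"

text \<open>Constraining coordinates to living points is enough to generate the \<open>\<sigma>\<close>-algebra. It
  means that only functions vanishing at the cemetery occur below.\<close>

definition cylinders :: "'a measure \<Rightarrow> (real \<Rightarrow> 'a option) set set" where
  "cylinders M = {cylinder M J A | J A. finite J \<and> J \<subseteq> path_times \<and> (\<forall>r\<in>J. A r \<in> sets M)}"

lemma path_component_measurable:
  assumes "r \<in> path_times"
  shows "(\<lambda>\<omega>. \<omega> r) \<in> path_space M \<rightarrow>\<^sub>M adjoin_cemetery M"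
  unfolding path_space_def using assms by (rule measurable_component_singleton)

lemma cylinder_in_sets:
  assumes "finite J" "J \<subseteq> path_times" "\<forall>r\<in>J. A r \<in> sets M"
  shows "cylinder M J A \<in> sets (path_space M)"
proof -
  have "{\<omega> \<in> space (path_space M). \<omega> r \<in> Some ` A r} \<in> sets (path_space M)" if "r \<in> J" for r
  proof -
    have "(\<lambda>\<omega>. \<omega> r) -` (Some ` A r) \<inter> space (path_space M) \<in> sets (path_space M)"
      using that assms by (intro measurable_sets[OF path_component_measurable Some_image_in_adjoin_cemetery]) auto
    moreover have "(\<lambda>\<omega>. \<omega> r) -` (Some ` A r) \<inter> space (path_space M) = {\<omega> \<in> space (path_space M). \<omega> r \<in> Some ` A r}"
      by auto
    ultimately show ?thesis by simp
  qed
  then show ?thesis unfolding cylinder_def using assms(1) by (rule sets.sets_Collect_finite_All)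
qed

lemma cylinders_generate:
  "Int_stable (cylinders M)" "cylinders M \<subseteq> Pow (space (path_space M))"
  "sets (path_space M) = sigma_sets (space (path_space M)) (cylinders M)"
  "space (path_space M) \<in> cylinders M"
proof -
  let ?W = "path_space M"
  have sub: "cylinders M \<subseteq> sets ?W"
    unfolding cylinders_def using cylinder_in_sets by blast
  then show pow: "cylinders M \<subseteq> Pow (space ?W)" using sets.sets_into_space by blast
  have "cylinder M {} (\<lambda>_. {}) = space ?W" by (simp add: cylinder_def)
  then show sp: "space ?W \<in> cylinders M" unfolding cylinders_def by force
  show "Int_stable (cylinders M)"
  proof (rule Int_stableI)
    fix A B assume "A \<in> cylinders M" "B \<in> cylinders M"
    then obtain J J' C C' where A: "A = cylinder M J C" "finite J" "J \<subseteq> path_times" "\<forall>r\<in>J. C r \<in> sets M"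
      and B: "B = cylinder M J' C'" "finite J'" "J' \<subseteq> path_times" "\<forall>r\<in>J'. C' r \<in> sets M"
      unfolding cylinders_def by blast
    define D where "D r = (if r \<in> J then if r \<in> J' then C r \<inter> C' r else C r else C' r)" for r
    have D: "\<omega> r \<in> Some ` D r \<longleftrightarrow> (r \<in> J \<longrightarrow> \<omega> r \<in> Some ` C r) \<and> (r \<in> J' \<longrightarrow> \<omega> r \<in> Some ` C' r)"
      if "r \<in> J \<union> J'" for r and \<omega> :: "real \<Rightarrow> 'a option"
      using that by (cases "\<omega> r") (auto simp: D_def)
    have "(\<forall>r\<in>J \<union> J'. \<omega> r \<in> Some ` D r) \<longleftrightarrow>
        (\<forall>r\<in>J \<union> J'. (r \<in> J \<longrightarrow> \<omega> r \<in> Some ` C r) \<and> (r \<in> J' \<longrightarrow> \<omega> r \<in> Some ` C' r))" for \<omega>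
      by (intro ball_cong refl D)
    then have "(\<forall>r\<in>J \<union> J'. \<omega> r \<in> Some ` D r) \<longleftrightarrow>
        (\<forall>r\<in>J. \<omega> r \<in> Some ` C r) \<and> (\<forall>r\<in>J'. \<omega> r \<in> Some ` C' r)" for \<omega>
      by (simp only: Un_iff Ball_def) blast
    then have "A \<inter> B = cylinder M (J \<union> J') D" unfolding A(1) B(1) cylinder_def by blast
    moreover have "\<forall>r\<in>J \<union> J'. D r \<in> sets M" using A(4) B(4) by (auto simp: D_def)
    ultimately show "A \<inter> B \<in> cylinders M"
      unfolding cylinders_def using A(2,3) B(2,3) by blast
  qed
  interpret sa: sigma_algebra "space ?W" "sigma_sets (space ?W) (cylinders M)"
    by (rule sigma_algebra_sigma_sets[OF pow])
  have single: "{\<omega> \<in> space ?W. \<omega> r \<in> S} \<in> sigma_sets (space ?W) (cylinders M)"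
    if r: "r \<in> path_times" and S: "S \<in> sets (adjoin_cemetery M)" for r S
    using S unfolding sets_adjoin_cemetery
  proof (induction rule: sigma_sets.induct)
    case (Basic S)
    then obtain A where A: "S = Some ` A" "A \<in> sets M" by blast
    have "{\<omega> \<in> space ?W. \<omega> r \<in> S} = cylinder M {r} (\<lambda>_. A)" by (simp add: cylinder_def A)
    then have "{\<omega> \<in> space ?W. \<omega> r \<in> S} \<in> cylinders M" unfolding cylinders_def using r A(2) by force
    then show ?case by (rule sigma_sets.Basic)
  next
    case Empty then show ?case by (simp add: sigma_sets.Empty)
  next
    case (Compl S)
    have "{\<omega> \<in> space ?W. \<omega> r \<in> insert None (Some ` space M) - S} = space ?W - {\<omega> \<in> space ?W. \<omega> r \<in> S}"
      using measurable_space[OF path_component_measurable[OF r, of M]] by (auto simp: space_adjoin_cemetery)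
    then show ?case using sigma_sets.Compl[OF Compl.IH] by simp
  next
    case (Union S)
    have "{\<omega> \<in> space ?W. \<omega> r \<in> \<Union>(range S)} = (\<Union>i. {\<omega> \<in> space ?W. \<omega> r \<in> S i})" by auto
    then show ?case using sigma_sets.Union[OF Union.IH] by simp
  qed
  have "sets ?W \<subseteq> sigma_sets (space ?W) (cylinders M)"
  proof -
    have "sets ?W = sigma_sets (space ?W)
        {{f \<in> space ?W. f i \<in> A} | i A. i \<in> path_times \<and> A \<in> sets (adjoin_cemetery M)}"
      unfolding path_space_def space_PiM by (rule sets_PiM_single)
    also have "\<dots> \<subseteq> sigma_sets (space ?W) (cylinders M)"
      by (rule sigma_sets_mono) (use single in blast)
    finally show ?thesis .
  qed
  then show "sets ?W = sigma_sets (space ?W) (cylinders M)"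
    using sets.sigma_sets_subset[OF sub] by blast
qed

lemma path_law_eqI:
  assumes "prob_space L" "prob_space L'" and L: "sets L = sets (path_space M)" and L': "sets L' = sets (path_space M)"
    and eq: "\<And>J A. finite J \<Longrightarrow> J \<noteq> {} \<Longrightarrow> J \<subseteq> path_times \<Longrightarrow> \<forall>r\<in>J. A r \<in> sets M \<Longrightarrow>
      emeasure L (cylinder M J A) = emeasure L' (cylinder M J A)"
  shows "L = L'"
proof (rule measure_eqI_generator_eq[OF cylinders_generate(1,2)])
  interpret L: prob_space L by fact
  interpret L': prob_space L' by fact
  have sp: "space L = space (path_space M)" "space L' = space (path_space M)"
    using L L' by (auto dest: sets_eq_imp_space_eq)
  fix C assume "C \<in> cylinders M"
  then obtain J A where C: "C = cylinder M J A" "finite J" "J \<subseteq> path_times" "\<forall>r\<in>J. A r \<in> sets M"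
    unfolding cylinders_def by blast
  show "emeasure L C = emeasure L' C"
  proof (cases "J = {}")
    case True
    then have "C = space (path_space M)" by (simp add: C cylinder_def)
    then show ?thesis using L.emeasure_space_1 L'.emeasure_space_1 sp by simp
  qed (use eq C in simp)
next
  interpret L: prob_space L by fact
  show "range (\<lambda>_::nat. space (path_space M)) \<subseteq> cylinders M" using cylinders_generate(4) by auto
  show "emeasure L (space (path_space M)) \<noteq> \<infinity>" for i :: nat by simp
qed (simp_all add: cylinders_generate(3)[symmetric] L L')

text \<open>For a Markov process with transition operators \<open>T\<close> that is at \<open>y\<close> at time \<open>r\<close>, the
  value \<open>chain T r [(t\<^sub>1, f\<^sub>1), \<dots>, (t\<^sub>n, f\<^sub>n)] y\<close> is the mean of the product of the \<open>f\<^sub>i\<close> at the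
  states at the times \<open>t\<^sub>i\<close>.\<close>

fun chain :: "(real \<Rightarrow> ('a \<Rightarrow> ennreal) \<Rightarrow> 'a \<Rightarrow> ennreal) \<Rightarrow> real \<Rightarrow> (real \<times> ('a \<Rightarrow> ennreal)) list \<Rightarrow> 'a \<Rightarrow> ennreal" where
  "chain T r [] = (\<lambda>_. 1)"
| "chain T r ((t, f) # l) = T (t - r) (\<lambda>y. f y * chain T t l y)"

lemma chain_measurable:
  assumes T: "\<And>s f. 0 \<le> s \<Longrightarrow> f \<in> borel_measurable M \<Longrightarrow> T s f \<in> borel_measurable M"
    and "sorted (r # map fst l)" "\<forall>(t, f)\<in>set l. f \<in> borel_measurable M"
  shows "chain T r l \<in> borel_measurable M"
  using assms(2,3)
proof (induction l arbitrary: r)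
  case (Cons p l)
  obtain t f where p: "p = (t, f)" by fastforce
  have "chain T t l \<in> borel_measurable M" using Cons.prems by (intro Cons.IH) (auto simp: p)
  moreover have "f \<in> borel_measurable M" using Cons.prems by (simp add: p)
  ultimately have "(\<lambda>y. f y * chain T t l y) \<in> borel_measurable M" by measurable
  then show ?case using Cons.prems unfolding p chain.simps by (intro T) auto
qed simp

lemma extend0_cong:
  assumes "\<And>y. y \<in> space M \<Longrightarrow> f y = g y" "z \<in> space (adjoin_cemetery M)"
  shows "extend0 f z = extend0 g z"
  using assms by (auto simp: extend0_def space_adjoin_cemetery)

lemma extend0_mult: "extend0 (\<lambda>y. f y * g y) z = extend0 f z * extend0 g z"
  by (simp add: extend0_def split: option.split)

context markov_process
begin

text \<open>The factor at the first time is moved into the weight; the induction hypothesis, applied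
  from this time on, collapses all the later factors, and one application of the Markov property leads back to
  time \<open>r\<close>. The functions live on \<open>M0\<close>, so that a process on a subspace can be treated with the transition
  operators of a process on the larger space.\<close>

lemma chain_integral:
  assumes inc: "(\<lambda>x. x) \<in> M \<rightarrow>\<^sub>M M0"
    and Tm: "\<And>s f. 0 \<le> s \<Longrightarrow> f \<in> borel_measurable M0 \<Longrightarrow> T s f \<in> borel_measurable M0"
    and T: "\<And>s f y. 0 \<le> s \<Longrightarrow> f \<in> borel_measurable M0 \<Longrightarrow> y \<in> space M \<Longrightarrow>
      (\<integral>\<^sup>+ v. extend0 f (X s v) \<partial>P y) = T s f y"
    and x: "x \<in> space M" and a: "0 \<le> a"
    and l: "l \<noteq> []" "0 \<le> r" "sorted (r # map fst l)" "\<forall>(t, f)\<in>set l. f \<in> borel_measurable M0"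
    and Y: "Y \<in> borel_measurable (\<F> (a + r))"
  shows "(\<integral>\<^sup>+ w. Y w * (\<Prod>(t, f)\<leftarrow>l. extend0 f (X (a + t) w)) \<partial>P x) =
    (\<integral>\<^sup>+ w. Y w * extend0 (chain T r l) (X (a + r) w) \<partial>P x)"
  using l Y
proof (induction l arbitrary: r Y)
  case (Cons p l)
  obtain t f where p: "p = (t, f)" by fastforce
  have rt: "0 \<le> r" "r \<le> t" and f: "f \<in> borel_measurable M0"
    and sl: "sorted (t # map fst l)" and fl: "\<forall>(t, f)\<in>set l. f \<in> borel_measurable M0"
    using Cons.prems by (auto simp: p)
  have to_M: "g \<in> borel_measurable M" if "g \<in> borel_measurable M0" for g :: "'a \<Rightarrow> ennreal"
    using measurable_compose[OF inc that] .
  let ?c = "chain T t l" and ?g = "\<lambda>y. f y * chain T t l y"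
  have c: "?c \<in> borel_measurable M0" by (rule chain_measurable[OF Tm sl fl])
  have g: "?g \<in> borel_measurable M0" using c f by measurable
  have "(\<integral>\<^sup>+ w. Y w * (\<Prod>(t, f)\<leftarrow>p # l. extend0 f (X (a + t) w)) \<partial>P x) =
      (\<integral>\<^sup>+ w. Y w * extend0 ?g (X (a + t) w) \<partial>P x)"
  proof (cases "l = []")
    case True
    then show ?thesis by (simp add: p)
  next
    case False
    have "Y \<in> borel_measurable (\<F> (a + t))"
    proof -
      have "subalgebra (\<F> (a + t)) (\<F> (a + r))"
        using subalgebra_filtration[of "a + t"] subalgebra_filtration[of "a + r"] filtration_mono[of "a + r" "a + t"] rt a
        by (simp add: subalgebra_def)
      then show ?thesis using Cons.prems(5) measurable_from_subalg by blast
    qed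
    moreover have "(\<lambda>w. extend0 f (X (a + t) w)) \<in> borel_measurable (\<F> (a + t))"
      using rt a by (intro measurable_compose[OF adapted measurable_extend0[OF to_M[OF f]]]) simp
    ultimately have Y': "(\<lambda>w. Y w * extend0 f (X (a + t) w)) \<in> borel_measurable (\<F> (a + t))"
      by (rule borel_measurable_times_ennreal)
    have "0 \<le> t" using rt by simp
    from Cons.IH[OF False this sl fl Y'] show ?thesis
      by (simp add: p mult.assoc extend0_mult)
  qed
  also have "\<dots> = (\<integral>\<^sup>+ w. Y w * extend0 (\<lambda>y. \<integral>\<^sup>+ v. extend0 ?g (X (t - r) v) \<partial>P y) (X (a + r) w) \<partial>P x)"
    using markov_integral[of "t - r" "a + r" Y ?g x] rt a Cons.prems(5) to_M[OF g] x by (simp add: add.assoc)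
  also have "\<dots> = (\<integral>\<^sup>+ w. Y w * extend0 (chain T r (p # l)) (X (a + r) w) \<partial>P x)"
  proof (rule nn_integral_cong)
    fix w assume "w \<in> space (P x)"
    then have "X (a + r) w \<in> space (adjoin_cemetery M)"
      using X_in_space[of "a + r" w] rt a space_P[OF x] by simp
    then have "extend0 (\<lambda>y. \<integral>\<^sup>+ v. extend0 ?g (X (t - r) v) \<partial>P y) (X (a + r) w) = extend0 (chain T r (p # l)) (X (a + r) w)"
      by (rule extend0_cong[rotated]) (use T[OF _ g] rt p in auto)
    then show "Y w * extend0 (\<lambda>y. \<integral>\<^sup>+ v. extend0 ?g (X (t - r) v) \<partial>P y) (X (a + r) w) =
        Y w * extend0 (chain T r (p # l)) (X (a + r) w)" by simp
  qed
  finally show ?case .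
qed simp

lemma path_measurable:
  assumes inc: "(\<lambda>x. x) \<in> M \<rightarrow>\<^sub>M M0" and a: "0 \<le> a" and x: "x \<in> space M"
  shows "path_of X a \<in> P x \<rightarrow>\<^sub>M path_space M0"
  unfolding path_space_def path_of_def
proof (rule measurable_restrict)
  fix r assume "r \<in> path_times"
  then show "X (a + r) \<in> P x \<rightarrow>\<^sub>M adjoin_cemetery M0"
    using a x by (intro measurable_compose[OF X_measurable_P adjoin_cemetery_mono[OF inc]]) (auto simp: path_times_def)
qed

lemma path_law_cylinder:
  assumes inc: "(\<lambda>x. x) \<in> M \<rightarrow>\<^sub>M M0"
    and Tm: "\<And>s f. 0 \<le> s \<Longrightarrow> f \<in> borel_measurable M0 \<Longrightarrow> T s f \<in> borel_measurable M0"
    and T: "\<And>s f y. 0 \<le> s \<Longrightarrow> f \<in> borel_measurable M0 \<Longrightarrow> y \<in> space M \<Longrightarrow>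
      (\<integral>\<^sup>+ v. extend0 f (X s v) \<partial>P y) = T s f y"
    and x: "x \<in> space M" and a: "0 \<le> a"
    and J: "finite J" "J \<noteq> {}" "J \<subseteq> path_times" "\<forall>r\<in>J. A r \<in> sets M0"
  shows "emeasure (distr (P x) (path_space M0) (path_of X a)) (cylinder M0 J A) =
    (\<integral>\<^sup>+ w. extend0 (chain T 0 (map (\<lambda>r. (r, indicator (A r))) (sorted_list_of_set J))) (X a w) \<partial>P x)"
proof -
  let ?l = "map (\<lambda>r. (r, indicator (A r) :: 'a \<Rightarrow> ennreal)) (sorted_list_of_set J)"
  have cyl: "cylinder M0 J A \<in> sets (path_space M0)" by (rule cylinder_in_sets[OF J(1,3,4)])
  have prod: "(\<Prod>(t, f)\<leftarrow>?l. extend0 f (X (a + t) w)) = indicator (path_of X a -` cylinder M0 J A \<inter> space (P x)) w"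
    if w: "w \<in> space (P x)" for w
  proof -
    have "(\<Prod>(t, f)\<leftarrow>?l. extend0 f (X (a + t) w)) = (\<Prod>r\<in>J. extend0 (indicator (A r)) (X (a + r) w))"
      using prod.distinct_set_conv_list[of "sorted_list_of_set J" "\<lambda>r. extend0 (indicator (A r)) (X (a + r) w)"] J(1)
      by (simp add: comp_def)
    also have "\<dots> = (\<Prod>r\<in>J. if X (a + r) w \<in> Some ` A r then 1 else 0)"
      by (intro prod.cong) (auto simp: extend0_def indicator_def split: option.split)
    also have "\<dots> = (if \<forall>r\<in>J. X (a + r) w \<in> Some ` A r then 1 else 0)"
      using J(1) by (auto intro: prod.neutral prod_zero)
    also have "\<dots> = indicator (path_of X a -` cylinder M0 J A \<inter> space (P x)) w"
    proof -
      have "path_of X a w \<in> space (path_space M0)"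
        by (rule measurable_space[OF path_measurable[OF inc a x] w])
      moreover have "path_of X a w r = X (a + r) w" if "r \<in> J" for r
        using that J(3) by (auto simp: path_of_def)
      ultimately have "path_of X a w \<in> cylinder M0 J A \<longleftrightarrow> (\<forall>r\<in>J. X (a + r) w \<in> Some ` A r)"
        by (simp add: cylinder_def)
      then show ?thesis using w by (simp add: indicator_def)
    qed
    finally show ?thesis .
  qed
  have "emeasure (distr (P x) (path_space M0) (path_of X a)) (cylinder M0 J A) =
      emeasure (P x) (path_of X a -` cylinder M0 J A \<inter> space (P x))"
    by (rule emeasure_distr[OF path_measurable[OF inc a x] cyl])
  also have "\<dots> = (\<integral>\<^sup>+ w. indicator (path_of X a -` cylinder M0 J A \<inter> space (P x)) w \<partial>P x)"
    by (rule nn_integral_indicator[symmetric]) (rule measurable_sets[OF path_measurable[OF inc a x] cyl])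
  also have "\<dots> = (\<integral>\<^sup>+ w. 1 * (\<Prod>(t, f)\<leftarrow>?l. extend0 f (X (a + t) w)) \<partial>P x)"
    using prod by (intro nn_integral_cong) simp
  also have "\<dots> = (\<integral>\<^sup>+ w. 1 * extend0 (chain T 0 ?l) (X (a + 0) w) \<partial>P x)"
  proof (rule chain_integral[OF inc Tm T x a])
    show "sorted (0 # map fst ?l)" using J(1,3) by (auto simp: comp_def path_times_def)
    show "?l \<noteq> []" using J(1,2) by simp
    show "\<forall>(t, f)\<in>set ?l. f \<in> borel_measurable M0" using J(1,4) by auto
  qed auto
  finally show ?thesis by simp
qed

end

section \<open>Visits to a negligible set\<close>

text \<open>The code of the state at time \<open>fst p\<close>, read off from a path that is known at rational times only.\<close>

definition code_at :: "(nat \<Rightarrow> 'a \<Rightarrow> ennreal) \<Rightarrow> real \<times> (real \<Rightarrow> 'a option) \<Rightarrow> nat \<Rightarrow> ennreal" where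
  "code_at u p k = liminf (\<lambda>n. extend0 (u k) (snd p (right_grid n (fst p))))"

lemma code_at_measurable:
  assumes u: "\<And>k. u k \<in> borel_measurable M"
  shows "code_at u \<in> borel \<Otimes>\<^sub>M path_space M \<rightarrow>\<^sub>M PiM UNIV (\<lambda>_. borel)"
proof (rule measurable_PiM_single')
  fix k :: nat
  have "(\<lambda>(t, \<omega>). extend0 (u k) (\<omega> (right_grid n t))) \<in> borel_measurable (borel \<Otimes>\<^sub>M path_space M)" for n
    by (rule measurable_right_grid[where Z = "\<lambda>r \<omega>. extend0 (u k) (\<omega> r)"])
      (rule measurable_compose[OF path_component_measurable measurable_extend0[OF u]], simp add: path_times_def)
  then show "(\<lambda>p. code_at u p k) \<in> borel_measurable (borel \<Otimes>\<^sub>M path_space M)"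
    unfolding code_at_def split_beta by (rule borel_measurable_liminf)
qed simp

lemma code_at_path:
  assumes rc: "\<And>k. right_continuous_along X (u k) w" and a: "0 \<le> a" and t: "0 \<le> t"
  shows "code_at u (t, path_of X a w) = (\<lambda>k. extend0 (u k) (X (a + t) w))"
proof
  fix k
  have "right_grid n t \<in> path_times" for n
    using right_grid_nonneg right_grid_rat by (simp add: path_times_def)
  then have "code_at u (t, path_of X a w) k = liminf (\<lambda>n. extend0 (u k) (X (a + right_grid n t) w))"
    by (simp add: code_at_def path_of_def)
  also have "\<dots> = extend0 (u k) (X (a + t) w)"
    by (rule lim_imp_Liminf[OF sequentially_bot right_continuous_along_grid[OF rc a t]])
  finally show "code_at u (t, path_of X a w) k = extend0 (u k) (X (a + t) w)" .
qed

lemma nn_integral_distr_target: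
  "T \<in> L \<rightarrow>\<^sub>M L' \<Longrightarrow> f \<in> borel_measurable L' \<Longrightarrow> integral\<^sup>N (distr L L' T) f = (\<integral>\<^sup>+ x. f (T x) \<partial>L)"
  by (simp add: nn_integral_distr)

context subspace_process
begin

definition transition :: "real \<Rightarrow> ('a \<Rightarrow> ennreal) \<Rightarrow> 'a \<Rightarrow> ennreal" where
  "transition s f y = (\<integral>\<^sup>+ v. extend0 f (X s v) \<partial>P y)"

lemma transition_measurable:
  assumes u: "coding u" and s: "0 \<le> s" and f: "f \<in> borel_measurable M"
  shows "transition s f \<in> borel_measurable M"
proof -
  have "(\<lambda>y. \<integral>\<^sup>+ z. extend0 f z \<partial>distr (P y) (adjoin_cemetery M) (X s)) \<in> borel_measurable M"
    by (rule measurable_compose[OF measurable_prob_algebraD[OF law_measurable[OF u s]]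
          nn_integral_measurable_subprob_algebra[OF measurable_extend0[OF f]]])
  moreover have "transition s f y = (\<integral>\<^sup>+ z. extend0 f z \<partial>distr (P y) (adjoin_cemetery M) (X s))"
    if "y \<in> space M" for y
    unfolding transition_def by (rule nn_integral_distr_target[OF E.X_measurable_P[OF s that] measurable_extend0[OF f], symmetric])
  ultimately show ?thesis by (simp cong: measurable_cong)
qed

lemma transition_agree:
  assumes u: "coding u" and s: "0 \<le> s" and f: "f \<in> borel_measurable M" and y: "y \<in> space M'"
  shows "(\<integral>\<^sup>+ v. extend0 f (X' s v) \<partial>P' y) = transition s f y"
proof -
  have "(\<integral>\<^sup>+ v. extend0 f (X' s v) \<partial>P' y) = (\<integral>\<^sup>+ z. extend0 f z \<partial>distr (P' y) (adjoin_cemetery M) (X' s))"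
    by (rule nn_integral_distr_target[OF X'_measurable[OF y s] measurable_extend0[OF f], symmetric])
  also have "\<dots> = (\<integral>\<^sup>+ z. extend0 f z \<partial>distr (P y) (adjoin_cemetery M) (X s))"
    by (simp only: one_dimensional_laws_agree[OF u y s])
  also have "\<dots> = transition s f y"
    unfolding transition_def by (rule nn_integral_distr_target[OF E.X_measurable_P[OF s space_M'[OF y]] measurable_extend0[OF f]])
  finally show ?thesis .
qed

definition path_law :: "'a \<Rightarrow> (real \<Rightarrow> 'a option) measure" where
  "path_law y = distr (P y) (path_space M) (path_of X 0)"

definition cylinder_chain :: "real set \<Rightarrow> (real \<Rightarrow> 'a set) \<Rightarrow> 'a \<Rightarrow> ennreal" where
  "cylinder_chain J A = chain transition 0 (map (\<lambda>r. (r, indicator (A r))) (sorted_list_of_set J))"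

lemma shifted_path_cylinder:
  assumes u: "coding u" and x: "x \<in> space M" and a: "0 \<le> a"
    and J: "finite J" "J \<noteq> {}" "J \<subseteq> path_times" "\<forall>r\<in>J. A r \<in> sets M"
  shows "emeasure (distr (P x) (path_space M) (path_of X a)) (cylinder M J A) =
    (\<integral>\<^sup>+ w. extend0 (cylinder_chain J A) (X a w) \<partial>P x)"
  unfolding cylinder_chain_def
  by (rule E.path_law_cylinder[OF measurable_ident_sets[OF refl] transition_measurable[OF u] transition_def[symmetric] x a J])

lemma integral_at_start:
  assumes "y \<in> space M"
  shows "(\<integral>\<^sup>+ w. extend0 f (X 0 w) \<partial>P y) = f y"
proof -
  interpret prob_space "P y" using assms by (rule E.prob_space_P)
  have "(\<integral>\<^sup>+ w. extend0 f (X 0 w) \<partial>P y) = (\<integral>\<^sup>+ w. f y \<partial>P y)"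
    using E.normal[OF assms] by (intro nn_integral_cong_AE) (auto elim!: eventually_mono simp: extend0_def)
  then show ?thesis by (simp add: emeasure_space_1)
qed

lemma integral_at_start':
  assumes "y \<in> space M'"
  shows "(\<integral>\<^sup>+ w. extend0 f (X' 0 w) \<partial>P' y) = f y"
proof -
  interpret prob_space "P' y" using assms by (rule F.prob_space_P)
  have "(\<integral>\<^sup>+ w. extend0 f (X' 0 w) \<partial>P' y) = (\<integral>\<^sup>+ w. f y \<partial>P' y)"
    using F.normal[OF assms] by (intro nn_integral_cong_AE) (auto elim!: eventually_mono simp: extend0_def)
  then show ?thesis by (simp add: emeasure_space_1)
qed

lemma path_measurable_E: "0 \<le> a \<Longrightarrow> x \<in> space M \<Longrightarrow> path_of X a \<in> P x \<rightarrow>\<^sub>M path_space M"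
  by (rule E.path_measurable[OF measurable_ident_sets[OF refl]])

lemma emeasure_path_law_cylinder:
  assumes u: "coding u" and y: "y \<in> space M"
    and J: "finite J" "J \<noteq> {}" "J \<subseteq> path_times" "\<forall>r\<in>J. A r \<in> sets M"
  shows "emeasure (path_law y) (cylinder M J A) = cylinder_chain J A y"
  unfolding path_law_def shifted_path_cylinder[OF u y order_refl J] integral_at_start[OF y] ..

text \<open>By the Markov property the transition operators determine the law, and on the smaller space both
  processes have the same ones.\<close>

lemma path_laws_agree:
  assumes u: "coding u" and y: "y \<in> space M'"
  shows "path_law y = distr (P' y) (path_space M) (path_of X' 0)"
proof (rule path_law_eqI)
  note yM = space_M'[OF y]
  show "prob_space (path_law y)" unfolding path_law_def
    by (rule prob_space.prob_space_distr[OF E.prob_space_P[OF yM] path_measurable_E[OF order_refl yM]])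
  show "prob_space (distr (P' y) (path_space M) (path_of X' 0))"
    by (rule prob_space.prob_space_distr[OF F.prob_space_P[OF y] F.path_measurable[OF inclusion order_refl y]])
  fix J A assume J: "finite J" "J \<noteq> {}" "J \<subseteq> path_times" "\<forall>r\<in>J. A r \<in> sets M"
  have "emeasure (distr (P' y) (path_space M) (path_of X' 0)) (cylinder M J A) = cylinder_chain J A y"
    using F.path_law_cylinder[OF inclusion transition_measurable[OF u] transition_agree[OF u] y order_refl J]
    unfolding cylinder_chain_def integral_at_start'[OF y] .
  then show "emeasure (path_law y) (cylinder M J A) =
      emeasure (distr (P' y) (path_space M) (path_of X' 0)) (cylinder M J A)"
    using emeasure_path_law_cylinder[OF u yM J] by simp
qed (simp_all add: path_law_def)

definition dead_path :: "real \<Rightarrow> 'a option" where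
  "dead_path = (\<lambda>r\<in>path_times. None)"

text \<open>The law of the path after some time as a function of the state at this time; from the cemetery only
  the dead path issues.\<close>

definition path_kernel :: "'a option \<Rightarrow> (real \<Rightarrow> 'a option) measure" where
  "path_kernel z = (case z of None \<Rightarrow> return (path_space M) dead_path | Some y \<Rightarrow> path_law y)"

lemma dead_path_in_space: "dead_path \<in> space (path_space M)"
  by (auto simp: dead_path_def path_space_def space_PiM space_adjoin_cemetery)

lemma path_law_measurable:
  assumes u: "coding u"
  shows "path_law \<in> M \<rightarrow>\<^sub>M prob_algebra (path_space M)"
proof (rule measurable_prob_algebra_generated[OF cylinders_generate(3,1,2)])
  show ps: "prob_space (path_law y)" if "y \<in> space M" for y unfolding path_law_def
    by (rule prob_space.prob_space_distr[OF E.prob_space_P[OF that] path_measurable_E[OF order_refl that]])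
  fix C assume "C \<in> cylinders M"
  then obtain J A where C: "C = cylinder M J A" and J: "finite J" "J \<subseteq> path_times" "\<forall>r\<in>J. A r \<in> sets M"
    unfolding cylinders_def by blast
  show "(\<lambda>y. emeasure (path_law y) C) \<in> borel_measurable M"
  proof (cases "J = {}")
    case True
    have "emeasure (path_law y) C = 1" if "y \<in> space M" for y
      using prob_space.emeasure_space_1[OF ps[OF that]] by (simp add: C True cylinder_def path_law_def)
    then show ?thesis by (simp cong: measurable_cong)
  next
    case False
    have "cylinder_chain J A \<in> borel_measurable M"
      unfolding cylinder_chain_def using J
      by (intro chain_measurable[OF transition_measurable[OF u]]) (auto simp: comp_def path_times_def)
    then show ?thesis using emeasure_path_law_cylinder[OF u _ J(1) False J(2,3)] C by (simp cong: measurable_cong)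
  qed
qed (simp add: path_law_def)

lemma path_kernel_measurable:
  assumes u: "coding u"
  shows "path_kernel \<in> adjoin_cemetery M \<rightarrow>\<^sub>M prob_algebra (path_space M)"
proof (rule measurable_adjoin_cemetery)
  show "(\<lambda>x. path_kernel (Some x)) \<in> M \<rightarrow>\<^sub>M prob_algebra (path_space M)"
    using path_law_measurable[OF u] by (simp add: path_kernel_def)
  show "path_kernel None \<in> space (prob_algebra (path_space M))"
    using prob_space_return[OF dead_path_in_space] by (simp add: path_kernel_def space_prob_algebra)
qed

text \<open>Both sides are laws of paths, and on cylinders the Markov property expresses both by the same iterated
  transition operators.\<close>

lemma shifted_path_law:
  assumes u: "coding u" and x: "x \<in> space M" and a: "0 \<le> a" and B: "B \<in> sets (path_space M)"
  shows "emeasure (distr (P x) (path_space M) (path_of X a)) B = (\<integral>\<^sup>+ w. emeasure (path_kernel (X a w)) B \<partial>P x)"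
proof -
  let ?\<mu> = "distr (P x) (adjoin_cemetery M) (X a)"
  interpret prob_space "P x" using x by (rule E.prob_space_P)
  note Xm = E.X_measurable_P[OF a x]
  have km: "path_kernel \<in> ?\<mu> \<rightarrow>\<^sub>M prob_algebra (path_space M)"
    using path_kernel_measurable[OF u] by (simp cong: measurable_cong_sets)
  have ne: "space ?\<mu> \<noteq> {}" by (simp add: space_adjoin_cemetery)
  have \<mu>: "?\<mu> \<in> space (prob_algebra (adjoin_cemetery M))"
    using prob_space_distr[OF Xm] by (simp add: space_prob_algebra)
  have em: "emeasure (?\<mu> \<bind> path_kernel) C = (\<integral>\<^sup>+ w. emeasure (path_kernel (X a w)) C \<partial>P x)"
    if C: "C \<in> sets (path_space M)" for C
  proof -
    have "emeasure (?\<mu> \<bind> path_kernel) C = (\<integral>\<^sup>+ z. emeasure (path_kernel z) C \<partial>?\<mu>)"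
      by (rule emeasure_bind[OF ne measurable_prob_algebraD[OF km] C])
    also have "\<dots> = (\<integral>\<^sup>+ w. emeasure (path_kernel (X a w)) C \<partial>P x)"
      by (rule nn_integral_distr_target[OF Xm measurable_compose[OF
            measurable_prob_algebraD[OF path_kernel_measurable[OF u]] measurable_emeasure_subprob_algebra[OF C]]])
    finally show ?thesis .
  qed
  have "distr (P x) (path_space M) (path_of X a) = ?\<mu> \<bind> path_kernel"
  proof (rule path_law_eqI)
    show "prob_space (distr (P x) (path_space M) (path_of X a))"
      by (rule prob_space_distr[OF path_measurable_E[OF a x]])
    show "prob_space (?\<mu> \<bind> path_kernel)"
      by (rule prob_space_bind'[OF \<mu> path_kernel_measurable[OF u]])
    show "sets (?\<mu> \<bind> path_kernel) = sets (path_space M)"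
      by (rule sets_bind'[OF \<mu> path_kernel_measurable[OF u]])
    fix J A assume J: "finite J" "J \<noteq> {}" "J \<subseteq> path_times" "\<forall>r\<in>J. A r \<in> sets M"
    note cyl = cylinder_in_sets[OF J(1,3,4)]
    have "extend0 (cylinder_chain J A) (X a w) = emeasure (path_kernel (X a w)) (cylinder M J A)"
      if "w \<in> space (P x)" for w
    proof (cases "X a w")
      case None
      have "dead_path \<notin> cylinder M J A" using J(2,3) by (auto simp: cylinder_def dead_path_def)
      then show ?thesis using cyl by (simp add: None extend0_def path_kernel_def)
    next
      case (Some y)
      then have "y \<in> space M" using measurable_space[OF Xm that] by (auto simp: space_adjoin_cemetery)
      then show ?thesis using emeasure_path_law_cylinder[OF u _ J] by (simp add: Some extend0_def path_kernel_def)
    qed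
    then show "emeasure (distr (P x) (path_space M) (path_of X a)) (cylinder M J A) =
        emeasure (?\<mu> \<bind> path_kernel) (cylinder M J A)"
      unfolding em[OF cyl] shifted_path_cylinder[OF u x a J] by (intro nn_integral_cong)
  qed simp
  then show ?thesis using em[OF B] by simp
qed

text \<open>Sets of this form contain the boxes and form a \<open>\<sigma>\<close>-algebra of sets of living points. Complements are taken
  inside \<open>0 < v 0\<close>, the condition on a code that excludes the cemetery.\<close>

lemma coded_set:
  assumes u: "coding u" and N: "N \<in> sets M"
  shows "\<exists>C\<in>sets (PiM UNIV (\<lambda>_::nat. borel :: ennreal measure)).
    \<forall>z\<in>space (adjoin_cemetery M). z \<in> Some ` N \<longleftrightarrow> (\<lambda>k. extend0 (u k) z) \<in> C"
proof -
  let ?V = "PiM UNIV (\<lambda>_::nat. borel :: ennreal measure)"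
  have spV: "space ?V = UNIV" by (simp add: space_PiM)
  have comp [measurable]: "(\<lambda>v. v k) \<in> borel_measurable ?V" for k
    by (rule measurable_component_singleton) simp
  have u0: "u 0 = (\<lambda>_. 1)" using u by (simp add: coding_def)
  have setsM: "sets M = sigma_sets (space M) {code_box M u J a | J a. finite J}" using u by (simp add: coding_def)
  define D where "D N \<longleftrightarrow> (\<exists>C\<in>sets ?V. \<forall>z\<in>space (adjoin_cemetery M). z \<in> Some ` N \<longleftrightarrow> (\<lambda>k. extend0 (u k) z) \<in> C)" for N
  have alive: "{v. 0 < v 0} \<in> sets ?V"
  proof -
    have "{v \<in> space ?V. 0 < v 0} \<in> sets ?V" by measurable
    then show ?thesis by (simp add: spV)
  qed
  from N have "D N" unfolding setsM
  proof (induction rule: sigma_sets.induct)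
    case (Basic N)
    then obtain J a where N: "N = code_box M u J a" and J: "finite J" by blast
    have "{v \<in> space ?V. 0 < v 0 \<and> (\<forall>k\<in>J. a k < enn2real (v k))} \<in> sets ?V" using J by measurable
    then show ?case unfolding D_def
      by (rule bexI[rotated]) (auto simp: spV N code_box_def extend0_def u0 space_adjoin_cemetery)
  next
    case Empty
    show ?case unfolding D_def by (rule bexI[of _ "{}"]) auto
  next
    case (Compl N)
    then obtain C where C: "C \<in> sets ?V" "\<forall>z\<in>space (adjoin_cemetery M). z \<in> Some ` N \<longleftrightarrow> (\<lambda>k. extend0 (u k) z) \<in> C"
      unfolding D_def by blast
    have "z \<in> Some ` (space M - N) \<longleftrightarrow> (\<lambda>k. extend0 (u k) z) \<in> {v. 0 < v 0} - C"
      if z: "z \<in> space (adjoin_cemetery M)" for z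
    proof -
      have "z \<in> Some ` (space M - N) \<longleftrightarrow> z \<noteq> None \<and> z \<notin> Some ` N"
        using z by (auto simp: space_adjoin_cemetery)
      also have "z \<noteq> None \<longleftrightarrow> 0 < extend0 (u 0) z" by (auto simp: extend0_def u0 split: option.split)
      finally show ?thesis using C(2) z by simp
    qed
    then show ?case unfolding D_def using C(1) alive by (intro bexI[of _ "{v. 0 < v 0} - C"]) auto
  next
    case (Union N)
    then have "\<forall>i. \<exists>C. C \<in> sets ?V \<and> (\<forall>z\<in>space (adjoin_cemetery M). z \<in> Some ` N i \<longleftrightarrow> (\<lambda>k. extend0 (u k) z) \<in> C)"
      unfolding D_def by blast
    then obtain C where C: "\<And>i. C i \<in> sets ?V"
      "\<And>i z. z \<in> space (adjoin_cemetery M) \<Longrightarrow> z \<in> Some ` N i \<longleftrightarrow> (\<lambda>k. extend0 (u k) z) \<in> C i"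
      unfolding choice_iff by blast
    have "(\<Union>i. C i) \<in> sets ?V" using C(1) by (intro sets.countable_UN) auto
    moreover have "\<forall>z\<in>space (adjoin_cemetery M). z \<in> Some ` (\<Union>(range N)) \<longleftrightarrow> (\<lambda>k. extend0 (u k) z) \<in> (\<Union>i. C i)"
      using C(2) by (simp add: image_Union image_UN)
    ultimately show ?case unfolding D_def by blast
  qed
  then show ?thesis unfolding D_def .
qed

text \<open>Let \<open>H\<close> be the set of all \<open>(t, \<omega>)\<close> such that the path \<open>\<omega>\<close> has its code in \<open>N\<close> at time \<open>t\<close>. After time
  \<open>a\<close> the path of \<open>X\<close> is a mixture of paths started outside \<open>N\<close>. Their laws are those of \<open>X'\<close>, which never
  enters \<open>N\<close>, so every measurable set inside the projection of \<open>H\<close> is null for the mixture. By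
  capacitability the projection itself is then negligible.\<close>

lemma not_hit_after:
  assumes u: "coding u" and N: "N \<in> sets M" and FN: "\<And>y. y \<in> space M \<Longrightarrow> y \<notin> N \<Longrightarrow> y \<in> space M'"
    and disj: "N \<inter> space M' = {}"
    and x: "x \<in> space M" and a: "0 \<le> a" and start: "AE w in P x. X a w \<notin> Some ` N"
  shows "AE w in P x. \<forall>t\<ge>a. X t w \<notin> Some ` N"
proof -
  obtain C where C: "C \<in> sets (PiM UNIV (\<lambda>_::nat. borel :: ennreal measure))"
    and NC: "\<And>z. z \<in> space (adjoin_cemetery M) \<Longrightarrow> z \<in> Some ` N \<longleftrightarrow> (\<lambda>k. extend0 (u k) z) \<in> C"
    using coded_set[OF u N] by blast
  have um: "\<And>k. u k \<in> borel_measurable M" using u by (simp add: coding_def)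
  let ?W = "path_space M"
  define H where "H = {p \<in> space (borel \<Otimes>\<^sub>M ?W). 0 \<le> fst p \<and> code_at u p \<in> C}"
  have Hsets: "H \<in> sets (borel \<Otimes>\<^sub>M ?W)"
  proof -
    have [measurable]: "code_at u \<in> borel \<Otimes>\<^sub>M ?W \<rightarrow>\<^sub>M PiM UNIV (\<lambda>_. borel)" by (rule code_at_measurable[OF um])
    note [measurable] = C
    show ?thesis unfolding H_def by measurable
  qed
  have Hsnd: "\<omega> \<in> snd ` H \<longleftrightarrow> (\<exists>t\<ge>0. code_at u (t, \<omega>) \<in> C)" if "\<omega> \<in> space ?W" for \<omega>
    using that unfolding H_def by (force simp: space_pair_measure image_iff)
  let ?L = "distr (P x) ?W (path_of X a)"
  interpret px: prob_space "P x" using x by (rule E.prob_space_P)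
  have Lp: "prob_space ?L" by (rule px.prob_space_distr[OF path_measurable_E[OF a x]])
  have "emeasure ?L A = 0" if A: "A \<in> sets ?L" "A \<subseteq> snd ` H" for A
  proof -
    have A': "A \<in> sets ?W" using A(1) by simp
    have null: "emeasure (path_kernel z) A = 0" if z: "z \<in> space (adjoin_cemetery M)" "z \<notin> Some ` N" for z
    proof (cases z)
      case None
      have "code_at u (t, dead_path) = (\<lambda>k. extend0 (u k) None)" for t
      proof
        fix k
        have "right_grid n t \<in> path_times" for n
          using right_grid_nonneg right_grid_rat by (simp add: path_times_def)
        then show "code_at u (t, dead_path) k = extend0 (u k) None"
          by (simp add: code_at_def dead_path_def Liminf_const)
      qed
      then have "dead_path \<notin> snd ` H" using Hsnd[OF dead_path_in_space] NC[of None] by (auto simp: space_adjoin_cemetery)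
      then have "dead_path \<notin> A" using A(2) by blast
      then show ?thesis using A' by (simp add: None path_kernel_def)
    next
      case (Some y)
      then have y: "y \<in> space M'" using z FN by (auto simp: space_adjoin_cemetery)
      have "AE w in P' y. path_of X' 0 w \<notin> A"
      proof -
        have "AE w in P' y. \<forall>k. right_continuous_along X' (u k) w" using u y by (simp add: coding_def)
        then show ?thesis using AE_space
        proof eventually_elim
          case (elim w)
          have pw: "path_of X' 0 w \<in> space ?W"
            by (rule measurable_space[OF F.path_measurable[OF inclusion order_refl y] elim(2)])
          have "code_at u (t, path_of X' 0 w) \<notin> C" if t: "0 \<le> t" for t
          proof -
            have "X' t w \<in> space (adjoin_cemetery M')"
              using F.X_in_space[OF t] elim(2) F.space_P[OF y] by simp
            then have "X' t w \<in> space (adjoin_cemetery M)" "X' t w \<notin> Some ` N"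
              using disj space_M' by (auto simp: space_adjoin_cemetery)
            then show ?thesis using code_at_path[of X' u w 0 t] elim(1) t NC[of "X' t w"] by simp
          qed
          then have "path_of X' 0 w \<notin> snd ` H" using Hsnd[OF pw] by blast
          then show ?case using A(2) by blast
        qed
      qed
      then have "AE \<omega> in distr (P' y) ?W (path_of X' 0). \<omega> \<notin> A"
        by (subst AE_distr_iff[OF F.path_measurable[OF inclusion order_refl y]]) (use A' in auto)
      then have "emeasure (distr (P' y) ?W (path_of X' 0)) A = 0"
        using A' by (subst (asm) AE_iff_measurable[OF _ refl]) (auto dest: sets.sets_into_space simp: Int_absorb1 Int_def[symmetric] Collect_conj_eq)
      then show ?thesis using path_laws_agree[OF u y] by (simp add: Some path_kernel_def)
    qed
    have "emeasure ?L A = (\<integral>\<^sup>+ w. emeasure (path_kernel (X a w)) A \<partial>P x)"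
      by (rule shifted_path_law[OF u x a A'])
    also have "\<dots> = (\<integral>\<^sup>+ w. 0 \<partial>P x)"
    proof (rule nn_integral_cong_AE)
      show "AE w in P x. emeasure (path_kernel (X a w)) A = 0"
        using start AE_space
        by eventually_elim (use null E.X_in_space[OF a] E.space_P[OF x] in auto)
    qed
    finally show ?thesis by simp
  qed
  moreover have "H \<in> sets (borel \<Otimes>\<^sub>M ?L)"
    using Hsets sets_pair_measure_cong[OF refl, of ?W ?L borel] by simp
  ultimately have "AE \<omega> in ?L. \<omega> \<notin> snd ` H"
    using Lp by (intro projection_null prob_space.finite_measure) auto
  then have "AE w in P x. path_of X a w \<notin> snd ` H"
    by (rule AE_distrD[OF path_measurable_E[OF a x]])
  moreover have "AE w in P x. \<forall>k. right_continuous_along X (u k) w" using u x by (simp add: coding_def)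
  ultimately show ?thesis using AE_space
  proof eventually_elim
    case (elim w)
    have pw: "path_of X a w \<in> space ?W"
      by (rule measurable_space[OF path_measurable_E[OF a x] elim(3)])
    show ?case
    proof (intro allI impI)
      fix t assume t: "a \<le> t"
      then have "code_at u (t - a, path_of X a w) \<notin> C" using elim(1) Hsnd[OF pw] by auto
      moreover have "code_at u (t - a, path_of X a w) = (\<lambda>k. extend0 (u k) (X t w))"
        using code_at_path[of X u w a "t - a"] elim(2) t a by simp
      moreover have "X t w \<in> space (adjoin_cemetery M)"
        using E.X_in_space[of t w] t a elim(3) E.space_P[OF x] by simp
      ultimately show "X t w \<notin> Some ` N" using NC by simp
    qed
  qed
qed

text \<open>By Fubini's theorem \<open>U 1 N = 0\<close> says that \<open>X a\<close> avoids \<open>N\<close> almost surely for almost every time \<open>a\<close>, in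
  particular for arbitrarily small ones. This also covers paths that start in \<open>N\<close>.\<close>

lemma good_times:
  assumes u: "coding u" and N: "negligible_set M U N" and x: "x \<in> space M" and e: "0 < e"
  shows "\<exists>a. 0 < a \<and> a < e \<and> (AE w in P x. X a w \<notin> Some ` N)"
proof -
  have Nm: "N \<in> sets M" using N by (simp add: negligible_set_def)
  obtain C where C: "C \<in> sets (PiM UNIV (\<lambda>_::nat. borel :: ennreal measure))"
    and NC: "\<And>z. z \<in> space (adjoin_cemetery M) \<Longrightarrow> z \<in> Some ` N \<longleftrightarrow> (\<lambda>k. extend0 (u k) z) \<in> C"
    using coded_set[OF u Nm] by blast
  have um: "\<And>k. u k \<in> borel_measurable M" using u by (simp add: coding_def)
  interpret px: prob_space "P x" using x by (rule E.prob_space_P)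
  \<comment> \<open>a jointly measurable version of the process that records the visits to \<open>N\<close>\<close>
  define Z where "Z p = (indicator C (code_at u (fst p, path_of X 0 (snd p))) :: ennreal)" for p
  have Zm [measurable]: "Z \<in> borel_measurable (borel \<Otimes>\<^sub>M P x)"
  proof -
    have "(\<lambda>p. (fst p, path_of X 0 (snd p))) \<in> borel \<Otimes>\<^sub>M P x \<rightarrow>\<^sub>M borel \<Otimes>\<^sub>M path_space M"
      by (intro measurable_Pair measurable_fst measurable_compose[OF measurable_snd path_measurable_E[OF order_refl x]])
    from measurable_compose[OF this code_at_measurable[OF um]]
    show ?thesis unfolding Z_def by (rule measurable_compose[OF _ borel_measurable_indicator[OF C]])
  qed
  have ZX: "AE w in P x. \<forall>t\<ge>0. Z (t, w) = extend0 (indicator N) (X t w)"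
  proof -
    have "AE w in P x. \<forall>k. right_continuous_along X (u k) w" using u x by (simp add: coding_def)
    then show ?thesis using AE_space
    proof eventually_elim
      case (elim w)
      show ?case
      proof (intro allI impI)
        fix t :: real assume t: "0 \<le> t"
        have "X t w \<in> space (adjoin_cemetery M)"
          using E.X_in_space[OF t, of w] elim(2) E.space_P[OF x] by simp
        moreover have "Z (t, w) = indicator C (\<lambda>k. extend0 (u k) (X t w))"
          using code_at_path[of X u w 0 t] elim(1) t by (simp add: Z_def)
        ultimately have "Z (t, w) = indicator (Some ` N) (X t w)" using NC[of "X t w"] by (simp add: indicator_def)
        then show "Z (t, w) = extend0 (indicator N) (X t w)"
          by (auto simp: extend0_def indicator_def split: option.split)
      qed
    qed
  qed
  have "(\<integral>\<^sup>+ t. (\<integral>\<^sup>+ w. ennreal (exp (- 1 * t)) * Z (t, w) * indicator {0..} t \<partial>P x) \<partial>lborel) =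
      (\<integral>\<^sup>+ w. (\<integral>\<^sup>+ t\<in>{0..}. ennreal (exp (- 1 * t)) * Z (t, w) \<partial>lborel) \<partial>P x)"
  proof -
    interpret pair_sigma_finite lborel "P x" by unfold_locales
    show ?thesis by (rule Fubini'[symmetric]) measurable
  qed
  also have "\<dots> = (\<integral>\<^sup>+ w. (\<integral>\<^sup>+ t\<in>{0..}. ennreal (exp (- 1 * t)) * extend0 (indicator N) (X t w) \<partial>lborel) \<partial>P x)"
    using ZX by (intro nn_integral_cong_AE) (auto elim!: eventually_mono intro!: nn_integral_cong simp: indicator_def)
  also have "\<dots> = kernel_apply (U 1) (indicator N) x"
    using E.resolvent[of 1 "indicator N" x] Nm x by simp
  also have "\<dots> = 0"
    using negligible_set_all[OF sub_markov N zero_less_one x] Nm resolvent_sets(1)[OF sub_markov zero_less_one x]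
    by (simp add: kernel_apply_def)
  finally have "AE t in lborel. (\<integral>\<^sup>+ w. ennreal (exp (- 1 * t)) * Z (t, w) * indicator {0..} t \<partial>P x) = 0"
    by (subst (asm) nn_integral_0_iff_AE) measurable
  then have *: "AE t in lborel. 0 \<le> t \<longrightarrow> (AE w in P x. X t w \<notin> Some ` N)"
  proof eventually_elim
    case (elim t)
    show ?case
    proof
      assume t: "0 \<le> t"
      have [measurable]: "(\<lambda>w. Z (t, w)) \<in> borel_measurable (P x)" using Zm by measurable
      have "AE w in P x. ennreal (exp (- 1 * t)) * Z (t, w) * indicator {0..} t = 0"
        using elim by (subst (asm) nn_integral_0_iff_AE) measurable
      then have "AE w in P x. Z (t, w) = 0" using t by (auto elim!: eventually_mono)
      then show "AE w in P x. X t w \<notin> Some ` N" using ZX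
        by eventually_elim (use t in \<open>auto simp: extend0_def indicator_def split: option.splits\<close>)
    qed
  qed
  show ?thesis
  proof (rule ccontr)
    assume no: "\<nexists>a. 0 < a \<and> a < e \<and> (AE w in P x. X a w \<notin> Some ` N)"
    from * have "AE t in lborel. t \<notin> {0<..<e}"
      by eventually_elim (use no in \<open>auto intro: less_imp_le\<close>)
    then have "emeasure lborel {0<..<e} = 0"
      by (subst (asm) AE_iff_measurable[OF _ refl]) (auto simp: greaterThanLessThan_def greaterThan_def lessThan_def Int_def)
    then show False using e by simp
  qed
qed

lemma negligible_imp_polar:
  assumes N: "negligible_set M U N" and sp: "space M' = space M - N"
  shows "polar_set M X P N"
proof -
  have Nm: "N \<in> sets M" using N by (simp add: negligible_set_def)
  have "AE w in P x. \<not> hitting_time X N w < \<infinity>" if x: "x \<in> space M" for x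
  proof -
    obtain u where u: "coding u" using coding_exists x by blast
    have "\<forall>n::nat. \<exists>a. 0 < a \<and> a < 1 / real (Suc n) \<and> (AE w in P x. X a w \<notin> Some ` N)"
      using good_times[OF u N x] by simp
    then obtain a where a: "\<And>n::nat. 0 < a n" "\<And>n. a n < 1 / real (Suc n)" "\<And>n. AE w in P x. X (a n) w \<notin> Some ` N"
      unfolding choice_iff by blast
    have "AE w in P x. \<forall>t\<ge>a n. X t w \<notin> Some ` N" for n
      using a(1)[of n] sp by (intro not_hit_after[OF u Nm _ _ x _ a(3)]) auto
    then have "AE w in P x. \<forall>n. \<forall>t\<ge>a n. X t w \<notin> Some ` N" unfolding AE_all_countable ..
    then show ?thesis
    proof eventually_elim
      case (elim w)
      have "X t w \<notin> Some ` N" if t: "0 < t" for t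
      proof -
        obtain n where "inverse (real (Suc n)) < t" using reals_Archimedean[OF t] by blast
        then have "a n \<le> t" using a(2)[of n] by (simp add: inverse_eq_divide)
        then show ?thesis using elim by blast
      qed
      then have empty: "{ennreal t | t. 0 < t \<and> X t w \<in> Some ` N} = {}" by blast
      show ?case unfolding hitting_time_def empty by simp
    qed
  qed
  then show ?thesis using Nm by (simp add: polar_set_def)
qed

end

theorem theorem2p5:
  fixes M :: "'a measure"
    and \<G> :: "'w measure"
    and \<F> :: "real \<Rightarrow> 'w measure"
    and X :: "real \<Rightarrow> 'w \<Rightarrow> 'a option"
    and \<theta> :: "real \<Rightarrow> 'w \<Rightarrow> 'w"
    and P :: "'a \<Rightarrow> 'w measure"
    and U :: "real \<Rightarrow> 'a \<Rightarrow> 'a measure"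
    and N :: "'a set"
  assumes "lusin_measurable_space M"
    and "sub_markov_resolvent M U"
    and "right_process M \<G> \<F> X \<theta> P U"
    and "conservative M X P"
    and "N \<in> sets M"
    and "negligible_set M U N"
    and "\<not> polar_set M X P N"
  shows "\<not> (\<exists>(\<G>' :: 'v measure) \<F>' X' \<theta>' P'.
            right_process (restrict_space M (space M - N)) \<G>' \<F>' X' \<theta>' P'
              (restrict_resolvent (space M - N) U))"
proof
  assume "\<exists>(\<G>' :: 'v measure) \<F>' X' \<theta>' P'.
            right_process (restrict_space M (space M - N)) \<G>' \<F>' X' \<theta>' P'
              (restrict_resolvent (space M - N) U)"
  then obtain \<G>' :: "'v measure" and \<F>' X' \<theta>' P' where
    R': "right_process (restrict_space M (space M - N)) \<G>' \<F>' X' \<theta>' P' (restrict_resolvent (space M - N) U)"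
    by blast
  let ?M' = "restrict_space M (space M - N)" and ?U' = "restrict_resolvent (space M - N) U"
  have sp: "space ?M' = space M - N" by (auto simp: space_restrict_space)
  interpret E: right_process M \<G> \<F> X \<theta> P U by fact
  interpret F: right_process ?M' \<G>' \<F>' X' \<theta>' P' ?U' by fact
  interpret subspace_process M \<G> \<F> X \<theta> P U ?M' \<G>' \<F>' X' \<theta>' P' ?U'
  proof unfold_locales
    show "sub_markov_resolvent M U" by fact
    show "sub_markov_resolvent ?M' ?U'" by (rule sub_markov_resolvent_restrict) fact+
    show "(\<lambda>x. x) \<in> ?M' \<rightarrow>\<^sub>M M" by (rule measurable_restrict_space1) simp
    show "kernel_apply (?U' q) f y = kernel_apply (U q) f y"
      if "0 < q" "f \<in> borel_measurable M" "y \<in> space ?M'" for q f y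
      using assms that sp by (intro kernel_apply_restrict_resolvent) auto
    show "\<exists>T. lusin_topology_on M T" using assms(1) by (simp add: lusin_measurable_space_def)
  qed
  show False using negligible_imp_polar[OF assms(6) sp] assms(7) by blast
qed

end
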